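(* Let $\Bbbk$ be a field and $H$ a finite-dimensional $\Bbbk$-linear bialgebra. Then one has a faithful functor $$i_{br}:({}_H\mathbf{YDAlg}^H)^{\times r}\to\mathbf{BrSyst}_{r+2},$$ $$\overline M=(M_1,\dots,M_r)\mapsto(H,M_1,\dots,M_r,H^*;\overline\sigma_{YDAlg}),$$ $$\overline f=(f_i:M_i\to N_i)_{1\le i\le r}\mapsto(\mathrm{Id}_H,f_1,\dots,f_r,\mathrm{Id}_{H^*}).$$ Moreover, if a braided morphism from $i_{br}(\overline M)$ to $i_{br}(\overline N)$ has the form $(\mathrm{Id}_H,f_1,\dots,f_r,\mathrm{Id}_{H^*})$ and if the $f_i$'s respect units (i.e. $f_i(1_{M_i})=1_{N_i}$), then all the $f_i:M_i\to N_i$ are morphisms in ${}_H\mathbf{YDAlg}^H$.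
   Context: Sweedler notation: $\Delta_H(h)=h_{(1)}\otimes h_{(2)}$, $\delta(v)=v_{(0)}\otimes v_{(1)}\in V\otimes H$ for coactions. Structures on $H^*$ are dual to those of $H$ with the "rainbow" convention: $(l_1l_2)(h)=l_1(h_{(2)})\,l_2(h_{(1)})$, the unit of $H^*$ is $\varepsilon_H$, and the comultiplication $l\mapsto l_{(1)}\otimes l_{(2)}$ is determined by $l(hh')=l_{(1)}(h')\,l_{(2)}(h)$. ${}_H\mathbf{YDAlg}^H$ is the category of Yetter-Drinfel'd module algebras over $H$: vector spaces $V$ with a unital associative algebra structure, a left $H$-module structure and a right $H$-comodule structure such that for all $h\in H$, $v,w\in V$: $(h_{(2)}v)_{(0)}\otimes(h_{(2)}v)_{(1)}h_{(1)}=h_{(1)}v_{(0)}\otimes h_{(2)}v_{(1)}$; $\delta(vw)=v_{(0)}w_{(0)}\otimes v_{(1)}w_{(1)}$; $h(vw)=(h_{(2)}v)(h_{(1)}w)$; $\delta(1_V)=1_V\otimes 1_H$; $h1_V=\varepsilon_H(h)1_V$. Its morphisms are linear maps that are simultaneously unital algebra, $H$-module and $H$-comodule morphisms. A braided system of rank $t$ (in $\Bbbk$-vector spaces) is an ordered family $V_1,\dots,V_t$ with linear maps $\sigma_{i,j}:V_i\otimes V_j\to V_j\otimes V_i$ for $1\le i\le j\le t$ satisfying, for all $1\le i\le j\le k\le t$, $$(\sigma_{j,k}\otimes\mathrm{Id}_i)(\mathrm{Id}_j\otimes\sigma_{i,k})(\sigma_{i,j}\otimes\mathrm{Id}_k)=(\mathrm{Id}_k\otimes\sigma_{i,j})(\sigma_{i,k}\otimes\mathrm{Id}_j)(\mathrm{Id}_i\otimes\sigma_{j,k}).$$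 A braided morphism $(\overline V,\overline\sigma)\to(\overline W,\overline\xi)$ between systems of the same rank $t$ is a family of linear maps $f_i:V_i\to W_i$ with $(f_j\otimes f_i)\circ\sigma_{i,j}=\xi_{i,j}\circ(f_i\otimes f_j)$ for all $1\le i\le j\le t$. $\mathbf{BrSyst}_t$ is the category of rank $t$ braided systems and braided morphisms in $\Bbbk$-vector spaces. The braiding $\overline\sigma_{YDAlg}$ on $(H,M_1,\dots,M_r,H^* )$ is: $\sigma_{H,H}:h_1\otimes h_2\mapsto h_1h_2\otimes 1_H$; $\sigma_{H^*,H^*}:l_1\otimes l_2\mapsto\varepsilon_H\otimes l_1l_2$; $\sigma_{H,H^*}:h\otimes l\mapsto l_{(1)}(h_{(2)})\,l_{(2)}\otimes h_{(1)}$; $\sigma_{M_i,M_i}:m_1\otimes m_2\mapsto 1_{M_i}\otimes m_1m_2$; $\sigma_{M_i,M_j}:m\otimes n\mapsto m_{(1)}n\otimes m_{(0)}$ for $i<j$; $\sigma_{H,M_i}:h\otimes m\mapsto h_{(2)}m\otimes h_{(1)}$; $\sigma_{M_i,H^*}:m\otimes l\mapsto l_{(1)}(m_{(1)})\,l_{(2)}\otimes m_{(0)}$. *)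

theory Defs
  imports
    "Jordan_Normal_Form.Missing_VectorSpace"
    "HOL-Algebra.QuotRing"
begin

section \<open>Tensor products of vector spaces\<close>

text \<open>
  The tensor product is the free vector space on the product of the carriers, modulo the subspace
  spanned by the bilinearity relators. The fields mult and one of a module record carry no meaning
  for a bare vector space and are left undefined.
\<close>

definition free_space :: "('k, 'r) ring_scheme \<Rightarrow> 'x set \<Rightarrow> ('k, 'x \<Rightarrow> 'k) module" where
  "free_space K X =
    \<lparr>carrier = {c. range c \<subseteq> carrier K \<and> finite {x. c x \<noteq> \<zero>\<^bsub>K\<^esub>} \<and> {x. c x \<noteq> \<zero>\<^bsub>K\<^esub>} \<subseteq> X},
     mult = undefined, one = undefined,
     zero = (\<lambda>_. \<zero>\<^bsub>K\<^esub>),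
     add = (\<lambda>c d x. c x \<oplus>\<^bsub>K\<^esub> d x),
     smult = (\<lambda>a c x. a \<otimes>\<^bsub>K\<^esub> c x)\<rparr>"

definition free_gen :: "('k, 'r) ring_scheme \<Rightarrow> 'x \<Rightarrow> ('x \<Rightarrow> 'k)" where
  "free_gen K x = (\<lambda>y. if y = x then \<one>\<^bsub>K\<^esub> else \<zero>\<^bsub>K\<^esub>)"

definition quotient_space ::
  "('k, 'r) ring_scheme \<Rightarrow> ('k, 'v, 'a) module_scheme \<Rightarrow> 'v set \<Rightarrow> ('k, 'v set) module" where
  "quotient_space K V W =
    \<lparr>carrier = a_rcosets\<^bsub>V\<^esub> W,
     mult = undefined, one = undefined,
     zero = W,
     add = set_add V,
     smult = (\<lambda>a X. \<Union>x\<in>X. W +>\<^bsub>V\<^esub> (a \<odot>\<^bsub>V\<^esub> x))\<rparr>"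

definition bilinear_relators ::
  "('k, 'r) ring_scheme \<Rightarrow> ('k, 'v, 'a) module_scheme \<Rightarrow> ('k, 'w, 'b) module_scheme
    \<Rightarrow> ('v \<times> 'w \<Rightarrow> 'k) set" where
  "bilinear_relators K V W = (let F = free_space K (carrier V \<times> carrier W); e = free_gen K in
     {e (v \<oplus>\<^bsub>V\<^esub> v', w) \<ominus>\<^bsub>F\<^esub> (e (v, w) \<oplus>\<^bsub>F\<^esub> e (v', w)) | v v' w.
        v \<in> carrier V \<and> v' \<in> carrier V \<and> w \<in> carrier W}
   \<union> {e (v, w \<oplus>\<^bsub>W\<^esub> w') \<ominus>\<^bsub>F\<^esub> (e (v, w) \<oplus>\<^bsub>F\<^esub> e (v, w')) | v w w'.
        v \<in> carrier V \<and> w \<in> carrier W \<and> w' \<in> carrier W}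
   \<union> {e (a \<odot>\<^bsub>V\<^esub> v, w) \<ominus>\<^bsub>F\<^esub> (a \<odot>\<^bsub>F\<^esub> e (v, w)) | a v w.
        a \<in> carrier K \<and> v \<in> carrier V \<and> w \<in> carrier W}
   \<union> {e (v, a \<odot>\<^bsub>W\<^esub> w) \<ominus>\<^bsub>F\<^esub> (a \<odot>\<^bsub>F\<^esub> e (v, w)) | a v w.
        a \<in> carrier K \<and> v \<in> carrier V \<and> w \<in> carrier W})"

definition tensor_null ::
  "('k, 'r) ring_scheme \<Rightarrow> ('k, 'v, 'a) module_scheme \<Rightarrow> ('k, 'w, 'b) module_scheme
    \<Rightarrow> ('v \<times> 'w \<Rightarrow> 'k) set" where
  "tensor_null K V W =
    LinearCombinations.module.span K (free_space K (carrier V \<times> carrier W)) (bilinear_relators K V W)"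

definition tensor ::
  "('k, 'r) ring_scheme \<Rightarrow> ('k, 'v, 'a) module_scheme \<Rightarrow> ('k, 'w, 'b) module_scheme
    \<Rightarrow> ('k, ('v \<times> 'w \<Rightarrow> 'k) set) module" where
  "tensor K V W = quotient_space K (free_space K (carrier V \<times> carrier W)) (tensor_null K V W)"

definition pure_tensor ::
  "('k, 'r) ring_scheme \<Rightarrow> ('k, 'v, 'a) module_scheme \<Rightarrow> ('k, 'w, 'b) module_scheme
    \<Rightarrow> 'v \<Rightarrow> 'w \<Rightarrow> ('v \<times> 'w \<Rightarrow> 'k) set" where
  "pure_tensor K V W v w =
    tensor_null K V W +>\<^bsub>free_space K (carrier V \<times> carrier W)\<^esub> free_gen K (v, w)"

text \<open>
  The value at a tensor t of the linear map into U induced by a bilinear map b, computed on an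
  arbitrary representative of t (the value does not depend on it when b is bilinear).
  It renders Sweedler notation: an expression b(t1, t2), linear in both components of
  t = t1 (x) t2 (summation understood), is written tensor_lift K U t b.
\<close>

definition tensor_lift ::
  "('k, 'r) ring_scheme \<Rightarrow> ('k, 'u, 'a) module_scheme \<Rightarrow> ('v \<times> 'w \<Rightarrow> 'k) set
    \<Rightarrow> ('v \<Rightarrow> 'w \<Rightarrow> 'u) \<Rightarrow> 'u" where
  "tensor_lift K U t b = (let c = (SOME c. c \<in> t) in
     \<Oplus>\<^bsub>U\<^esub>p\<in>{p. c p \<noteq> \<zero>\<^bsub>K\<^esub>}. c p \<odot>\<^bsub>U\<^esub> b (fst p) (snd p))"

definition tensor_map ::
  "('k, 'r) ring_scheme \<Rightarrow> ('k, 'v, 'a) module_scheme \<Rightarrow> ('k, 'w, 'b) module_scheme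
    \<Rightarrow> ('k, 'v2, 'c) module_scheme \<Rightarrow> ('k, 'w2, 'd) module_scheme
    \<Rightarrow> ('v \<Rightarrow> 'v2) \<Rightarrow> ('w \<Rightarrow> 'w2) \<Rightarrow> ('v \<times> 'w \<Rightarrow> 'k) set \<Rightarrow> ('v2 \<times> 'w2 \<Rightarrow> 'k) set" where
  "tensor_map K V W V2 W2 f g = (\<lambda>t\<in>carrier (tensor K V W).
     tensor_lift K (tensor K V2 W2) t (\<lambda>v w. pure_tensor K V2 W2 (f v) (g w)))"

definition tensor_assoc ::
  "('k, 'r) ring_scheme \<Rightarrow> ('k, 'u, 'a) module_scheme \<Rightarrow> ('k, 'v, 'b) module_scheme
    \<Rightarrow> ('k, 'w, 'c) module_scheme
    \<Rightarrow> (('u \<times> 'v \<Rightarrow> 'k) set \<times> 'w \<Rightarrow> 'k) set \<Rightarrow> ('u \<times> ('v \<times> 'w \<Rightarrow> 'k) set \<Rightarrow> 'k) set" where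
  "tensor_assoc K U V W = (\<lambda>t\<in>carrier (tensor K (tensor K U V) W).
     tensor_lift K (tensor K U (tensor K V W)) t (\<lambda>p w.
       tensor_lift K (tensor K U (tensor K V W)) p (\<lambda>u v.
         pure_tensor K U (tensor K V W) u (pure_tensor K V W v w))))"

definition tensor_unassoc ::
  "('k, 'r) ring_scheme \<Rightarrow> ('k, 'u, 'a) module_scheme \<Rightarrow> ('k, 'v, 'b) module_scheme
    \<Rightarrow> ('k, 'w, 'c) module_scheme
    \<Rightarrow> ('u \<times> ('v \<times> 'w \<Rightarrow> 'k) set \<Rightarrow> 'k) set \<Rightarrow> (('u \<times> 'v \<Rightarrow> 'k) set \<times> 'w \<Rightarrow> 'k) set" where
  "tensor_unassoc K U V W = (\<lambda>t\<in>carrier (tensor K U (tensor K V W)).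
     tensor_lift K (tensor K (tensor K U V) W) t (\<lambda>u q.
       tensor_lift K (tensor K (tensor K U V) W) q (\<lambda>v w.
         pure_tensor K (tensor K U V) W (pure_tensor K U V u v) w)))"

definition self_space :: "('k, 'r) ring_scheme \<Rightarrow> ('k, 'k) module" where
  "self_space K =
    \<lparr>carrier = carrier K, mult = mult K, one = one K, zero = zero K, add = add K, smult = mult K\<rparr>"


section \<open>Bialgebras and their duals\<close>

text \<open>The locale algebra of the library only covers commutative algebras.\<close>

locale unital_algebra = vectorspace K A + alg: ring A
  for K :: "('k, 'r) ring_scheme" and A :: "('k, 'a, 'm) module_scheme" +
  assumes smult_mult_left: "\<lbrakk>c \<in> carrier K; x \<in> carrier A; y \<in> carrier A\<rbrakk>
      \<Longrightarrow> (c \<odot>\<^bsub>A\<^esub> x) \<otimes>\<^bsub>A\<^esub> y = c \<odot>\<^bsub>A\<^esub> (x \<otimes>\<^bsub>A\<^esub> y)"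
    and smult_mult_right: "\<lbrakk>c \<in> carrier K; x \<in> carrier A; y \<in> carrier A\<rbrakk>
      \<Longrightarrow> x \<otimes>\<^bsub>A\<^esub> (c \<odot>\<^bsub>A\<^esub> y) = c \<odot>\<^bsub>A\<^esub> (x \<otimes>\<^bsub>A\<^esub> y)"

record ('k, 'h) bialgebra = "('k, 'h) module" +
  comult :: "'h \<Rightarrow> ('h \<times> 'h \<Rightarrow> 'k) set"
  counit :: "'h \<Rightarrow> 'k"

locale bialgebra = unital_algebra K H
  for K :: "('k, 'r) ring_scheme" and H :: "('k, 'h) bialgebra" +
  assumes comult_linear: "comult H \<in> module_hom K H (tensor K H H)"
    and counit_linear: "counit H \<in> module_hom K H (self_space K)"
    and coassoc: "h \<in> carrier H \<Longrightarrow>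
      tensor_lift K (tensor K H (tensor K H H)) (comult H h) (\<lambda>h1 h2.
        tensor_lift K (tensor K H (tensor K H H)) (comult H h1) (\<lambda>h11 h12.
          pure_tensor K H (tensor K H H) h11 (pure_tensor K H H h12 h2)))
      = tensor_lift K (tensor K H (tensor K H H)) (comult H h) (\<lambda>h1 h2.
          pure_tensor K H (tensor K H H) h1 (comult H h2))"
    and counit_left: "h \<in> carrier H \<Longrightarrow>
      tensor_lift K H (comult H h) (\<lambda>h1 h2. counit H h1 \<odot>\<^bsub>H\<^esub> h2) = h"
    and counit_right: "h \<in> carrier H \<Longrightarrow>
      tensor_lift K H (comult H h) (\<lambda>h1 h2. counit H h2 \<odot>\<^bsub>H\<^esub> h1) = h"
    and comult_mult: "\<lbrakk>g \<in> carrier H; h \<in> carrier H\<rbrakk> \<Longrightarrow>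
      comult H (g \<otimes>\<^bsub>H\<^esub> h) =
        tensor_lift K (tensor K H H) (comult H g) (\<lambda>g1 g2.
          tensor_lift K (tensor K H H) (comult H h) (\<lambda>h1 h2.
            pure_tensor K H H (g1 \<otimes>\<^bsub>H\<^esub> h1) (g2 \<otimes>\<^bsub>H\<^esub> h2)))"
    and comult_one: "comult H \<one>\<^bsub>H\<^esub> = pure_tensor K H H \<one>\<^bsub>H\<^esub> \<one>\<^bsub>H\<^esub>"
    and counit_mult: "\<lbrakk>g \<in> carrier H; h \<in> carrier H\<rbrakk> \<Longrightarrow>
      counit H (g \<otimes>\<^bsub>H\<^esub> h) = counit H g \<otimes>\<^bsub>K\<^esub> counit H h"
    and counit_one: "counit H \<one>\<^bsub>H\<^esub> = \<one>\<^bsub>K\<^esub>"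

text \<open>
  The dual algebra with the rainbow convention (l1 l2)(h) = l1(h2) l2(h1). Functionals are
  normalised to be undefined outside the carrier, so that equality of elements is equality of maps.
\<close>

definition dual_space :: "('k, 'r) ring_scheme \<Rightarrow> ('k, 'h) bialgebra \<Rightarrow> ('k, 'h \<Rightarrow> 'k) module" where
  "dual_space K H =
    \<lparr>carrier = module_hom K H (self_space K) \<inter> extensional (carrier H),
     mult = (\<lambda>l1 l2. \<lambda>h\<in>carrier H.
       tensor_lift K (self_space K) (comult H h) (\<lambda>h1 h2. l1 h2 \<otimes>\<^bsub>K\<^esub> l2 h1)),
     one = (\<lambda>h\<in>carrier H. counit H h),
     zero = (\<lambda>h\<in>carrier H. \<zero>\<^bsub>K\<^esub>),
     add = (\<lambda>l1 l2. \<lambda>h\<in>carrier H. l1 h \<oplus>\<^bsub>K\<^esub> l2 h),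
     smult = (\<lambda>c l. \<lambda>h\<in>carrier H. c \<otimes>\<^bsub>K\<^esub> l h)\<rparr>"

text \<open>
  The comultiplication of the dual, determined by l(h h') = l1(h') l2(h). Existence of such a
  tensor requires H to be finite-dimensional.
\<close>

definition dual_comult ::
  "('k, 'r) ring_scheme \<Rightarrow> ('k, 'h) bialgebra \<Rightarrow> ('h \<Rightarrow> 'k) \<Rightarrow> (('h \<Rightarrow> 'k) \<times> ('h \<Rightarrow> 'k) \<Rightarrow> 'k) set"
  where
  "dual_comult K H l = (THE t. t \<in> carrier (tensor K (dual_space K H) (dual_space K H)) \<and>
     (\<forall>h\<in>carrier H. \<forall>h'\<in>carrier H.
        l (h \<otimes>\<^bsub>H\<^esub> h') = tensor_lift K (self_space K) t (\<lambda>l1 l2. l1 h' \<otimes>\<^bsub>K\<^esub> l2 h)))"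


section \<open>Categories\<close>

text \<open>
  Hom-sets need not be disjoint, so the composition of g : B -> C with f : A -> B is written
  Comp X A B C g f.
\<close>

record ('o, 'm) cat =
  Ob :: "'o set"
  Hom :: "'o \<Rightarrow> 'o \<Rightarrow> 'm set"
  Ident :: "'o \<Rightarrow> 'm"
  Comp :: "'o \<Rightarrow> 'o \<Rightarrow> 'o \<Rightarrow> 'm \<Rightarrow> 'm \<Rightarrow> 'm"

locale category =
  fixes X :: "('o, 'm) cat"
  assumes Ident_in: "A \<in> Ob X \<Longrightarrow> Ident X A \<in> Hom X A A"
    and Comp_in: "\<lbrakk>A \<in> Ob X; B \<in> Ob X; C \<in> Ob X; f \<in> Hom X A B; g \<in> Hom X B C\<rbrakk>
      \<Longrightarrow> Comp X A B C g f \<in> Hom X A C"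
    and Comp_Ident: "\<lbrakk>A \<in> Ob X; B \<in> Ob X; f \<in> Hom X A B\<rbrakk> \<Longrightarrow> Comp X A A B f (Ident X A) = f"
    and Ident_Comp: "\<lbrakk>A \<in> Ob X; B \<in> Ob X; f \<in> Hom X A B\<rbrakk> \<Longrightarrow> Comp X A B B (Ident X B) f = f"
    and Comp_assoc: "\<lbrakk>A \<in> Ob X; B \<in> Ob X; C \<in> Ob X; D \<in> Ob X;
        f \<in> Hom X A B; g \<in> Hom X B C; h \<in> Hom X C D\<rbrakk>
      \<Longrightarrow> Comp X A C D h (Comp X A B C g f) = Comp X A B D (Comp X B C D h g) f"

locale cat_functor = source: category X + target: category Y
  for X :: "('o, 'm) cat" and Y :: "('p, 'n) cat" +
  fixes Fo :: "'o \<Rightarrow> 'p" and Fm :: "'o \<Rightarrow> 'o \<Rightarrow> 'm \<Rightarrow> 'n"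
  assumes Fo_in: "A \<in> Ob X \<Longrightarrow> Fo A \<in> Ob Y"
    and Fm_in: "\<lbrakk>A \<in> Ob X; B \<in> Ob X; f \<in> Hom X A B\<rbrakk> \<Longrightarrow> Fm A B f \<in> Hom Y (Fo A) (Fo B)"
    and Fm_Ident: "A \<in> Ob X \<Longrightarrow> Fm A A (Ident X A) = Ident Y (Fo A)"
    and Fm_Comp: "\<lbrakk>A \<in> Ob X; B \<in> Ob X; C \<in> Ob X; f \<in> Hom X A B; g \<in> Hom X B C\<rbrakk>
      \<Longrightarrow> Fm A C (Comp X A B C g f) = Comp Y (Fo A) (Fo B) (Fo C) (Fm B C g) (Fm A B f)"

locale faithful_functor = cat_functor +
  assumes faithful: "\<lbrakk>A \<in> Ob X; B \<in> Ob X\<rbrakk> \<Longrightarrow> inj_on (Fm A B) (Hom X A B)"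

definition power_cat :: "('o, 'm) cat \<Rightarrow> nat \<Rightarrow> (nat \<Rightarrow> 'o, nat \<Rightarrow> 'm) cat" where
  "power_cat X r =
    \<lparr>Ob = {1..r} \<rightarrow>\<^sub>E Ob X,
     Hom = (\<lambda>A B. \<Pi>\<^sub>E i\<in>{1..r}. Hom X (A i) (B i)),
     Ident = (\<lambda>A. \<lambda>i\<in>{1..r}. Ident X (A i)),
     Comp = (\<lambda>A B C g f. \<lambda>i\<in>{1..r}. Comp X (A i) (B i) (C i) (g i) (f i))\<rparr>"


section \<open>Yetter-Drinfeld module algebras\<close>

record ('k, 'h, 'v) yd_algebra = "('k, 'v) module" +
  act :: "'h \<Rightarrow> 'v \<Rightarrow> 'v"
  coact :: "'v \<Rightarrow> ('v \<times> 'h \<Rightarrow> 'k) set"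

locale yd_module_algebra = H: bialgebra K H + M: unital_algebra K M
  for K :: "('k, 'r) ring_scheme" and H :: "('k, 'h) bialgebra"
    and M :: "('k, 'h, 'v) yd_algebra" +
  assumes act_linear_left: "v \<in> carrier M \<Longrightarrow> (\<lambda>h. act M h v) \<in> module_hom K H M"
    and act_linear_right: "h \<in> carrier H \<Longrightarrow> act M h \<in> module_hom K M M"
    and act_mult: "\<lbrakk>g \<in> carrier H; h \<in> carrier H; v \<in> carrier M\<rbrakk>
      \<Longrightarrow> act M (g \<otimes>\<^bsub>H\<^esub> h) v = act M g (act M h v)"
    and act_one: "v \<in> carrier M \<Longrightarrow> act M \<one>\<^bsub>H\<^esub> v = v"
    and coact_linear: "coact M \<in> module_hom K M (tensor K M H)"
    and coact_coassoc: "v \<in> carrier M \<Longrightarrow>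
      tensor_lift K (tensor K M (tensor K H H)) (coact M v) (\<lambda>v0 v1.
        tensor_lift K (tensor K M (tensor K H H)) (coact M v0) (\<lambda>v00 v01.
          pure_tensor K M (tensor K H H) v00 (pure_tensor K H H v01 v1)))
      = tensor_lift K (tensor K M (tensor K H H)) (coact M v) (\<lambda>v0 v1.
          pure_tensor K M (tensor K H H) v0 (comult H v1))"
    and coact_counit: "v \<in> carrier M \<Longrightarrow>
      tensor_lift K M (coact M v) (\<lambda>v0 v1. counit H v1 \<odot>\<^bsub>M\<^esub> v0) = v"
    and yetter_drinfeld: "\<lbrakk>h \<in> carrier H; v \<in> carrier M\<rbrakk> \<Longrightarrow>
      tensor_lift K (tensor K M H) (comult H h) (\<lambda>h1 h2.
        tensor_lift K (tensor K M H) (coact M (act M h2 v)) (\<lambda>x0 x1.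
          pure_tensor K M H x0 (x1 \<otimes>\<^bsub>H\<^esub> h1)))
      = tensor_lift K (tensor K M H) (comult H h) (\<lambda>h1 h2.
          tensor_lift K (tensor K M H) (coact M v) (\<lambda>v0 v1.
            pure_tensor K M H (act M h1 v0) (h2 \<otimes>\<^bsub>H\<^esub> v1)))"
    and coact_prod: "\<lbrakk>v \<in> carrier M; w \<in> carrier M\<rbrakk> \<Longrightarrow>
      coact M (v \<otimes>\<^bsub>M\<^esub> w) =
        tensor_lift K (tensor K M H) (coact M v) (\<lambda>v0 v1.
          tensor_lift K (tensor K M H) (coact M w) (\<lambda>w0 w1.
            pure_tensor K M H (v0 \<otimes>\<^bsub>M\<^esub> w0) (v1 \<otimes>\<^bsub>H\<^esub> w1)))"
    and act_prod: "\<lbrakk>h \<in> carrier H; v \<in> carrier M; w \<in> carrier M\<rbrakk> \<Longrightarrow>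
      act M h (v \<otimes>\<^bsub>M\<^esub> w) =
        tensor_lift K M (comult H h) (\<lambda>h1 h2. act M h2 v \<otimes>\<^bsub>M\<^esub> act M h1 w)"
    and coact_unit: "coact M \<one>\<^bsub>M\<^esub> = pure_tensor K M H \<one>\<^bsub>M\<^esub> \<one>\<^bsub>H\<^esub>"
    and act_unit: "h \<in> carrier H \<Longrightarrow> act M h \<one>\<^bsub>M\<^esub> = counit H h \<odot>\<^bsub>M\<^esub> \<one>\<^bsub>M\<^esub>"

definition yd_hom ::
  "('k, 'r) ring_scheme \<Rightarrow> ('k, 'h) bialgebra \<Rightarrow> ('k, 'h, 'v) yd_algebra \<Rightarrow> ('k, 'h, 'v) yd_algebra
    \<Rightarrow> ('v \<Rightarrow> 'v) set" where
  "yd_hom K H M N = {f \<in> extensional (carrier M).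
     f \<in> module_hom K M N \<and> f \<in> ring_hom M N \<and>
     (\<forall>h\<in>carrier H. \<forall>v\<in>carrier M. f (act M h v) = act N h (f v)) \<and>
     (\<forall>v\<in>carrier M. coact N (f v) =
        tensor_lift K (tensor K N H) (coact M v) (\<lambda>v0 v1. pure_tensor K N H (f v0) v1))}"

definition YDAlg ::
  "('k, 'r) ring_scheme \<Rightarrow> ('k, 'h) bialgebra \<Rightarrow> (('k, 'h, 'v) yd_algebra, 'v \<Rightarrow> 'v) cat" where
  "YDAlg K H =
    \<lparr>Ob = {M. yd_module_algebra K H M},
     Hom = yd_hom K H,
     Ident = (\<lambda>M. \<lambda>v\<in>carrier M. v),
     Comp = (\<lambda>L M N g f. compose (carrier L) g f)\<rparr>"


section \<open>Braided systems\<close>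

text \<open>
  A system of rank t is indexed by 1..t. Families and maps are normalised to be undefined outside
  their domains, so that equality of records is equality of systems.
\<close>

record ('k, 'u) brsystem =
  space :: "nat \<Rightarrow> ('k, 'u) module"
  braid :: "nat \<times> nat \<Rightarrow> ('u \<times> 'u \<Rightarrow> 'k) set \<Rightarrow> ('u \<times> 'u \<Rightarrow> 'k) set"

definition yang_baxter ::
  "('k, 'r) ring_scheme \<Rightarrow> ('k, 'u) brsystem \<Rightarrow> nat \<Rightarrow> nat \<Rightarrow> nat \<Rightarrow> bool" where
  "yang_baxter K S i j k = (let A = space S i; B = space S j; C = space S k;
       AB = tensor K A B; BA = tensor K B A; AC = tensor K A C; CA = tensor K C A;
       BC = tensor K B C; CB = tensor K C B;
       s_ij = braid S (i, j); s_ik = braid S (i, k); s_jk = braid S (j, k) in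
     \<forall>t\<in>carrier (tensor K AB C).
       tensor_map K BC A CB A s_jk id
         (tensor_unassoc K B C A
           (tensor_map K B AC B CA id s_ik
             (tensor_assoc K B A C
               (tensor_map K AB C BA C s_ij id t))))
       = tensor_unassoc K C B A
           (tensor_map K C AB C BA id s_ij
             (tensor_assoc K C A B
               (tensor_map K AC B CA B s_ik id
                 (tensor_unassoc K A C B
                   (tensor_map K A BC A CB id s_jk
                     (tensor_assoc K A B C t)))))))"

definition braided_system :: "('k, 'r) ring_scheme \<Rightarrow> nat \<Rightarrow> ('k, 'u) brsystem \<Rightarrow> bool" where
  "braided_system K t S \<longleftrightarrow>
     space S \<in> extensional {1..t} \<and>
     (\<forall>i\<in>{1..t}. vectorspace K (space S i)) \<and>
     braid S \<in> (\<Pi>\<^sub>E (i, j)\<in>{(i, j). 1 \<le> i \<and> i \<le> j \<and> j \<le> t}.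
       module_hom K (tensor K (space S i) (space S j)) (tensor K (space S j) (space S i))
         \<inter> extensional (carrier (tensor K (space S i) (space S j)))) \<and>
     (\<forall>i j k. 1 \<le> i \<and> i \<le> j \<and> j \<le> k \<and> k \<le> t \<longrightarrow> yang_baxter K S i j k)"

definition braided_hom ::
  "('k, 'r) ring_scheme \<Rightarrow> nat \<Rightarrow> ('k, 'u) brsystem \<Rightarrow> ('k, 'u) brsystem \<Rightarrow> (nat \<Rightarrow> 'u \<Rightarrow> 'u) set"
  where
  "braided_hom K t S S' =
    {f \<in> (\<Pi>\<^sub>E i\<in>{1..t}. module_hom K (space S i) (space S' i) \<inter> extensional (carrier (space S i))).
     \<forall>i j. 1 \<le> i \<and> i \<le> j \<and> j \<le> t \<longrightarrow>
       (\<forall>x\<in>carrier (tensor K (space S i) (space S j)).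
          tensor_map K (space S j) (space S i) (space S' j) (space S' i) (f j) (f i)
            (braid S (i, j) x)
          = braid S' (i, j)
              (tensor_map K (space S i) (space S j) (space S' i) (space S' j) (f i) (f j) x))}"

definition BrSyst ::
  "('k, 'r) ring_scheme \<Rightarrow> nat \<Rightarrow> (('k, 'u) brsystem, nat \<Rightarrow> 'u \<Rightarrow> 'u) cat" where
  "BrSyst K t =
    \<lparr>Ob = {S. braided_system K t S},
     Hom = braided_hom K t,
     Ident = (\<lambda>S. \<lambda>i\<in>{1..t}. \<lambda>x\<in>carrier (space S i). x),
     Comp = (\<lambda>R S T g f. \<lambda>i\<in>{1..t}. compose (carrier (space R i)) (g i) (f i))\<rparr>"


section \<open>The functor\<close>

text \<open>
  The spaces H, M1, ..., Mr and H* have elements of three different types; inside one braided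
  system they are tagged copies living in the following sum type.
\<close>

datatype ('h, 'v, 'd) summand = InH (unH: 'h) | InM (unM: 'v) | InD (unD: 'd)

text \<open>The underlying vector space of V, transported along an injective tagging map e.\<close>

definition tagged_space :: "('v \<Rightarrow> 'u) \<Rightarrow> ('k, 'v, 'a) module_scheme \<Rightarrow> ('k, 'u) module" where
  "tagged_space e V = (let d = the_inv_into (carrier V) e in
    \<lparr>carrier = e ` carrier V,
     mult = undefined, one = undefined,
     zero = e \<zero>\<^bsub>V\<^esub>,
     add = (\<lambda>x y. e (d x \<oplus>\<^bsub>V\<^esub> d y)),
     smult = (\<lambda>c x. e (c \<odot>\<^bsub>V\<^esub> d x))\<rparr>)"

text \<open>Position 1 is H, position i + 1 is the i-th module algebra, position r + 2 is H*.\<close>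

definition ibr_space ::
  "('k, 'r) ring_scheme \<Rightarrow> ('k, 'h) bialgebra \<Rightarrow> nat \<Rightarrow> (nat \<Rightarrow> ('k, 'h, 'v) yd_algebra)
    \<Rightarrow> nat \<Rightarrow> ('k, ('h, 'v, 'h \<Rightarrow> 'k) summand) module" where
  "ibr_space K H r M = (\<lambda>i\<in>{1..r+2}.
     if i = 1 then tagged_space InH H
     else if i = r + 2 then tagged_space InD (dual_space K H)
     else tagged_space InM (M (i - 1)))"

text \<open>
  The braiding on pure tensors x (x) y, with x in position i and y in position j, i \<le> j.
\<close>

definition ibr_braid_pure ::
  "('k, 'r) ring_scheme \<Rightarrow> ('k, 'h) bialgebra \<Rightarrow> nat \<Rightarrow> (nat \<Rightarrow> ('k, 'h, 'v) yd_algebra)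
    \<Rightarrow> nat \<Rightarrow> nat \<Rightarrow> ('h, 'v, 'h \<Rightarrow> 'k) summand \<Rightarrow> ('h, 'v, 'h \<Rightarrow> 'k) summand
    \<Rightarrow> (('h, 'v, 'h \<Rightarrow> 'k) summand \<times> ('h, 'v, 'h \<Rightarrow> 'k) summand \<Rightarrow> 'k) set" where
  "ibr_braid_pure K H r M i j x y = (let
       D = dual_space K H; Mi = M (i - 1); Mj = M (j - 1);
       T = tensor K (ibr_space K H r M j) (ibr_space K H r M i);
       ten = pure_tensor K (ibr_space K H r M j) (ibr_space K H r M i) in
     case (x, y) of
       (InH h, InH h') \<Rightarrow> ten (InH (h \<otimes>\<^bsub>H\<^esub> h')) (InH \<one>\<^bsub>H\<^esub>)
     | (InD l, InD l') \<Rightarrow> ten (InD \<one>\<^bsub>D\<^esub>) (InD (l \<otimes>\<^bsub>D\<^esub> l'))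
     | (InH h, InD l) \<Rightarrow>
         tensor_lift K T (dual_comult K H l) (\<lambda>l1 l2. tensor_lift K T (comult H h) (\<lambda>h1 h2.
           l1 h2 \<odot>\<^bsub>T\<^esub> ten (InD l2) (InH h1)))
     | (InM m, InM n) \<Rightarrow>
         (if i = j then ten (InM \<one>\<^bsub>Mi\<^esub>) (InM (m \<otimes>\<^bsub>Mi\<^esub> n))
          else tensor_lift K T (coact Mi m) (\<lambda>m0 m1. ten (InM (act Mj m1 n)) (InM m0)))
     | (InH h, InM m) \<Rightarrow>
         tensor_lift K T (comult H h) (\<lambda>h1 h2. ten (InM (act Mj h2 m)) (InH h1))
     | (InM m, InD l) \<Rightarrow>
         tensor_lift K T (dual_comult K H l) (\<lambda>l1 l2. tensor_lift K T (coact Mi m) (\<lambda>m0 m1.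
           l1 m1 \<odot>\<^bsub>T\<^esub> ten (InD l2) (InM m0)))
     | _ \<Rightarrow> undefined)"

definition ibr_obj ::
  "('k, 'r) ring_scheme \<Rightarrow> ('k, 'h) bialgebra \<Rightarrow> nat \<Rightarrow> (nat \<Rightarrow> ('k, 'h, 'v) yd_algebra)
    \<Rightarrow> ('k, ('h, 'v, 'h \<Rightarrow> 'k) summand) brsystem" where
  "ibr_obj K H r M =
    \<lparr>space = ibr_space K H r M,
     braid = (\<lambda>(i, j)\<in>{(i, j). 1 \<le> i \<and> i \<le> j \<and> j \<le> r + 2}.
       \<lambda>t\<in>carrier (tensor K (ibr_space K H r M i) (ibr_space K H r M j)).
         tensor_lift K (tensor K (ibr_space K H r M j) (ibr_space K H r M i)) t
           (ibr_braid_pure K H r M i j))\<rparr>"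

definition ibr_mor ::
  "('k, 'r) ring_scheme \<Rightarrow> ('k, 'h) bialgebra \<Rightarrow> nat
    \<Rightarrow> (nat \<Rightarrow> ('k, 'h, 'v) yd_algebra) \<Rightarrow> (nat \<Rightarrow> ('k, 'h, 'v) yd_algebra) \<Rightarrow> (nat \<Rightarrow> 'v \<Rightarrow> 'v)
    \<Rightarrow> nat \<Rightarrow> ('h, 'v, 'h \<Rightarrow> 'k) summand \<Rightarrow> ('h, 'v, 'h \<Rightarrow> 'k) summand" where
  "ibr_mor K H r M N f = (\<lambda>i\<in>{1..r+2}. \<lambda>x\<in>carrier (ibr_space K H r M i).
     if i = 1 \<or> i = r + 2 then x else InM (f (i - 1) (unM x)))"

end

theory Submission
  imports Defs
begin

text \<open>
  The system \<open>(H, M\<^sub>1, \<dots>, M\<^sub>r, H\<^sup>*)\<close> looks heterogeneous, but all its braidings come from two formulas.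
  Between different positions every braiding is the crossing
  \<open>x \<otimes> y \<mapsto> x\<^sub>(\<^sub>1\<^sub>) y \<otimes> x\<^sub>(\<^sub>0\<^sub>)\<close>, which only uses a right coaction of \<open>H\<close> on the left factor and a
  left action of \<open>H\<close> on the right factor. The first entry \<open>H\<close> coacts on itself by its
  comultiplication. The last entry \<open>H\<^sup>*\<close> is acted upon by \<open>(h l)(x) = l(x h) = l\<^sub>(\<^sub>1\<^sub>)(h) l\<^sub>(\<^sub>2\<^sub>)(x)\<close>; in
  this form the comultiplication of \<open>H\<^sup>*\<close> disappears (\<open>lift_dual_comult\<close>), and the action makes
  \<open>H\<^sup>*\<close> a module algebra. At a repeated position the braiding puts the unit beside the product: to
  its left for the \<open>M\<^sub>i\<close> and \<open>H\<^sup>*\<close>, to its right for \<open>H\<close>.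

  The Yang-Baxter equation therefore has only a few shapes, and each of them is one group of axioms.
  For \<open>i < j < k\<close> both sides become \<open>z\<close>, \<open>y\<close>, \<open>x\<close> acted upon by components of \<open>x\<close> and \<open>y\<close>; coassociativity
  aligns the components of \<open>x\<close>, and what remains is the Yetter-Drinfeld condition for the middle
  factor (\<open>yang_baxter_distinct\<close>). For \<open>i = j < k\<close> it says that the coaction is multiplicative and
  unital (\<open>yang_baxter_unit_crossing\<close>), for \<open>i < j = k\<close> that the action respects products and the
  unit (\<open>yang_baxter_crossing_left_unit\<close>), and for \<open>i = j = k\<close> it is associativity
  (\<open>yang_baxter_left_unit\<close>, \<open>yang_baxter_right_unit\<close>).

  Sweedler calculations are carried out on the sums themselves. A term \<open>tensor_lift K U t b\<close> is a
  finite sum over a representative of \<open>t\<close>, so linear maps pass through it (\<open>hom_lift\<close>), two of them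
  commute (\<open>lift_swap\<close>), and on a pure tensor it is evaluated when \<open>b\<close> is bilinear (\<open>lift_pure\<close>).
  The rule \<open>yang_baxterI\<close> translates the equation of linear maps on triple tensor products,
  reassociations included, into one equation of nested sums.

  A family of morphisms commutes with products and units, actions and coactions, which are the
  only ingredients of the two formulas; so it induces a braided morphism (\<open>crossing_natural\<close>,
  \<open>unit_braiding_natural\<close>). The functor is faithful because \<open>f\<^sub>i\<close> can be read off at position
  \<open>i + 1\<close>. Conversely (\<open>braided_imp_yd_hom\<close>), let a family respect units and induce a braided
  morphism. Multiplying the two factors of \<open>1 \<otimes> m n\<close> shows that \<open>f\<^sub>i\<close> is multiplicative. Applying the
  counit to the right factor of \<open>h\<^sub>(\<^sub>2\<^sub>) m \<otimes> h\<^sub>(\<^sub>1\<^sub>)\<close> leaves \<open>h m\<close>, whence \<open>f\<^sub>i\<close> is \<open>H\<close>-linear. Evaluating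
  the left factor of \<open>m\<^sub>(\<^sub>1\<^sub>) l \<otimes> m\<^sub>(\<^sub>0\<^sub>)\<close> at \<open>1\<close> leaves \<open>l(m\<^sub>(\<^sub>1\<^sub>)) m\<^sub>(\<^sub>0\<^sub>)\<close> for every \<open>l \<in> H\<^sup>*\<close>; since \<open>H\<close> has finite
  dimension these values determine the coaction of \<open>m\<close> (\<open>separated_by_functionals\<close>), and \<open>f\<^sub>i\<close> is
  \<open>H\<close>-colinear.
\<close>

section \<open>Linear maps\<close>

lemma homI:
  assumes "\<And>x. x \<in> carrier V \<Longrightarrow> f x \<in> carrier W"
    and "\<And>x y. \<lbrakk>x \<in> carrier V; y \<in> carrier V\<rbrakk> \<Longrightarrow> f (x \<oplus>\<^bsub>V\<^esub> y) = f x \<oplus>\<^bsub>W\<^esub> f y"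
    and "\<And>a x. \<lbrakk>a \<in> carrier K; x \<in> carrier V\<rbrakk> \<Longrightarrow> f (a \<odot>\<^bsub>V\<^esub> x) = a \<odot>\<^bsub>W\<^esub> f x"
  shows "f \<in> module_hom K V W"
  using assms unfolding module_hom_def by auto

lemma hom_closed: "\<lbrakk>f \<in> module_hom K V W; x \<in> carrier V\<rbrakk> \<Longrightarrow> f x \<in> carrier W"
  unfolding module_hom_def by auto

lemma hom_diff:
  assumes "vectorspace K V" "vectorspace K W" "f \<in> module_hom K V W"
    and "x \<in> carrier V" "y \<in> carrier V"
  shows "f (x \<ominus>\<^bsub>V\<^esub> y) = f x \<ominus>\<^bsub>W\<^esub> f y"
proof -
  interpret V: vectorspace K V by fact
  interpret W: vectorspace K W by fact
  interpret mod_hom K V W f by unfold_locales fact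
  show ?thesis using assms by simp
qed

lemma hom_finsum:
  assumes "vectorspace K V" "vectorspace K W" "f \<in> module_hom K V W" "g \<in> A \<rightarrow> carrier V"
  shows "f (\<Oplus>\<^bsub>V\<^esub>a\<in>A. g a) = (\<Oplus>\<^bsub>W\<^esub>a\<in>A. f (g a))"
proof -
  interpret V: vectorspace K V by fact
  interpret W: vectorspace K W by fact
  interpret mod_hom K V W f by unfold_locales fact
  show ?thesis using assms(4)
    by (induction A rule: infinite_finite_induct) (auto simp: Pi_def hom_closed[OF assms(3)])
qed

lemma hom_cong:
  assumes "vectorspace K V" "\<And>x. x \<in> carrier V \<Longrightarrow> f x = g x" "f \<in> module_hom K V W"
  shows "g \<in> module_hom K V W"
proof -
  interpret V: vectorspace K V by fact
  show ?thesis using assms(2,3) unfolding module_hom_def by (auto simp: Pi_def)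
qed

section \<open>Free vector spaces\<close>

text \<open>
  The linear extension of \<open>b\<close> to formal combinations of elements of \<open>X\<close>; this is the value that
  \<open>tensor_lift\<close> computes on a representative.
\<close>

definition free_eval ::
  "('k, 'r) ring_scheme \<Rightarrow> ('k, 'u, 'a) module_scheme \<Rightarrow> ('x \<Rightarrow> 'u) \<Rightarrow> ('x \<Rightarrow> 'k) \<Rightarrow> 'u" where
  "free_eval K U b c = (\<Oplus>\<^bsub>U\<^esub>p\<in>{p. c p \<noteq> \<zero>\<^bsub>K\<^esub>}. c p \<odot>\<^bsub>U\<^esub> b p)"

lemma free_space_simps:
  "carrier (free_space K X) =
    {c. range c \<subseteq> carrier K \<and> finite {x. c x \<noteq> \<zero>\<^bsub>K\<^esub>} \<and> {x. c x \<noteq> \<zero>\<^bsub>K\<^esub>} \<subseteq> X}"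
  "\<zero>\<^bsub>free_space K X\<^esub> = (\<lambda>_. \<zero>\<^bsub>K\<^esub>)"
  "c \<oplus>\<^bsub>free_space K X\<^esub> d = (\<lambda>x. c x \<oplus>\<^bsub>K\<^esub> d x)"
  "a \<odot>\<^bsub>free_space K X\<^esub> c = (\<lambda>x. a \<otimes>\<^bsub>K\<^esub> c x)"
  by (simp_all add: free_space_def)

lemma free_space_vectorspace:
  assumes "field K"
  shows "vectorspace K (free_space K X)"
proof -
  interpret field K by fact
  have supp_add: "{x. c x \<oplus>\<^bsub>K\<^esub> d x \<noteq> \<zero>\<^bsub>K\<^esub>} \<subseteq> {x. c x \<noteq> \<zero>\<^bsub>K\<^esub>} \<union> {x. d x \<noteq> \<zero>\<^bsub>K\<^esub>}" for c d :: "_ \<Rightarrow> _"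
    by auto
  have add_closed: "c \<oplus>\<^bsub>free_space K X\<^esub> d \<in> carrier (free_space K X)"
    if "c \<in> carrier (free_space K X)" "d \<in> carrier (free_space K X)" for c d
  proof -
    have "finite {x. c x \<oplus>\<^bsub>K\<^esub> d x \<noteq> \<zero>\<^bsub>K\<^esub>}" "{x. c x \<oplus>\<^bsub>K\<^esub> d x \<noteq> \<zero>\<^bsub>K\<^esub>} \<subseteq> X"
      using that supp_add[of c d] by (auto simp: free_space_simps intro: finite_subset[OF supp_add])
    then show ?thesis using that by (simp add: free_space_simps image_subset_iff)
  qed
  have supp_mul: "{x. a \<otimes>\<^bsub>K\<^esub> c x \<noteq> \<zero>\<^bsub>K\<^esub>} \<subseteq> {x. c x \<noteq> \<zero>\<^bsub>K\<^esub>}" if "a \<in> carrier K" for a and c :: "_ \<Rightarrow> _"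
    using that by auto
  have supp_neg: "{x. \<ominus>\<^bsub>K\<^esub> c x \<noteq> \<zero>\<^bsub>K\<^esub>} \<subseteq> {x. c x \<noteq> \<zero>\<^bsub>K\<^esub>}" for c :: "_ \<Rightarrow> _"
    by auto
  show ?thesis
  proof (rule vs_criteria)
    show "field K" by fact
  next
    show "\<zero>\<^bsub>free_space K X\<^esub> \<in> carrier (free_space K X)" by (auto simp: free_space_simps)
  next
    show "\<forall>v w. v \<in> carrier (free_space K X) \<and> w \<in> carrier (free_space K X) \<longrightarrow>
      v \<oplus>\<^bsub>free_space K X\<^esub> w \<in> carrier (free_space K X)"
      using add_closed by simp
  next
    show "\<forall>v\<in>carrier (free_space K X). \<exists>w\<in>carrier (free_space K X).
      v \<oplus>\<^bsub>free_space K X\<^esub> w = \<zero>\<^bsub>free_space K X\<^esub>"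
    proof
      fix c assume c: "c \<in> carrier (free_space K X)"
      then have cK: "c x \<in> carrier K" for x by (auto simp: free_space_simps)
      have "(\<lambda>x. \<ominus>\<^bsub>K\<^esub> c x) \<in> carrier (free_space K X)"
        using c supp_neg[of c] finite_subset[OF supp_neg[of c]] cK by (auto simp: free_space_simps)
      moreover have "c \<oplus>\<^bsub>free_space K X\<^esub> (\<lambda>x. \<ominus>\<^bsub>K\<^esub> c x) = \<zero>\<^bsub>free_space K X\<^esub>"
        using cK by (auto simp: free_space_simps r_neg)
      ultimately show "\<exists>w\<in>carrier (free_space K X). c \<oplus>\<^bsub>free_space K X\<^esub> w = \<zero>\<^bsub>free_space K X\<^esub>"
        by blast
    qed
  next
    show "\<forall>a v. a \<in> carrier K \<and> v \<in> carrier (free_space K X) \<longrightarrow>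
      a \<odot>\<^bsub>free_space K X\<^esub> v \<in> carrier (free_space K X)"
      by (auto simp: free_space_simps image_subset_iff intro: finite_subset[OF supp_mul])
  next
    show "\<forall>v w. v \<in> carrier (free_space K X) \<and> w \<in> carrier (free_space K X) \<longrightarrow>
      v \<oplus>\<^bsub>free_space K X\<^esub> w = w \<oplus>\<^bsub>free_space K X\<^esub> v"
      using a_comm by (simp add: free_space_simps fun_eq_iff image_subset_iff)
  qed (simp_all add: free_space_simps fun_eq_iff image_subset_iff a_assoc m_assoc l_distr r_distr)
qed

lemma free_gen_closed:
  "\<lbrakk>field K; x \<in> X\<rbrakk> \<Longrightarrow> free_gen K x \<in> carrier (free_space K X)"
proof -
  assume "field K" "x \<in> X"
  interpret field K by fact
  show ?thesis using \<open>x \<in> X\<close> by (auto simp: free_space_simps free_gen_def)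
qed

text \<open>
  Formal combinations with different supports can only be added termwise over a common index set.
\<close>

lemma free_eval_superset:
  assumes "vectorspace K U" "b \<in> X \<rightarrow> carrier U" "c \<in> carrier (free_space K X)"
    and "finite S" "{x. c x \<noteq> \<zero>\<^bsub>K\<^esub>} \<subseteq> S" "S \<subseteq> X"
  shows "free_eval K U b c = (\<Oplus>\<^bsub>U\<^esub>p\<in>S. c p \<odot>\<^bsub>U\<^esub> b p)"
proof -
  interpret U: vectorspace K U by fact
  have cK: "c p \<in> carrier K" for p using assms(3) by (auto simp: free_space_simps)
  have bU: "b p \<in> carrier U" if "p \<in> S" for p using assms(2,6) that by auto
  show ?thesis unfolding free_eval_def
    using assms(5) cK bU by (intro U.add.finprod_mono_neutral_cong_left[OF assms(4,5)]) auto
qed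

lemma free_eval_hom:
  assumes U: "vectorspace K U" and b: "b \<in> X \<rightarrow> carrier U"
  shows "free_eval K U b \<in> module_hom K (free_space K X) U"
proof -
  interpret U: vectorspace K U by fact
  note sup = free_eval_superset[OF U b]
  have bU: "b p \<in> carrier U" if "p \<in> S" "S \<subseteq> X" for p S using b that by auto
  have cK: "c p \<in> carrier K" if "c \<in> carrier (free_space K X)" for c :: "_ \<Rightarrow> _" and p
    using that by (auto simp: free_space_simps)
  interpret F: vectorspace K "free_space K X" by (rule free_space_vectorspace) unfold_locales
  show ?thesis
  proof (rule homI)
    fix c assume c: "c \<in> carrier (free_space K X)"
    then show "free_eval K U b c \<in> carrier U"
      unfolding free_eval_def using b cK[OF c]
      by (intro U.finsum_closed Pi_I U.smult_closed) (auto simp: free_space_simps)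
  next
    fix c d assume c: "c \<in> carrier (free_space K X)" and d: "d \<in> carrier (free_space K X)"
    define S where "S = {x. c x \<noteq> \<zero>\<^bsub>K\<^esub>} \<union> {x. d x \<noteq> \<zero>\<^bsub>K\<^esub>}"
    have S: "finite S" "S \<subseteq> X" using c d by (auto simp: S_def free_space_simps)
    have "free_eval K U b (c \<oplus>\<^bsub>free_space K X\<^esub> d) = (\<Oplus>\<^bsub>U\<^esub>p\<in>S. (c p \<oplus>\<^bsub>K\<^esub> d p) \<odot>\<^bsub>U\<^esub> b p)"
      using S by (subst sup[OF F.a_closed[OF c d], of S]) (auto simp: free_space_simps S_def)
    also have "\<dots> = (\<Oplus>\<^bsub>U\<^esub>p\<in>S. c p \<odot>\<^bsub>U\<^esub> b p \<oplus>\<^bsub>U\<^esub> d p \<odot>\<^bsub>U\<^esub> b p)"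
      using S bU cK[OF c] cK[OF d] by (intro U.finsum_cong') (auto simp: U.smult_l_distr)
    also have "\<dots> = (\<Oplus>\<^bsub>U\<^esub>p\<in>S. c p \<odot>\<^bsub>U\<^esub> b p) \<oplus>\<^bsub>U\<^esub> (\<Oplus>\<^bsub>U\<^esub>p\<in>S. d p \<odot>\<^bsub>U\<^esub> b p)"
      using S bU cK[OF c] cK[OF d] by (intro U.finsum_addf) auto
    also have "\<dots> = free_eval K U b c \<oplus>\<^bsub>U\<^esub> free_eval K U b d"
      using S by (subst (1 2) sup[of _ S]) (auto simp: c d S_def)
    finally show "free_eval K U b (c \<oplus>\<^bsub>free_space K X\<^esub> d) = free_eval K U b c \<oplus>\<^bsub>U\<^esub> free_eval K U b d" .
  next
    fix a c assume a: "a \<in> carrier K" and c: "c \<in> carrier (free_space K X)"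
    define S where "S = {x. c x \<noteq> \<zero>\<^bsub>K\<^esub>}"
    have S: "finite S" "S \<subseteq> X" using c by (auto simp: S_def free_space_simps)
    have "free_eval K U b (a \<odot>\<^bsub>free_space K X\<^esub> c) = (\<Oplus>\<^bsub>U\<^esub>p\<in>S. (a \<otimes>\<^bsub>K\<^esub> c p) \<odot>\<^bsub>U\<^esub> b p)"
      using S a by (subst sup[OF F.smult_closed[OF a c], of S]) (auto simp: free_space_simps S_def)
    also have "\<dots> = (\<Oplus>\<^bsub>U\<^esub>p\<in>S. a \<odot>\<^bsub>U\<^esub> (c p \<odot>\<^bsub>U\<^esub> b p))"
      using S bU a cK[OF c] by (intro U.finsum_cong') (auto simp: U.smult_assoc1)
    also have "\<dots> = a \<odot>\<^bsub>U\<^esub> (\<Oplus>\<^bsub>U\<^esub>p\<in>S. c p \<odot>\<^bsub>U\<^esub> b p)"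
      using S bU a cK[OF c] by (intro U.finsum_smult[symmetric]) auto
    also have "\<dots> = a \<odot>\<^bsub>U\<^esub> free_eval K U b c"
      using S by (subst sup[of _ S]) (auto simp: c S_def)
    finally show "free_eval K U b (a \<odot>\<^bsub>free_space K X\<^esub> c) = a \<odot>\<^bsub>U\<^esub> free_eval K U b c" .
  qed
qed

lemma free_eval_gen:
  assumes U: "vectorspace K U" and b: "b \<in> X \<rightarrow> carrier U" and x: "x \<in> X"
  shows "free_eval K U b (free_gen K x) = b x"
proof -
  interpret U: vectorspace K U by fact
  have "free_eval K U b (free_gen K x) = (\<Oplus>\<^bsub>U\<^esub>p\<in>{x}. free_gen K x p \<odot>\<^bsub>U\<^esub> b p)"
    using x by (intro free_eval_superset[OF U b] free_gen_closed) (auto simp: free_gen_def U.field_axioms)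
  then show ?thesis using b x by (simp add: free_gen_def Pi_iff)
qed

lemma free_eval_id:
  assumes "field K" and c: "c \<in> carrier (free_space K X)"
  shows "free_eval K (free_space K X) (free_gen K) c = c"
proof
  fix y
  interpret field K by fact
  let ?F = "free_space K X"
  interpret F: vectorspace K ?F by (rule free_space_vectorspace) fact
  have cK: "c p \<in> carrier K" for p using c by (auto simp: free_space_simps)
  have fin: "finite {p. c p \<noteq> \<zero>\<^bsub>K\<^esub>}" and sub: "{p. c p \<noteq> \<zero>\<^bsub>K\<^esub>} \<subseteq> X"
    using c by (auto simp: free_space_simps)
  have pointwise: "finite A \<Longrightarrow> g \<in> A \<rightarrow> carrier ?F \<Longrightarrow> (\<Oplus>\<^bsub>?F\<^esub>p\<in>A. g p) y = (\<Oplus>\<^bsub>K\<^esub>p\<in>A. g p y)"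
    for A g
  proof (induction A rule: finite_induct)
    case empty
    then show ?case by (simp add: free_space_simps)
  next
    case (insert a A)
    have "g p y \<in> carrier K" if "p \<in> insert a A" for p
      using insert.prems that unfolding free_space_simps by blast
    then show ?case using insert by (simp add: free_space_simps(3) Pi_iff)
  qed
  have "free_eval K ?F (free_gen K) c y = (\<Oplus>\<^bsub>K\<^esub>p\<in>{p. c p \<noteq> \<zero>\<^bsub>K\<^esub>}. (c p \<odot>\<^bsub>?F\<^esub> free_gen K p) y)"
    unfolding free_eval_def using sub cK \<open>field K\<close>
    by (intro pointwise fin) (auto intro!: F.smult_closed free_gen_closed)
  also have "\<dots> = (\<Oplus>\<^bsub>K\<^esub>p\<in>{p. c p \<noteq> \<zero>\<^bsub>K\<^esub>}. if y = p then c p else \<zero>\<^bsub>K\<^esub>)"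
    using cK by (intro finsum_cong') (auto simp: free_space_simps free_gen_def)
  also have "\<dots> = c y"
  proof (cases "c y = \<zero>\<^bsub>K\<^esub>")
    case True
    then have "(\<Oplus>\<^bsub>K\<^esub>p\<in>{p. c p \<noteq> \<zero>\<^bsub>K\<^esub>}. if y = p then c p else \<zero>\<^bsub>K\<^esub>) = (\<Oplus>\<^bsub>K\<^esub>p\<in>{p. c p \<noteq> \<zero>\<^bsub>K\<^esub>}. \<zero>\<^bsub>K\<^esub>)"
      by (intro finsum_cong') auto
    then show ?thesis using True by simp
  next
    case False
    then show ?thesis using cK fin by (intro add.finprod_singleton) auto
  qed
  finally show "free_eval K ?F (free_gen K) c y = c y" .
qed

section \<open>Quotient spaces\<close>

lemma quotient_space_simps:
  "carrier (quotient_space K V W) = a_rcosets\<^bsub>V\<^esub> W"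
  "\<zero>\<^bsub>quotient_space K V W\<^esub> = W"
  "X \<oplus>\<^bsub>quotient_space K V W\<^esub> Y = X <+>\<^bsub>V\<^esub> Y"
  "a \<odot>\<^bsub>quotient_space K V W\<^esub> X = (\<Union>x\<in>X. W +>\<^bsub>V\<^esub> (a \<odot>\<^bsub>V\<^esub> x))"
  by (simp_all add: quotient_space_def)

text \<open>
  Scalar multiplication of a coset is defined as a union of cosets. All cosets in this union
  coincide, since \<open>a (w + x) - a x = a w\<close> lies in \<open>W\<close>.
\<close>

lemma quotient_facts:
  assumes V: "vectorspace K V" and W: "submodule K W V"
  shows quotient_carrier: "carrier (quotient_space K V W) = (\<lambda>x. W +>\<^bsub>V\<^esub> x) ` carrier V"
    and quotient_vectorspace: "vectorspace K (quotient_space K V W)"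
    and quotient_proj_hom: "(\<lambda>x. W +>\<^bsub>V\<^esub> x) \<in> module_hom K V (quotient_space K V W)"
    and quotient_proj_eq: "\<lbrakk>x \<in> carrier V; y \<in> carrier V\<rbrakk> \<Longrightarrow>
      (W +>\<^bsub>V\<^esub> x = W +>\<^bsub>V\<^esub> y) \<longleftrightarrow> x \<ominus>\<^bsub>V\<^esub> y \<in> W"
    and quotient_proj_self: "x \<in> carrier V \<Longrightarrow> x \<in> W +>\<^bsub>V\<^esub> x"
    and quotient_proj_mem: "\<lbrakk>x \<in> carrier V; c \<in> W +>\<^bsub>V\<^esub> x\<rbrakk> \<Longrightarrow> c \<in> carrier V \<and> W +>\<^bsub>V\<^esub> c = W +>\<^bsub>V\<^esub> x"
proof -
  interpret V: vectorspace K V by fact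
  interpret W: submodule K W V by fact
  let ?Q = "quotient_space K V W"
  have Wneg: "\<ominus>\<^bsub>V\<^esub> w \<in> W" if "w \<in> W" for w
    using W.smult_closed[of "\<ominus>\<^bsub>K\<^esub> \<one>\<^bsub>K\<^esub>" w] that W.subset V.smult_minus_1[of w]
    by (metis V.R.add.inv_closed V.one_closed subsetD)
  have "subgroup W (add_monoid V)"
    by (rule subgroup.intro) (use W.subset Wneg in \<open>auto simp: a_inv_def[symmetric]\<close>)
  then interpret S: abelian_subgroup W V
    by (intro abelian_subgroupI3 V.abelian_group_axioms additive_subgroup.intro)
  show carr: "carrier ?Q = (\<lambda>x. W +>\<^bsub>V\<^esub> x) ` carrier V"
    by (auto simp: quotient_space_simps A_RCOSETS_def' )
  show self: "x \<in> W +>\<^bsub>V\<^esub> x" if "x \<in> carrier V" for x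
    using that by (rule S.a_rcos_self)
  show eq: "(W +>\<^bsub>V\<^esub> x = W +>\<^bsub>V\<^esub> y) \<longleftrightarrow> x \<ominus>\<^bsub>V\<^esub> y \<in> W" if "x \<in> carrier V" "y \<in> carrier V" for x y
    unfolding a_minus_def S.a_rcos_module[OF that(2,1), symmetric]
    using S.a_repr_independence'[OF _ that(2)] S.a_repr_independenceD[OF that(1)] by blast
  show "c \<in> carrier V \<and> W +>\<^bsub>V\<^esub> c = W +>\<^bsub>V\<^esub> x" if "x \<in> carrier V" "c \<in> W +>\<^bsub>V\<^esub> x" for x c
    using that S.a_repr_independence' S.a_elemrcos_carrier by blast
  have add: "(W +>\<^bsub>V\<^esub> x) \<oplus>\<^bsub>?Q\<^esub> (W +>\<^bsub>V\<^esub> y) = W +>\<^bsub>V\<^esub> (x \<oplus>\<^bsub>V\<^esub> y)" if "x \<in> carrier V" "y \<in> carrier V" for x y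
    using that by (simp add: quotient_space_simps S.a_rcos_sum)
  have smult: "a \<odot>\<^bsub>?Q\<^esub> (W +>\<^bsub>V\<^esub> x) = W +>\<^bsub>V\<^esub> (a \<odot>\<^bsub>V\<^esub> x)" if a: "a \<in> carrier K" and x: "x \<in> carrier V" for a x
  proof -
    have "W +>\<^bsub>V\<^esub> (a \<odot>\<^bsub>V\<^esub> c) = W +>\<^bsub>V\<^esub> (a \<odot>\<^bsub>V\<^esub> x)" if c: "c \<in> W +>\<^bsub>V\<^esub> x" for c
    proof -
      obtain w where w: "w \<in> W" "c = w \<oplus>\<^bsub>V\<^esub> x" using c by (auto simp: a_r_coset_def')
      then have wV: "w \<in> carrier V" using W.subset by auto
      have "a \<odot>\<^bsub>V\<^esub> c \<ominus>\<^bsub>V\<^esub> a \<odot>\<^bsub>V\<^esub> x = a \<odot>\<^bsub>V\<^esub> w"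
      proof -
        have ax: "a \<odot>\<^bsub>V\<^esub> x \<in> carrier V" and aw: "a \<odot>\<^bsub>V\<^esub> w \<in> carrier V" using a x wV by simp_all
        have "a \<odot>\<^bsub>V\<^esub> c = a \<odot>\<^bsub>V\<^esub> w \<oplus>\<^bsub>V\<^esub> a \<odot>\<^bsub>V\<^esub> x"
          unfolding w(2) by (rule V.smult_r_distr[OF a wV x])
        then show ?thesis
          using V.M.a_assoc[OF aw ax V.M.a_inv_closed[OF ax]] V.M.r_neg[OF ax] V.M.r_zero[OF aw]
          unfolding a_minus_def by (simp only:)
      qed
      then show ?thesis using a x wV w by (subst eq) auto
    qed
    then show ?thesis unfolding quotient_space_simps by (intro UN_constant_eq[OF self[OF x]] ballI)
  qed
  have zero: "\<zero>\<^bsub>?Q\<^esub> = W +>\<^bsub>V\<^esub> \<zero>\<^bsub>V\<^esub>"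
    by (simp add: quotient_space_simps a_r_coset_def')
  show "vectorspace K ?Q"
  proof (rule vs_criteria)
    show "field K" by unfold_locales
    show "\<forall>v\<in>carrier ?Q. \<exists>w\<in>carrier ?Q. v \<oplus>\<^bsub>?Q\<^esub> w = \<zero>\<^bsub>?Q\<^esub>"
    proof
      fix v assume "v \<in> carrier ?Q"
      then obtain x where "x \<in> carrier V" "v = W +>\<^bsub>V\<^esub> x" by (auto simp: carr)
      then show "\<exists>w\<in>carrier ?Q. v \<oplus>\<^bsub>?Q\<^esub> w = \<zero>\<^bsub>?Q\<^esub>"
        by (intro bexI[of _ "W +>\<^bsub>V\<^esub> (\<ominus>\<^bsub>V\<^esub> x)"]) (auto simp: carr add zero V.M.r_neg)
    qed
  next
    show "\<forall>v w. v \<in> carrier ?Q \<and> w \<in> carrier ?Q \<longrightarrow> v \<oplus>\<^bsub>?Q\<^esub> w = w \<oplus>\<^bsub>?Q\<^esub> v"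
      using V.M.a_comm by (auto simp: carr add)
  next
    show "\<forall>a b v. a \<in> carrier K \<and> b \<in> carrier K \<and> v \<in> carrier ?Q \<longrightarrow>
      (a \<oplus>\<^bsub>K\<^esub> b) \<odot>\<^bsub>?Q\<^esub> v = a \<odot>\<^bsub>?Q\<^esub> v \<oplus>\<^bsub>?Q\<^esub> b \<odot>\<^bsub>?Q\<^esub> v"
      using V.smult_l_distr by (auto simp: carr add smult)
    show "\<forall>a v w. a \<in> carrier K \<and> v \<in> carrier ?Q \<and> w \<in> carrier ?Q \<longrightarrow>
      a \<odot>\<^bsub>?Q\<^esub> (v \<oplus>\<^bsub>?Q\<^esub> w) = a \<odot>\<^bsub>?Q\<^esub> v \<oplus>\<^bsub>?Q\<^esub> a \<odot>\<^bsub>?Q\<^esub> w"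
      using V.smult_r_distr by (auto simp: carr add smult)
    show "\<forall>a b v. a \<in> carrier K \<and> b \<in> carrier K \<and> v \<in> carrier ?Q \<longrightarrow>
      (a \<otimes>\<^bsub>K\<^esub> b) \<odot>\<^bsub>?Q\<^esub> v = a \<odot>\<^bsub>?Q\<^esub> (b \<odot>\<^bsub>?Q\<^esub> v)"
      using V.smult_assoc1 by (auto simp: carr smult)
  qed (auto simp: carr add smult zero V.M.a_assoc)
  show "(\<lambda>x. W +>\<^bsub>V\<^esub> x) \<in> module_hom K V ?Q"
    by (rule homI) (auto simp: carr add smult)
qed

section \<open>Pure tensors\<close>

text \<open>
  Both clauses are linearity of a function of one variable, so that one collection of rules for
  linear maps decides bilinearity too.
\<close>

definition bilinear ::
  "('k, 'r) ring_scheme \<Rightarrow> ('k, 'v, 'a) module_scheme \<Rightarrow> ('k, 'w, 'b) module_scheme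
    \<Rightarrow> ('k, 'u, 'c) module_scheme \<Rightarrow> ('v \<Rightarrow> 'w \<Rightarrow> 'u) \<Rightarrow> bool" where
  "bilinear K V W U b \<longleftrightarrow> (\<forall>v\<in>carrier V. (\<lambda>w. b v w) \<in> module_hom K W U) \<and>
     (\<forall>w\<in>carrier W. (\<lambda>v. b v w) \<in> module_hom K V U)"

lemma bilinearI:
  assumes "\<And>v. v \<in> carrier V \<Longrightarrow> (\<lambda>w. b v w) \<in> module_hom K W U"
    and "\<And>w. w \<in> carrier W \<Longrightarrow> (\<lambda>v. b v w) \<in> module_hom K V U"
  shows "bilinear K V W U b"
  using assms by (simp add: bilinear_def)

lemma bilinear_right: "\<lbrakk>bilinear K V W U b; v \<in> carrier V\<rbrakk> \<Longrightarrow> (\<lambda>w. b v w) \<in> module_hom K W U"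
  and bilinear_left: "\<lbrakk>bilinear K V W U b; w \<in> carrier W\<rbrakk> \<Longrightarrow> (\<lambda>v. b v w) \<in> module_hom K V U"
  by (simp_all add: bilinear_def)

lemma bilinear_closed: "\<lbrakk>bilinear K V W U b; v \<in> carrier V; w \<in> carrier W\<rbrakk> \<Longrightarrow> b v w \<in> carrier U"
  using hom_closed[OF bilinear_right] .

lemma bilinear_relators_subset:
  assumes V: "vectorspace K V" and W: "vectorspace K W"
  shows "bilinear_relators K V W \<subseteq> carrier (free_space K (carrier V \<times> carrier W))"
proof -
  interpret V: vectorspace K V by fact
  interpret W: vectorspace K W by fact
  interpret F: vectorspace K "free_space K (carrier V \<times> carrier W)"
    by (rule free_space_vectorspace) unfold_locales
  have gen: "free_gen K (v, w) \<in> carrier (free_space K (carrier V \<times> carrier W))"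
    if "v \<in> carrier V" "w \<in> carrier W" for v w
    using that by (intro free_gen_closed) (auto simp: V.field_axioms)
  show ?thesis
    unfolding bilinear_relators_def Let_def
    by (auto intro!: F.M.minus_closed F.M.a_closed F.smult_closed gen
        V.M.a_closed W.M.a_closed V.smult_closed W.smult_closed)
qed

lemma tensor_null_submodule:
  assumes V: "vectorspace K V" and W: "vectorspace K W"
  shows "submodule K (tensor_null K V W) (free_space K (carrier V \<times> carrier W))"
proof -
  interpret V: vectorspace K V by fact
  interpret F: vectorspace K "free_space K (carrier V \<times> carrier W)"
    by (rule free_space_vectorspace) unfold_locales
  show ?thesis unfolding tensor_null_def
    by (rule F.span_is_submodule) (rule bilinear_relators_subset[OF V W])
qed

lemma relator_in_null:
  assumes V: "vectorspace K V" and W: "vectorspace K W"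
    and "x \<in> bilinear_relators K V W"
  shows "x \<in> tensor_null K V W"
proof -
  interpret V: vectorspace K V by fact
  interpret F: vectorspace K "free_space K (carrier V \<times> carrier W)"
    by (rule free_space_vectorspace) unfold_locales
  show ?thesis
    using F.in_own_span[OF bilinear_relators_subset[OF V W]] assms(3) unfolding tensor_null_def by blast
qed

lemma field_of_vectorspace: "vectorspace K V \<Longrightarrow> field K"
  by (simp add: vectorspace_def)

lemma tensor_vectorspace:
  assumes "vectorspace K V" "vectorspace K W"
  shows "vectorspace K (tensor K V W)"
  unfolding tensor_def
  by (rule quotient_vectorspace[OF free_space_vectorspace[OF field_of_vectorspace[OF assms(1)]]
        tensor_null_submodule[OF assms]])

lemma tensor_proj_hom:
  assumes "vectorspace K V" "vectorspace K W"
  shows "(\<lambda>c. tensor_null K V W +>\<^bsub>free_space K (carrier V \<times> carrier W)\<^esub> c)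
    \<in> module_hom K (free_space K (carrier V \<times> carrier W)) (tensor K V W)"
  unfolding tensor_def
  by (rule quotient_proj_hom[OF free_space_vectorspace[OF field_of_vectorspace[OF assms(1)]]
        tensor_null_submodule[OF assms]])

lemma pure_tensor_closed:
  assumes "vectorspace K V" "vectorspace K W" "v \<in> carrier V" "w \<in> carrier W"
  shows "pure_tensor K V W v w \<in> carrier (tensor K V W)"
  unfolding pure_tensor_def
  by (rule hom_closed[OF tensor_proj_hom[OF assms(1,2)]], rule free_gen_closed)
    (use assms field_of_vectorspace in auto)

lemma tensor_representative:
  assumes V: "vectorspace K V" and W: "vectorspace K W" and t: "t \<in> carrier (tensor K V W)"
  defines "c \<equiv> (SOME c. c \<in> t)"
  shows "c \<in> carrier (free_space K (carrier V \<times> carrier W))"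
    and "tensor_null K V W +>\<^bsub>free_space K (carrier V \<times> carrier W)\<^esub> c = t"
proof -
  let ?F = "free_space K (carrier V \<times> carrier W)"
  have F: "vectorspace K ?F" by (rule free_space_vectorspace[OF field_of_vectorspace[OF V]])
  note N = tensor_null_submodule[OF V W]
  obtain d where d: "d \<in> carrier ?F" "t = tensor_null K V W +>\<^bsub>?F\<^esub> d"
    using t quotient_carrier[OF F N] unfolding tensor_def by auto
  have "c \<in> t" unfolding c_def by (rule someI[of _ d]) (use d quotient_proj_self[OF F N] in simp)
  then show "c \<in> carrier ?F" "tensor_null K V W +>\<^bsub>?F\<^esub> c = t"
    using quotient_proj_mem[OF F N d(1)] d(2) by auto
qed

lemma pure_tensor_bilinear:
  assumes V: "vectorspace K V" and W: "vectorspace K W"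
  shows "bilinear K V W (tensor K V W) (pure_tensor K V W)"
proof -
  let ?F = "free_space K (carrier V \<times> carrier W)"
  have F: "vectorspace K ?F" by (rule free_space_vectorspace[OF field_of_vectorspace[OF V]])
  interpret V: vectorspace K V by fact
  interpret W: vectorspace K W by fact
  interpret F: vectorspace K ?F by fact
  note N = tensor_null_submodule[OF V W]
  note hom = tensor_proj_hom[OF V W]
  have gen: "free_gen K (v, w) \<in> carrier ?F" if "v \<in> carrier V" "w \<in> carrier W" for v w
    using that by (intro free_gen_closed) (auto simp: V.field_axioms)
  have relators:
    "\<And>v v' w. \<lbrakk>v \<in> carrier V; v' \<in> carrier V; w \<in> carrier W\<rbrakk> \<Longrightarrow>
      free_gen K (v \<oplus>\<^bsub>V\<^esub> v', w) \<ominus>\<^bsub>?F\<^esub> (free_gen K (v, w) \<oplus>\<^bsub>?F\<^esub> free_gen K (v', w)) \<in> bilinear_relators K V W"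
    "\<And>v w w'. \<lbrakk>v \<in> carrier V; w \<in> carrier W; w' \<in> carrier W\<rbrakk> \<Longrightarrow>
      free_gen K (v, w \<oplus>\<^bsub>W\<^esub> w') \<ominus>\<^bsub>?F\<^esub> (free_gen K (v, w) \<oplus>\<^bsub>?F\<^esub> free_gen K (v, w')) \<in> bilinear_relators K V W"
    "\<And>a v w. \<lbrakk>a \<in> carrier K; v \<in> carrier V; w \<in> carrier W\<rbrakk> \<Longrightarrow>
      free_gen K (a \<odot>\<^bsub>V\<^esub> v, w) \<ominus>\<^bsub>?F\<^esub> (a \<odot>\<^bsub>?F\<^esub> free_gen K (v, w)) \<in> bilinear_relators K V W"
    "\<And>a v w. \<lbrakk>a \<in> carrier K; v \<in> carrier V; w \<in> carrier W\<rbrakk> \<Longrightarrow>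
      free_gen K (v, a \<odot>\<^bsub>W\<^esub> w) \<ominus>\<^bsub>?F\<^esub> (a \<odot>\<^bsub>?F\<^esub> free_gen K (v, w)) \<in> bilinear_relators K V W"
    unfolding bilinear_relators_def Let_def
    by blast+
  have eqI: "tensor_null K V W +>\<^bsub>?F\<^esub> x = tensor_null K V W +>\<^bsub>?F\<^esub> y"
    if "x \<ominus>\<^bsub>?F\<^esub> y \<in> bilinear_relators K V W" "x \<in> carrier ?F" "y \<in> carrier ?F" for x y
    using quotient_proj_eq[OF F N that(2,3)] relator_in_null[OF V W that(1)] by simp
  show ?thesis
  proof (rule bilinearI; rule homI)
    fix v w assume "v \<in> carrier V" "w \<in> carrier W"
    then show "pure_tensor K V W v w \<in> carrier (tensor K V W)" by (rule pure_tensor_closed[OF V W])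
    then show "pure_tensor K V W v w \<in> carrier (tensor K V W)" .
  next
    fix v x y assume v: "v \<in> carrier V" and x: "x \<in> carrier W" and y: "y \<in> carrier W"
    have "tensor_null K V W +>\<^bsub>?F\<^esub> free_gen K (v, x \<oplus>\<^bsub>W\<^esub> y)
        = tensor_null K V W +>\<^bsub>?F\<^esub> (free_gen K (v, x) \<oplus>\<^bsub>?F\<^esub> free_gen K (v, y))"
      using v x y
      by (intro eqI F.M.a_closed gen) (simp_all add: relators)
    then show "pure_tensor K V W v (x \<oplus>\<^bsub>W\<^esub> y) = pure_tensor K V W v x \<oplus>\<^bsub>tensor K V W\<^esub> pure_tensor K V W v y"
      unfolding pure_tensor_def using module_hom_add[OF hom gen[OF v x] gen[OF v y]] by simp
  next
    fix w x y assume w: "w \<in> carrier W" and x: "x \<in> carrier V" and y: "y \<in> carrier V"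
    have "tensor_null K V W +>\<^bsub>?F\<^esub> free_gen K (x \<oplus>\<^bsub>V\<^esub> y, w)
        = tensor_null K V W +>\<^bsub>?F\<^esub> (free_gen K (x, w) \<oplus>\<^bsub>?F\<^esub> free_gen K (y, w))"
      using w x y
      by (intro eqI F.M.a_closed gen) (simp_all add: relators)
    then show "pure_tensor K V W (x \<oplus>\<^bsub>V\<^esub> y) w = pure_tensor K V W x w \<oplus>\<^bsub>tensor K V W\<^esub> pure_tensor K V W y w"
      unfolding pure_tensor_def using module_hom_add[OF hom gen[OF x w] gen[OF y w]] by simp
  next
    fix v a x assume v: "v \<in> carrier V" and a: "a \<in> carrier K" and x: "x \<in> carrier W"
    have "tensor_null K V W +>\<^bsub>?F\<^esub> free_gen K (v, a \<odot>\<^bsub>W\<^esub> x)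
        = tensor_null K V W +>\<^bsub>?F\<^esub> (a \<odot>\<^bsub>?F\<^esub> free_gen K (v, x))"
      using v x a
      by (intro eqI F.smult_closed gen) (simp_all add: relators)
    then show "pure_tensor K V W v (a \<odot>\<^bsub>W\<^esub> x) = a \<odot>\<^bsub>tensor K V W\<^esub> pure_tensor K V W v x"
      unfolding pure_tensor_def using module_hom_smult[OF hom a gen[OF v x]] by simp
  next
    fix w a x assume w: "w \<in> carrier W" and a: "a \<in> carrier K" and x: "x \<in> carrier V"
    have "tensor_null K V W +>\<^bsub>?F\<^esub> free_gen K (a \<odot>\<^bsub>V\<^esub> x, w)
        = tensor_null K V W +>\<^bsub>?F\<^esub> (a \<odot>\<^bsub>?F\<^esub> free_gen K (x, w))"
      using w x a
      by (intro eqI F.smult_closed gen) (simp_all add: relators)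
    then show "pure_tensor K V W (a \<odot>\<^bsub>V\<^esub> x) w = a \<odot>\<^bsub>tensor K V W\<^esub> pure_tensor K V W x w"
      unfolding pure_tensor_def using module_hom_smult[OF hom a gen[OF x w]] by simp
  qed
qed

section \<open>Sweedler sums\<close>

lemma tensor_lift_eval: "tensor_lift K U t b = free_eval K U (\<lambda>p. b (fst p) (snd p)) (SOME c. c \<in> t)"
  by (simp add: tensor_lift_def free_eval_def Let_def)

lemma representative_facts:
  assumes "vectorspace K V" "vectorspace K W" "t \<in> carrier (tensor K V W)"
  defines "c \<equiv> (SOME c. c \<in> t)"
  shows "finite {p. c p \<noteq> \<zero>\<^bsub>K\<^esub>}" "c p \<in> carrier K"
    "c p \<noteq> \<zero>\<^bsub>K\<^esub> \<Longrightarrow> fst p \<in> carrier V \<and> snd p \<in> carrier W"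
proof -
  have "c \<in> carrier (free_space K (carrier V \<times> carrier W))"
    unfolding c_def by (rule tensor_representative(1)[OF assms(1-3)])
  then show "finite {p. c p \<noteq> \<zero>\<^bsub>K\<^esub>}" "c p \<in> carrier K"
    "c p \<noteq> \<zero>\<^bsub>K\<^esub> \<Longrightarrow> fst p \<in> carrier V \<and> snd p \<in> carrier W"
    unfolding free_space_simps by (cases p; auto)+
qed

lemma lift_closed:
  assumes "vectorspace K V" "vectorspace K W" "vectorspace K U" "t \<in> carrier (tensor K V W)"
    and b: "\<And>v w. \<lbrakk>v \<in> carrier V; w \<in> carrier W\<rbrakk> \<Longrightarrow> b v w \<in> carrier U"
  shows "tensor_lift K U t b \<in> carrier U"
proof -
  have "(\<lambda>p. b (fst p) (snd p)) \<in> carrier V \<times> carrier W \<rightarrow> carrier U" using b by auto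
  from hom_closed[OF free_eval_hom[OF assms(3) this] tensor_representative(1)[OF assms(1,2,4)]]
  show ?thesis unfolding tensor_lift_eval .
qed

lemma lift_cong:
  assumes "vectorspace K V" "vectorspace K W" "vectorspace K U" "t \<in> carrier (tensor K V W)"
    and b: "\<And>v w. \<lbrakk>v \<in> carrier V; w \<in> carrier W\<rbrakk> \<Longrightarrow> b v w = b' v w"
    and cl: "\<And>v w. \<lbrakk>v \<in> carrier V; w \<in> carrier W\<rbrakk> \<Longrightarrow> b' v w \<in> carrier U"
  shows "tensor_lift K U t b = tensor_lift K U t b'"
proof -
  interpret U: vectorspace K U by fact
  note rep = representative_facts[OF assms(1,2,4)]
  show ?thesis unfolding tensor_lift_def Let_def
    using rep(3) b cl by (intro U.M.finsum_cong') (auto intro!: U.smult_closed rep(2))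
qed

text \<open>
  A linear map passes through the finite sum over the representative. In a Sweedler calculation it
  can thus be moved past an expression before anything is known about the linearity of the latter.
\<close>

lemma hom_lift:
  assumes "vectorspace K V" "vectorspace K W" "t \<in> carrier (tensor K V W)"
    and U: "vectorspace K U" and U': "vectorspace K U'" and f: "f \<in> module_hom K U U'"
    and b: "\<And>v w. \<lbrakk>v \<in> carrier V; w \<in> carrier W\<rbrakk> \<Longrightarrow> b v w \<in> carrier U"
  shows "f (tensor_lift K U t b) = tensor_lift K U' t (\<lambda>v w. f (b v w))"
proof -
  interpret U: vectorspace K U by fact
  interpret U': vectorspace K U' by fact
  note rep = representative_facts[OF assms(1-3)]
  show ?thesis unfolding tensor_lift_def Let_def
    apply (subst hom_finsum[OF U U' f])
    subgoal using rep(3) b by (auto intro!: U.smult_closed rep(2))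
    subgoal using rep(3) b hom_closed[OF f] module_hom_smult[OF f rep(2)]
      by (intro U'.M.finsum_cong') (auto intro!: U'.smult_closed rep(2))
    done
qed

lemma finsum_swap:
  assumes U: "vectorspace K U" and "finite B"
    and "\<And>a b. \<lbrakk>a \<in> A; b \<in> B\<rbrakk> \<Longrightarrow> g a b \<in> carrier U"
  shows "(\<Oplus>\<^bsub>U\<^esub>a\<in>A. \<Oplus>\<^bsub>U\<^esub>b\<in>B. g a b) = (\<Oplus>\<^bsub>U\<^esub>b\<in>B. \<Oplus>\<^bsub>U\<^esub>a\<in>A. g a b)"
proof -
  interpret U: vectorspace K U by fact
  show ?thesis using assms(3)
  proof (induction A rule: infinite_finite_induct)
    case (insert a A)
    have "(\<Oplus>\<^bsub>U\<^esub>b\<in>B. \<Oplus>\<^bsub>U\<^esub>a\<in>insert a A. g a b) = (\<Oplus>\<^bsub>U\<^esub>b\<in>B. g a b \<oplus>\<^bsub>U\<^esub> (\<Oplus>\<^bsub>U\<^esub>a\<in>A. g a b))"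
      using insert by (intro U.M.finsum_cong' U.M.finsum_insert) (auto intro!: U.M.finsum_closed)
    also have "\<dots> = (\<Oplus>\<^bsub>U\<^esub>b\<in>B. g a b) \<oplus>\<^bsub>U\<^esub> (\<Oplus>\<^bsub>U\<^esub>b\<in>B. \<Oplus>\<^bsub>U\<^esub>a\<in>A. g a b)"
      using insert by (intro U.M.finsum_addf) (auto intro!: U.M.finsum_closed)
    finally show ?case
      using insert by (subst U.M.finsum_insert) (auto intro!: U.M.finsum_closed)
  qed simp_all
qed

text \<open>
  Independent Sweedler indices may be introduced in either order, being two finite sums.
\<close>

lemma lift_swap:
  assumes V: "vectorspace K V" "vectorspace K W" and t: "t \<in> carrier (tensor K V W)"
    and X: "vectorspace K X" "vectorspace K Y" and s: "s \<in> carrier (tensor K X Y)"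
    and U: "vectorspace K U"
    and b: "\<And>v w x y. \<lbrakk>v \<in> carrier V; w \<in> carrier W; x \<in> carrier X; y \<in> carrier Y\<rbrakk> \<Longrightarrow> b v w x y \<in> carrier U"
  shows "tensor_lift K U t (\<lambda>v w. tensor_lift K U s (\<lambda>x y. b v w x y))
    = tensor_lift K U s (\<lambda>x y. tensor_lift K U t (\<lambda>v w. b v w x y))"
proof -
  interpret U: vectorspace K U by fact
  note rt = representative_facts[OF V t] and rs = representative_facts[OF X s]
  define c where "c = (SOME c. c \<in> t)"
  define d where "d = (SOME d. d \<in> s)"
  note rt = rt[folded c_def] and rs = rs[folded d_def]
  have bU: "b (fst p) (snd p) (fst q) (snd q) \<in> carrier U" if "c p \<noteq> \<zero>\<^bsub>K\<^esub>" "d q \<noteq> \<zero>\<^bsub>K\<^esub>" for p q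
    using rt(3)[OF that(1)] rs(3)[OF that(2)] b by auto
  have "tensor_lift K U t (\<lambda>v w. tensor_lift K U s (\<lambda>x y. b v w x y))
    = (\<Oplus>\<^bsub>U\<^esub>p\<in>{p. c p \<noteq> \<zero>\<^bsub>K\<^esub>}. \<Oplus>\<^bsub>U\<^esub>q\<in>{q. d q \<noteq> \<zero>\<^bsub>K\<^esub>}.
         c p \<odot>\<^bsub>U\<^esub> (d q \<odot>\<^bsub>U\<^esub> b (fst p) (snd p) (fst q) (snd q)))"
    unfolding tensor_lift_def Let_def c_def[symmetric] d_def[symmetric]
    using rt(2) rs(2) bU
    by (intro U.M.finsum_cong') (auto intro!: U.smult_closed U.M.finsum_closed U.finsum_smult)
  also have "\<dots> = (\<Oplus>\<^bsub>U\<^esub>q\<in>{q. d q \<noteq> \<zero>\<^bsub>K\<^esub>}. \<Oplus>\<^bsub>U\<^esub>p\<in>{p. c p \<noteq> \<zero>\<^bsub>K\<^esub>}.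
         c p \<odot>\<^bsub>U\<^esub> (d q \<odot>\<^bsub>U\<^esub> b (fst p) (snd p) (fst q) (snd q)))"
    using rt(2) rs bU by (intro finsum_swap[OF U]) (auto intro!: U.smult_closed)
  also have "\<dots> = (\<Oplus>\<^bsub>U\<^esub>q\<in>{q. d q \<noteq> \<zero>\<^bsub>K\<^esub>}. \<Oplus>\<^bsub>U\<^esub>p\<in>{p. c p \<noteq> \<zero>\<^bsub>K\<^esub>}.
         d q \<odot>\<^bsub>U\<^esub> (c p \<odot>\<^bsub>U\<^esub> b (fst p) (snd p) (fst q) (snd q)))"
    using rt(2) rs(2) bU
    by (intro U.M.finsum_cong')
      (auto intro!: U.smult_closed U.M.finsum_closed simp: U.smult_assoc1[symmetric] U.R.m_comm)
  also have "\<dots> = tensor_lift K U s (\<lambda>x y. tensor_lift K U t (\<lambda>v w. b v w x y))"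
    unfolding tensor_lift_def Let_def c_def[symmetric] d_def[symmetric]
    using rt(2) rs(2) bU
    by (intro U.M.finsum_cong') (auto intro!: U.smult_closed U.M.finsum_closed U.finsum_smult[symmetric])
  finally show ?thesis .
qed

text \<open>
  The linear extension of a bilinear map kills each relator, hence their span. It therefore agrees
  on any two elements of a coset, in particular on the representative that is chosen in
  \<open>tensor_lift\<close>.
\<close>

lemma lift_proj:
  assumes V: "vectorspace K V" "vectorspace K W" and U: "vectorspace K U" and b: "bilinear K V W U b"
    and c: "c \<in> carrier (free_space K (carrier V \<times> carrier W))"
  shows "tensor_lift K U (tensor_null K V W +>\<^bsub>free_space K (carrier V \<times> carrier W)\<^esub> c) b
    = free_eval K U (\<lambda>p. b (fst p) (snd p)) c"
proof -
  let ?F = "free_space K (carrier V \<times> carrier W)"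
  let ?ev = "free_eval K U (\<lambda>p. b (fst p) (snd p))"
  let ?t = "tensor_null K V W +>\<^bsub>?F\<^esub> c"
  have F: "vectorspace K ?F" by (rule free_space_vectorspace[OF field_of_vectorspace[OF U]])
  interpret V: vectorspace K V by fact
  interpret W: vectorspace K W by fact
  interpret F: vectorspace K ?F by fact
  interpret U: vectorspace K U by fact
  have bU: "(\<lambda>p. b (fst p) (snd p)) \<in> carrier V \<times> carrier W \<rightarrow> carrier U"
    using bilinear_closed[OF b] by auto
  note ev = free_eval_hom[OF U bU] and evg = free_eval_gen[OF U bU]
  interpret ev: mod_hom K ?F U ?ev by unfold_locales (rule ev)
  have gen: "free_gen K (v, w) \<in> carrier ?F" if "v \<in> carrier V" "w \<in> carrier W" for v w
    using that by (intro free_gen_closed) (auto simp: V.field_axioms)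
  note bl = bilinear_left[OF b] and br = bilinear_right[OF b]
  have kerI: "y \<ominus>\<^bsub>?F\<^esub> z \<in> ev.ker" if "y \<in> carrier ?F" "z \<in> carrier ?F" "?ev y = ?ev z" for y z
  proof -
    have "?ev (y \<ominus>\<^bsub>?F\<^esub> z) = \<zero>\<^bsub>U\<^esub>" using that hom_diff[OF F U ev] hom_closed[OF ev] by simp
    then show ?thesis using F.M.minus_closed[OF that(1,2)] by (simp add: ev.ker_def)
  qed
  have "bilinear_relators K V W \<subseteq> ev.ker"
    unfolding bilinear_relators_def Let_def
  proof (intro Un_least subsetI; elim CollectE exE conjE; hypsubst)
    fix v v' w assume *: "v \<in> carrier V" "v' \<in> carrier V" "w \<in> carrier W"
    show "free_gen K (v \<oplus>\<^bsub>V\<^esub> v', w) \<ominus>\<^bsub>?F\<^esub> (free_gen K (v, w) \<oplus>\<^bsub>?F\<^esub> free_gen K (v', w)) \<in> ev.ker"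
      by (rule kerI) (simp_all add: * gen evg module_hom_add[OF ev] module_hom_add[OF bl])
  next
    fix v w w' assume *: "v \<in> carrier V" "w \<in> carrier W" "w' \<in> carrier W"
    show "free_gen K (v, w \<oplus>\<^bsub>W\<^esub> w') \<ominus>\<^bsub>?F\<^esub> (free_gen K (v, w) \<oplus>\<^bsub>?F\<^esub> free_gen K (v, w')) \<in> ev.ker"
      by (rule kerI) (simp_all add: * gen evg module_hom_add[OF ev] module_hom_add[OF br])
  next
    fix a v w assume *: "a \<in> carrier K" "v \<in> carrier V" "w \<in> carrier W"
    show "free_gen K (a \<odot>\<^bsub>V\<^esub> v, w) \<ominus>\<^bsub>?F\<^esub> (a \<odot>\<^bsub>?F\<^esub> free_gen K (v, w)) \<in> ev.ker"
      by (rule kerI) (simp_all add: * gen evg module_hom_smult[OF ev] module_hom_smult[OF bl])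
  next
    fix a v w assume *: "a \<in> carrier K" "v \<in> carrier V" "w \<in> carrier W"
    show "free_gen K (v, a \<odot>\<^bsub>W\<^esub> w) \<ominus>\<^bsub>?F\<^esub> (a \<odot>\<^bsub>?F\<^esub> free_gen K (v, w)) \<in> ev.ker"
      by (rule kerI) (simp_all add: * gen evg module_hom_smult[OF ev] module_hom_smult[OF br])
  qed
  then have null: "tensor_null K V W \<subseteq> ev.ker"
    unfolding tensor_null_def by (intro F.span_is_subset ev.ker_is_submodule)
  note N = tensor_null_submodule[OF V]
  have t: "?t \<in> carrier (tensor K V W)" by (rule hom_closed[OF tensor_proj_hom[OF V] c])
  note rep = tensor_representative[OF V t]
  define d where "d = (SOME d. d \<in> ?t)"
  note rep = rep[folded d_def]
  have "d \<ominus>\<^bsub>?F\<^esub> c \<in> tensor_null K V W"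
    using quotient_proj_eq[OF F N rep(1) c] rep(2) by simp
  then have "?ev d \<ominus>\<^bsub>U\<^esub> ?ev c = \<zero>\<^bsub>U\<^esub>"
    using null hom_diff[OF F U ev rep(1) c] by (auto simp: ev.ker_def)
  then have "?ev d = ?ev c" using hom_closed[OF ev] rep(1) c by simp
  then show ?thesis unfolding tensor_lift_eval d_def .
qed

lemma lift_pure:
  assumes V: "vectorspace K V" "vectorspace K W" and U: "vectorspace K U" and b: "bilinear K V W U b"
    and "v \<in> carrier V" "w \<in> carrier W"
  shows "tensor_lift K U (pure_tensor K V W v w) b = b v w"
proof -
  have bU: "(\<lambda>p. b (fst p) (snd p)) \<in> carrier V \<times> carrier W \<rightarrow> carrier U"
    using bilinear_closed[OF b] by auto
  show ?thesis unfolding pure_tensor_def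
    by (subst lift_proj[OF V U b]) (use assms free_eval_gen[OF U bU, of "(v, w)"]
        free_gen_closed[OF field_of_vectorspace[OF U], of "(v, w)"] in auto)
qed

lemma lift_hom:
  assumes V: "vectorspace K V" "vectorspace K W" and U: "vectorspace K U" and b: "bilinear K V W U b"
  shows "(\<lambda>t. tensor_lift K U t b) \<in> module_hom K (tensor K V W) U"
proof -
  let ?F = "free_space K (carrier V \<times> carrier W)"
  let ?ev = "free_eval K U (\<lambda>p. b (fst p) (snd p))"
  let ?pr = "\<lambda>c. tensor_null K V W +>\<^bsub>?F\<^esub> c"
  have F: "vectorspace K ?F" by (rule free_space_vectorspace[OF field_of_vectorspace[OF U]])
  interpret F: vectorspace K ?F by fact
  have bU: "(\<lambda>p. b (fst p) (snd p)) \<in> carrier V \<times> carrier W \<rightarrow> carrier U"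
    using bilinear_closed[OF b] by auto
  note ev = free_eval_hom[OF U bU] and pr = tensor_proj_hom[OF V]
  note lift = lift_proj[OF V U b]
  have rep: "\<exists>c\<in>carrier ?F. t = ?pr c" if "t \<in> carrier (tensor K V W)" for t
    using tensor_representative[OF V that] by metis
  show ?thesis
  proof (rule homI)
    show "tensor_lift K U t b \<in> carrier U" if t: "t \<in> carrier (tensor K V W)" for t
      using lift_closed[OF V U t] bilinear_closed[OF b] by blast
  next
    fix s t assume "s \<in> carrier (tensor K V W)" "t \<in> carrier (tensor K V W)"
    then obtain c d where cd: "c \<in> carrier ?F" "d \<in> carrier ?F" "s = ?pr c" "t = ?pr d"
      using rep by metis
    have "s \<oplus>\<^bsub>tensor K V W\<^esub> t = ?pr (c \<oplus>\<^bsub>?F\<^esub> d)" using module_hom_add[OF pr] cd by simp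
    then show "tensor_lift K U (s \<oplus>\<^bsub>tensor K V W\<^esub> t) b = tensor_lift K U s b \<oplus>\<^bsub>U\<^esub> tensor_lift K U t b"
      using cd module_hom_add[OF ev] by (simp add: lift)
  next
    fix a t assume a: "a \<in> carrier K" and "t \<in> carrier (tensor K V W)"
    then obtain c where c: "c \<in> carrier ?F" "t = ?pr c" using rep by metis
    have "a \<odot>\<^bsub>tensor K V W\<^esub> t = ?pr (a \<odot>\<^bsub>?F\<^esub> c)" using module_hom_smult[OF pr] c a by simp
    then show "tensor_lift K U (a \<odot>\<^bsub>tensor K V W\<^esub> t) b = a \<odot>\<^bsub>U\<^esub> tensor_lift K U t b"
      using c a module_hom_smult[OF ev] by (simp add: lift)
  qed
qed

text \<open>
  Projecting a representative, written as a combination of generators, displays a tensor as a sum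
  of pure tensors.
\<close>

lemma lift_pure_id:
  assumes V: "vectorspace K V" "vectorspace K W" and t: "t \<in> carrier (tensor K V W)"
  shows "tensor_lift K (tensor K V W) t (pure_tensor K V W) = t"
proof -
  let ?F = "free_space K (carrier V \<times> carrier W)"
  have F: "vectorspace K ?F" by (rule free_space_vectorspace[OF field_of_vectorspace[OF V(1)]])
  interpret F: vectorspace K ?F by fact
  define c where "c = (SOME c. c \<in> t)"
  note rep = tensor_representative[OF V t, folded c_def]
  note facts = representative_facts[OF V t, folded c_def]
  note pr = tensor_proj_hom[OF V]
  note T = tensor_vectorspace[OF V]
  interpret T: vectorspace K "tensor K V W" by fact
  have gen: "free_gen K p \<in> carrier ?F" if "c p \<noteq> \<zero>\<^bsub>K\<^esub>" for p
    using facts(3)[OF that] by (intro free_gen_closed[OF field_of_vectorspace[OF V(1)]]) (auto simp: mem_Times_iff)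
  have "t = tensor_null K V W +>\<^bsub>?F\<^esub> (\<Oplus>\<^bsub>?F\<^esub>p\<in>{p. c p \<noteq> \<zero>\<^bsub>K\<^esub>}. c p \<odot>\<^bsub>?F\<^esub> free_gen K p)"
    using rep free_eval_id[OF field_of_vectorspace[OF V(1)] rep(1)] unfolding free_eval_def by simp
  also have "\<dots> = (\<Oplus>\<^bsub>tensor K V W\<^esub>p\<in>{p. c p \<noteq> \<zero>\<^bsub>K\<^esub>}. tensor_null K V W +>\<^bsub>?F\<^esub> (c p \<odot>\<^bsub>?F\<^esub> free_gen K p))"
    using gen facts(2) by (intro hom_finsum[OF F T pr]) (auto intro!: F.smult_closed)
  also have "\<dots> = (\<Oplus>\<^bsub>tensor K V W\<^esub>p\<in>{p. c p \<noteq> \<zero>\<^bsub>K\<^esub>}. c p \<odot>\<^bsub>tensor K V W\<^esub> pure_tensor K V W (fst p) (snd p))"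
    using gen facts pure_tensor_closed[OF V] module_hom_smult[OF pr]
    by (intro T.M.finsum_cong') (auto intro!: T.smult_closed simp: pure_tensor_def)
  finally show ?thesis unfolding tensor_lift_def Let_def c_def by simp
qed

section \<open>Linearity in one Sweedler component\<close>

text \<open>
  Linearity and membership are decided by the syntax of a term: each operation contributes one rule
  for each of its arguments, and a Sweedler sum reduces to its body. The side conditions of a
  calculation are discharged by applying the collected rules exhaustively. Rules about the
  structures at hand are added locally.
\<close>

named_theorems lin

declare tensor_vectorspace [lin] pure_tensor_closed [lin] bilinearI [lin]

lemma hom_id [lin]: "(\<lambda>x. x) \<in> module_hom K V V"
  by (rule homI) auto

lemma hom_compose:
  "\<lbrakk>f \<in> module_hom K A B; (\<lambda>x. g x) \<in> module_hom K V A\<rbrakk> \<Longrightarrow> (\<lambda>x. f (g x)) \<in> module_hom K V B"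
  by (rule homI) (simp_all add: hom_closed module_hom_add module_hom_smult)

lemma hom_bilinear_left:
  "\<lbrakk>bilinear K A B U b; (\<lambda>x. g x) \<in> module_hom K V A; w \<in> carrier B\<rbrakk> \<Longrightarrow> (\<lambda>x. b (g x) w) \<in> module_hom K V U"
  by (rule hom_compose[OF bilinear_left])

lemma hom_bilinear_right:
  "\<lbrakk>bilinear K A B U b; v \<in> carrier A; (\<lambda>x. g x) \<in> module_hom K V B\<rbrakk> \<Longrightarrow> (\<lambda>x. b v (g x)) \<in> module_hom K V U"
  by (rule hom_compose[OF bilinear_right])

lemma hom_pure_left [lin]:
  "\<lbrakk>vectorspace K A; vectorspace K B; (\<lambda>x. g x) \<in> module_hom K V A; w \<in> carrier B\<rbrakk>
    \<Longrightarrow> (\<lambda>x. pure_tensor K A B (g x) w) \<in> module_hom K V (tensor K A B)"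
  by (rule hom_bilinear_left[OF pure_tensor_bilinear])

lemma hom_pure_right [lin]:
  "\<lbrakk>vectorspace K A; vectorspace K B; v \<in> carrier A; (\<lambda>x. g x) \<in> module_hom K V B\<rbrakk>
    \<Longrightarrow> (\<lambda>x. pure_tensor K A B v (g x)) \<in> module_hom K V (tensor K A B)"
  by (rule hom_bilinear_right[OF pure_tensor_bilinear])

text \<open>
  The parameter \<open>x\<close> occurs below the sum only. Since \<open>t\<close> does not depend on \<open>x\<close>, neither does the
  representative, and a fixed finite sum of linear maps is linear.
\<close>

lemma hom_lift_body:
  assumes AB: "vectorspace K A" "vectorspace K B" and t: "t \<in> carrier (tensor K A B)"
    and U: "vectorspace K U" and V: "vectorspace K V"
    and f: "\<And>a b. \<lbrakk>a \<in> carrier A; b \<in> carrier B\<rbrakk> \<Longrightarrow> (\<lambda>x. f x a b) \<in> module_hom K V U"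
  shows "(\<lambda>x. tensor_lift K U t (f x)) \<in> module_hom K V U"
proof -
  interpret U: vectorspace K U by fact
  interpret V: vectorspace K V by fact
  define c where "c = (SOME c. c \<in> t)"
  note rep = representative_facts[OF AB t, folded c_def]
  have lin: "(\<lambda>x. f x (fst p) (snd p)) \<in> module_hom K V U" if "c p \<noteq> \<zero>\<^bsub>K\<^esub>" for p
    using rep(3)[OF that] f by blast
  have cl: "f x (fst p) (snd p) \<in> carrier U" if "c p \<noteq> \<zero>\<^bsub>K\<^esub>" "x \<in> carrier V" for p x
    using hom_closed[OF lin[OF that(1)] that(2)] .
  show ?thesis
  proof (rule homI)
    fix x assume "x \<in> carrier V"
    then show "tensor_lift K U t (f x) \<in> carrier U"
      using lift_closed[OF AB U t] hom_closed[OF f] by blast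
  next
    fix x y assume xy: "x \<in> carrier V" "y \<in> carrier V"
    have "tensor_lift K U t (f (x \<oplus>\<^bsub>V\<^esub> y)) = (\<Oplus>\<^bsub>U\<^esub>p\<in>{p. c p \<noteq> \<zero>\<^bsub>K\<^esub>}.
        c p \<odot>\<^bsub>U\<^esub> f x (fst p) (snd p) \<oplus>\<^bsub>U\<^esub> c p \<odot>\<^bsub>U\<^esub> f y (fst p) (snd p))"
      unfolding tensor_lift_def Let_def c_def[symmetric]
      using xy by (intro U.M.finsum_cong')
        (auto intro!: U.M.a_closed U.smult_closed rep(2) cl simp: module_hom_add[OF lin] U.smult_r_distr rep(2) cl)
    also have "\<dots> = tensor_lift K U t (f x) \<oplus>\<^bsub>U\<^esub> tensor_lift K U t (f y)"
      unfolding tensor_lift_def Let_def c_def[symmetric]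
      using xy by (intro U.M.finsum_addf) (auto intro!: U.smult_closed rep(2) cl)
    finally show "tensor_lift K U t (f (x \<oplus>\<^bsub>V\<^esub> y)) = tensor_lift K U t (f x) \<oplus>\<^bsub>U\<^esub> tensor_lift K U t (f y)" .
  next
    fix a x assume a: "a \<in> carrier K" and x: "x \<in> carrier V"
    have "tensor_lift K U t (f (a \<odot>\<^bsub>V\<^esub> x)) = (\<Oplus>\<^bsub>U\<^esub>p\<in>{p. c p \<noteq> \<zero>\<^bsub>K\<^esub>}.
        a \<odot>\<^bsub>U\<^esub> (c p \<odot>\<^bsub>U\<^esub> f x (fst p) (snd p)))"
      unfolding tensor_lift_def Let_def c_def[symmetric]
    proof (rule U.M.finsum_cong'[OF refl])
      show "(\<lambda>p. a \<odot>\<^bsub>U\<^esub> (c p \<odot>\<^bsub>U\<^esub> f x (fst p) (snd p))) \<in> {p. c p \<noteq> \<zero>\<^bsub>K\<^esub>} \<rightarrow> carrier U"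
        using a x by (auto intro!: U.smult_closed rep(2) cl)
      fix p assume "p \<in> {p. c p \<noteq> \<zero>\<^bsub>K\<^esub>}"
      then have p: "c p \<noteq> \<zero>\<^bsub>K\<^esub>" by simp
      show "c p \<odot>\<^bsub>U\<^esub> f (a \<odot>\<^bsub>V\<^esub> x) (fst p) (snd p) = a \<odot>\<^bsub>U\<^esub> (c p \<odot>\<^bsub>U\<^esub> f x (fst p) (snd p))"
        using module_hom_smult[OF lin[OF p] a x] U.smult_assoc1[OF a rep(2) cl[OF p x]]
          U.smult_assoc1[OF rep(2) a cl[OF p x]] U.R.m_comm[OF a rep(2)] by simp
    qed
    also have "\<dots> = a \<odot>\<^bsub>U\<^esub> tensor_lift K U t (f x)"
      unfolding tensor_lift_def Let_def c_def[symmetric]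
      using a x by (intro U.finsum_smult[symmetric]) (auto intro!: U.smult_closed rep(2) cl)
    finally show "tensor_lift K U t (f (a \<odot>\<^bsub>V\<^esub> x)) = a \<odot>\<^bsub>U\<^esub> tensor_lift K U t (f x)" .
  qed
qed

text \<open>
  The next three rules specialise the sum to the values of a linear map \<open>r\<close> into a tensor product,
  such as a coaction or a braiding. Once the typing of \<open>r\<close> is supplied, resolution knows the two
  factors, which the term \<open>tensor_lift K U (r c) f\<close> does not show.
\<close>

lemma coaction_body:
  assumes "r \<in> module_hom K C (tensor K A B)" "vectorspace K A" "vectorspace K B"
    and "vectorspace K U" "vectorspace K V" "c \<in> carrier C"
    and "\<And>a b. \<lbrakk>a \<in> carrier A; b \<in> carrier B\<rbrakk> \<Longrightarrow> (\<lambda>x. f x a b) \<in> module_hom K V U"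
  shows "(\<lambda>x. tensor_lift K U (r c) (f x)) \<in> module_hom K V U"
  by (rule hom_lift_body[OF assms(2,3) hom_closed[OF assms(1,6)] assms(4,5,7)])

lemma coaction_arg:
  assumes "r \<in> module_hom K C (tensor K A B)" "vectorspace K A" "vectorspace K B"
    and "vectorspace K U" "(\<lambda>x. g x) \<in> module_hom K V C" "bilinear K A B U b"
  shows "(\<lambda>x. tensor_lift K U (r (g x)) b) \<in> module_hom K V U"
  by (rule hom_compose[OF lift_hom[OF assms(2-4,6)] hom_compose[OF assms(1,5)]])

lemma coaction_closed:
  assumes "r \<in> module_hom K C (tensor K A B)" "vectorspace K A" "vectorspace K B"
    and "vectorspace K U" "c \<in> carrier C"
    and "\<And>a b. \<lbrakk>a \<in> carrier A; b \<in> carrier B\<rbrakk> \<Longrightarrow> f a b \<in> carrier U"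
  shows "tensor_lift K U (r c) f \<in> carrier U"
  by (rule lift_closed[OF assms(2-4) hom_closed[OF assms(1,5)] assms(6)])

lemmas coaction_rules = coaction_body coaction_arg coaction_closed

lemma lift_lift:
  assumes "vectorspace K A" "vectorspace K B" "t \<in> carrier (tensor K A B)"
    and "vectorspace K C" "vectorspace K D" "vectorspace K U" "bilinear K C D U b"
    and "\<And>x y. \<lbrakk>x \<in> carrier A; y \<in> carrier B\<rbrakk> \<Longrightarrow> g x y \<in> carrier (tensor K C D)"
  shows "tensor_lift K U (tensor_lift K (tensor K C D) t g) b
    = tensor_lift K U t (\<lambda>x y. tensor_lift K U (g x y) b)"
  by (rule hom_lift[OF assms(1-3) tensor_vectorspace[OF assms(4,5)] assms(6) lift_hom[OF assms(4-7)] assms(8)])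

text \<open>
  Linear maps on a tensor product are determined by their values on pure tensors; the sum over a
  representative replaces an induction over tensors.
\<close>

lemma hom_eq_lift:
  assumes "vectorspace K A" "vectorspace K B" "vectorspace K U"
    and "f \<in> module_hom K (tensor K A B) U" "t \<in> carrier (tensor K A B)"
  shows "f t = tensor_lift K U t (\<lambda>a b. f (pure_tensor K A B a b))"
  using hom_lift[OF assms(1,2,5) tensor_vectorspace[OF assms(1,2)] assms(3,4), of "pure_tensor K A B"]
    lift_pure_id[OF assms(1,2,5)] pure_tensor_closed[OF assms(1,2)] by simp

lemma hom_tensor_eqI:
  assumes "vectorspace K A" "vectorspace K B" "vectorspace K U"
    and "f \<in> module_hom K (tensor K A B) U" "g \<in> module_hom K (tensor K A B) U" "t \<in> carrier (tensor K A B)"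
    and "\<And>a b. \<lbrakk>a \<in> carrier A; b \<in> carrier B\<rbrakk> \<Longrightarrow> f (pure_tensor K A B a b) = g (pure_tensor K A B a b)"
  shows "f t = g t"
  unfolding hom_eq_lift[OF assms(1-4,6)] hom_eq_lift[OF assms(1-3,5,6)]
  by (rule lift_cong[OF assms(1-3,6) assms(7)])
    (simp_all add: hom_closed[OF assms(5)] pure_tensor_closed[OF assms(1,2)])

section \<open>Tensor products of linear maps and reassociation\<close>

lemma tensor_map_eq:
  "t \<in> carrier (tensor K V W) \<Longrightarrow> tensor_map K V W V2 W2 f g t
    = tensor_lift K (tensor K V2 W2) t (\<lambda>v w. pure_tensor K V2 W2 (f v) (g w))"
  by (simp add: tensor_map_def)

context
  fixes K V W V2 W2 f g
  assumes vs [lin]: "vectorspace K V" "vectorspace K W" "vectorspace K V2" "vectorspace K W2"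
    and f: "f \<in> module_hom K V V2" and g: "g \<in> module_hom K W W2"
begin

lemma tensor_map_bilinear: "bilinear K V W (tensor K V2 W2) (\<lambda>v w. pure_tensor K V2 W2 (f v) (g w))"
  by (rule lin hom_compose[OF f] hom_compose[OF g] hom_closed[OF f] hom_closed[OF g] | assumption)+

lemma tensor_map_hom: "tensor_map K V W V2 W2 f g \<in> module_hom K (tensor K V W) (tensor K V2 W2)"
  by (rule hom_cong[OF _ _ lift_hom[OF _ _ _ tensor_map_bilinear]])
    (simp_all add: tensor_map_eq vs tensor_vectorspace)

lemma tensor_map_pure:
  "\<lbrakk>v \<in> carrier V; w \<in> carrier W\<rbrakk> \<Longrightarrow>
    tensor_map K V W V2 W2 f g (pure_tensor K V W v w) = pure_tensor K V2 W2 (f v) (g w)"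
  by (simp add: tensor_map_eq vs pure_tensor_closed lift_pure[OF _ _ _ tensor_map_bilinear] tensor_vectorspace)

end

lemma id_hom: "id \<in> module_hom K V V"
  using hom_id by (simp add: id_def)

context
  fixes K U V W
  assumes vs [lin]: "vectorspace K U" "vectorspace K V" "vectorspace K W"
begin

lemma assoc_bilinear:
  "bilinear K (tensor K U V) W (tensor K U (tensor K V W))
    (\<lambda>p w. tensor_lift K (tensor K U (tensor K V W)) p (\<lambda>u v.
         pure_tensor K U (tensor K V W) u (pure_tensor K V W v w)))"
  by (rule lin coaction_rules[OF hom_id] | assumption)+

lemma tensor_assoc_hom:
  "tensor_assoc K U V W \<in> module_hom K (tensor K (tensor K U V) W) (tensor K U (tensor K V W))"
  by (rule hom_cong[OF _ _ lift_hom[OF _ _ _ assoc_bilinear]])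
    (simp_all add: tensor_assoc_def vs tensor_vectorspace)

lemma tensor_assoc_pure:
  assumes "u \<in> carrier U" "v \<in> carrier V" "w \<in> carrier W"
  shows "tensor_assoc K U V W (pure_tensor K (tensor K U V) W (pure_tensor K U V u v) w)
    = pure_tensor K U (tensor K V W) u (pure_tensor K V W v w)"
proof -
  have *: "bilinear K U V (tensor K U (tensor K V W))
    (\<lambda>u v. pure_tensor K U (tensor K V W) u (pure_tensor K V W v w))"
    using assms(3) by - (rule lin | assumption)+
  show ?thesis using assms
    by (simp add: tensor_assoc_def vs tensor_vectorspace pure_tensor_closed
        lift_pure[OF _ _ _ assoc_bilinear] lift_pure[OF _ _ _ *])
qed

lemma unassoc_bilinear:
  "bilinear K U (tensor K V W) (tensor K (tensor K U V) W)
    (\<lambda>u q. tensor_lift K (tensor K (tensor K U V) W) q (\<lambda>v w.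
         pure_tensor K (tensor K U V) W (pure_tensor K U V u v) w))"
  by (rule lin coaction_rules[OF hom_id] | assumption)+

lemma tensor_unassoc_hom:
  "tensor_unassoc K U V W \<in> module_hom K (tensor K U (tensor K V W)) (tensor K (tensor K U V) W)"
  by (rule hom_cong[OF _ _ lift_hom[OF _ _ _ unassoc_bilinear]])
    (simp_all add: tensor_unassoc_def vs tensor_vectorspace)

lemma tensor_unassoc_pure:
  assumes "u \<in> carrier U" "v \<in> carrier V" "w \<in> carrier W"
  shows "tensor_unassoc K U V W (pure_tensor K U (tensor K V W) u (pure_tensor K V W v w))
    = pure_tensor K (tensor K U V) W (pure_tensor K U V u v) w"
proof -
  have *: "bilinear K V W (tensor K (tensor K U V) W)
    (\<lambda>v w. pure_tensor K (tensor K U V) W (pure_tensor K U V u v) w)"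
    using assms(1) by - (rule lin | assumption)+
  show ?thesis using assms
    by (simp add: tensor_unassoc_def vs tensor_vectorspace pure_tensor_closed
        lift_pure[OF _ _ _ unassoc_bilinear] lift_pure[OF _ _ _ *])
qed

end

section \<open>The Yang-Baxter equation on pure tensors\<close>

lemma hom_tensor3_eqI:
  assumes vs [lin]: "vectorspace K A" "vectorspace K B" "vectorspace K C" "vectorspace K U"
    and f: "f \<in> module_hom K (tensor K (tensor K A B) C) U"
    and g: "g \<in> module_hom K (tensor K (tensor K A B) C) U"
    and t: "t \<in> carrier (tensor K (tensor K A B) C)"
    and eq: "\<And>a b c. \<lbrakk>a \<in> carrier A; b \<in> carrier B; c \<in> carrier C\<rbrakk> \<Longrightarrow>
      f (pure_tensor K (tensor K A B) C (pure_tensor K A B a b) c)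
      = g (pure_tensor K (tensor K A B) C (pure_tensor K A B a b) c)"
  shows "f t = g t"
proof (rule hom_tensor_eqI[OF tensor_vectorspace[OF vs(1,2)] vs(3,4) f g t])
  fix p c assume p: "p \<in> carrier (tensor K A B)" and c: "c \<in> carrier C"
  have lin: "(\<lambda>p. h (pure_tensor K (tensor K A B) C p c)) \<in> module_hom K (tensor K A B) U"
    if "h \<in> module_hom K (tensor K (tensor K A B) C) U" for h
    using c by - (rule lin hom_compose[OF that] | assumption)+
  show "f (pure_tensor K (tensor K A B) C p c) = g (pure_tensor K (tensor K A B) C p c)"
    by (rule hom_tensor_eqI[OF vs(1,2,4) lin[OF f] lin[OF g] p]) (rule eq[OF _ _ c])
qed

text \<open>
  Both sides of the equation are linear, so pure tensors suffice. On a pure tensor each braiding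
  acts on two adjacent factors, producing a Sweedler sum through which the remaining maps pass, and
  the reassociations only regroup pure tensors.
\<close>

lemma yang_baxterI:
  fixes K :: "('k, 'r) ring_scheme" and A B C :: "('k, 'u) module"
  defines "T \<equiv> tensor K (tensor K C B) A"
  assumes S: "space S i = A" "space S j = B" "space S k = C"
    and s: "braid S (i, j) = s_ij" "braid S (i, k) = s_ik" "braid S (j, k) = s_jk"
    and vs [lin]: "vectorspace K A" "vectorspace K B" "vectorspace K C"
    and ij: "s_ij \<in> module_hom K (tensor K A B) (tensor K B A)"
    and ik: "s_ik \<in> module_hom K (tensor K A C) (tensor K C A)"
    and jk: "s_jk \<in> module_hom K (tensor K B C) (tensor K C B)"
    and eq: "\<And>x y z. \<lbrakk>x \<in> carrier A; y \<in> carrier B; z \<in> carrier C\<rbrakk> \<Longrightarrow>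
      tensor_lift K T (s_ij (pure_tensor K A B x y)) (\<lambda>b a.
        tensor_lift K T (s_ik (pure_tensor K A C a z)) (\<lambda>c a'.
          tensor_lift K T (s_jk (pure_tensor K B C b c)) (\<lambda>c' b'.
            pure_tensor K (tensor K C B) A (pure_tensor K C B c' b') a')))
      = tensor_lift K T (s_jk (pure_tensor K B C y z)) (\<lambda>c b.
        tensor_lift K T (s_ik (pure_tensor K A C x c)) (\<lambda>c' a.
          tensor_lift K T (s_ij (pure_tensor K A B a b)) (\<lambda>b' a'.
            pure_tensor K (tensor K C B) A (pure_tensor K C B c' b') a')))"
  shows "yang_baxter K S i j k"
proof -
  let ?AB = "tensor K A B" and ?BA = "tensor K B A" and ?AC = "tensor K A C" and ?CA = "tensor K C A"
    and ?BC = "tensor K B C" and ?CB = "tensor K C B"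
  let ?l1 = "tensor_map K ?AB C ?BA C s_ij id" and ?l2 = "tensor_assoc K B A C"
    and ?l3 = "tensor_map K B ?AC B ?CA id s_ik" and ?l4 = "tensor_unassoc K B C A"
    and ?l5 = "tensor_map K ?BC A ?CB A s_jk id"
  let ?r1 = "tensor_assoc K A B C" and ?r2 = "tensor_map K A ?BC A ?CB id s_jk"
    and ?r3 = "tensor_unassoc K A C B" and ?r4 = "tensor_map K ?AC B ?CA B s_ik id"
    and ?r5 = "tensor_assoc K C A B" and ?r6 = "tensor_map K C ?AB C ?BA id s_ij"
    and ?r7 = "tensor_unassoc K C B A"
  have tv [lin]: "vectorspace K T" unfolding T_def by (rule lin)+
  have tvs: "vectorspace K ?AB" "vectorspace K ?BA" "vectorspace K ?AC" "vectorspace K ?CA"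
    "vectorspace K ?BC" "vectorspace K ?CB" by (rule lin)+
  note tm = tensor_map_hom and as = tensor_assoc_hom and un = tensor_unassoc_hom
  note idh = id_hom
  have l1: "?l1 \<in> module_hom K (tensor K ?AB C) (tensor K ?BA C)" by (intro tm lin ij idh)
  have l2: "?l2 \<in> module_hom K (tensor K ?BA C) (tensor K B ?AC)" by (intro as lin)
  have l3: "?l3 \<in> module_hom K (tensor K B ?AC) (tensor K B ?CA)" by (intro tm lin ik idh)
  have l4: "?l4 \<in> module_hom K (tensor K B ?CA) (tensor K ?BC A)" by (intro un lin)
  have l5: "?l5 \<in> module_hom K (tensor K ?BC A) T" unfolding T_def by (intro tm lin jk idh)
  have r1: "?r1 \<in> module_hom K (tensor K ?AB C) (tensor K A ?BC)" by (intro as lin)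
  have r2: "?r2 \<in> module_hom K (tensor K A ?BC) (tensor K A ?CB)" by (intro tm lin jk idh)
  have r3: "?r3 \<in> module_hom K (tensor K A ?CB) (tensor K ?AC B)" by (intro un lin)
  have r4: "?r4 \<in> module_hom K (tensor K ?AC B) (tensor K ?CA B)" by (intro tm lin ik idh)
  have r5: "?r5 \<in> module_hom K (tensor K ?CA B) (tensor K C ?AB)" by (intro as lin)
  have r6: "?r6 \<in> module_hom K (tensor K C ?AB) (tensor K C ?BA)" by (intro tm lin ij idh)
  have r7: "?r7 \<in> module_hom K (tensor K C ?BA) T" unfolding T_def by (intro un lin)
  have L: "(\<lambda>t. ?l5 (?l4 (?l3 (?l2 (?l1 t))))) \<in> module_hom K (tensor K ?AB C) T"
    by (intro hom_compose[OF l5] hom_compose[OF l4] hom_compose[OF l3] hom_compose[OF l2] l1)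
  have R: "(\<lambda>t. ?r7 (?r6 (?r5 (?r4 (?r3 (?r2 (?r1 t))))))) \<in> module_hom K (tensor K ?AB C) T"
    by (intro hom_compose[OF r7] hom_compose[OF r6] hom_compose[OF r5] hom_compose[OF r4]
        hom_compose[OF r3] hom_compose[OF r2] r1)
  have "?l5 (?l4 (?l3 (?l2 (?l1 t)))) = ?r7 (?r6 (?r5 (?r4 (?r3 (?r2 (?r1 t))))))"
    if t: "t \<in> carrier (tensor K ?AB C)" for t
  proof (rule hom_tensor3_eqI[OF vs tv L R t])
    fix x y z assume x: "x \<in> carrier A" and y: "y \<in> carrier B" and z: "z \<in> carrier C"
    let ?P = "\<lambda>c b a. pure_tensor K ?CB A (pure_tensor K C B c b) a"
    let ?L = "tensor_lift K T" and ?ij = "\<lambda>a b. s_ij (pure_tensor K A B a b)"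
      and ?ik = "\<lambda>a c. s_ik (pure_tensor K A C a c)" and ?jk = "\<lambda>b c. s_jk (pure_tensor K B C b c)"
      and ?abc = "pure_tensor K ?AB C (pure_tensor K A B x y) z"
    note [lin] = x y z hom_closed[OF ij] hom_closed[OF ik] hom_closed[OF jk]
    have e5: "?l5 (?l4 (pure_tensor K B ?CA b (pure_tensor K C A c a))) =
        ?L (?jk b c) (\<lambda>c' b'. ?P c' b' a)"
      if abc: "a \<in> carrier A" "b \<in> carrier B" "c \<in> carrier C" for a b c
    proof -
      have "?l5 (?l4 (pure_tensor K B ?CA b (pure_tensor K C A c a)))
          = pure_tensor K ?CB A (?jk b c) a"
        using abc by (simp add: tensor_unassoc_pure vs tensor_map_pure[OF tvs(5) vs(1) tvs(6) vs(1) jk idh]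
            pure_tensor_closed)
      also have "\<dots> = ?L (?jk b c) (\<lambda>c' b'. ?P c' b' a)"
        using abc unfolding T_def
        by - (rule hom_eq_lift[where f = "\<lambda>u. pure_tensor K ?CB A u a"], (rule lin | assumption)+)
      finally show ?thesis .
    qed
    have e3: "?l5 (?l4 (?l3 (?l2 (pure_tensor K ?BA C (pure_tensor K B A b a) z)))) =
        ?L (?ik a z) (\<lambda>c a'.
          ?L (?jk b c) (\<lambda>c' b'. ?P c' b' a'))"
      if ab: "a \<in> carrier A" "b \<in> carrier B" for a b
    proof -
      have "?l3 (?l2 (pure_tensor K ?BA C (pure_tensor K B A b a) z))
          = pure_tensor K B ?CA b (?ik a z)"
        using ab z by (simp add: tensor_assoc_pure vs tensor_map_pure[OF vs(2) tvs(3) vs(2) tvs(4) idh ik]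
            pure_tensor_closed)
      then have "?l5 (?l4 (?l3 (?l2 (pure_tensor K ?BA C (pure_tensor K B A b a) z))))
          = ?L (?ik a z) (\<lambda>c a'.
              ?l5 (?l4 (pure_tensor K B ?CA b (pure_tensor K C A c a'))))"
        using ab
        by - (simp only:, rule hom_eq_lift[where f = "\<lambda>u. ?l5 (?l4 (pure_tensor K B ?CA b u))"],
            (rule lin hom_compose[OF l5] hom_compose[OF l4] | assumption)+)
      also have "\<dots> = ?L (?ik a z) (\<lambda>c a'.
          ?L (?jk b c) (\<lambda>c' b'. ?P c' b' a'))"
        using ab
        by - (rule lift_cong[OF vs(3,1) tv], (rule lin e5 | assumption)+, unfold T_def,
            (rule lin coaction_rules[OF jk] | assumption)+)
      finally show ?thesis .
    qed
    have "?l5 (?l4 (?l3 (?l2 (?l1 ?abc))))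
      = ?l5 (?l4 (?l3 (?l2 (pure_tensor K ?BA C (?ij x y) z))))"
      using x y z by (simp add: tensor_map_pure[OF tvs(1) vs(3) tvs(2) vs(3) ij idh] pure_tensor_closed vs)
    also have "\<dots> = ?L (?ij x y) (\<lambda>b a.
        ?l5 (?l4 (?l3 (?l2 (pure_tensor K ?BA C (pure_tensor K B A b a) z)))))"
      by (rule hom_eq_lift[where f = "\<lambda>u. ?l5 (?l4 (?l3 (?l2 (pure_tensor K ?BA C u z))))"],
          (rule lin hom_compose[OF l5] hom_compose[OF l4] hom_compose[OF l3] hom_compose[OF l2] | assumption)+)
    also have "\<dots> = ?L (?ij x y) (\<lambda>b a.
        ?L (?ik a z) (\<lambda>c a'.
          ?L (?jk b c) (\<lambda>c' b'. ?P c' b' a')))"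
      by (rule lift_cong[OF vs(2,1) tv], (rule lin e3 | assumption)+, unfold T_def,
          (rule lin coaction_rules[OF jk] coaction_rules[OF ik] | assumption)+)
    also note eq[OF x y z]
    finally have lhs: "?l5 (?l4 (?l3 (?l2 (?l1 ?abc))))
      = ?L (?jk y z) (\<lambda>c b.
        ?L (?ik x c) (\<lambda>c' a.
          ?L (?ij a b) (\<lambda>b' a'. ?P c' b' a')))" .
    have f6: "?r7 (?r6 (?r5 (pure_tensor K ?CA B (pure_tensor K C A c a) b))) =
        ?L (?ij a b) (\<lambda>b' a'. ?P c b' a')"
      if abc: "a \<in> carrier A" "b \<in> carrier B" "c \<in> carrier C" for a b c
    proof -
      have "?r6 (?r5 (pure_tensor K ?CA B (pure_tensor K C A c a) b))
          = pure_tensor K C ?BA c (?ij a b)"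
        using abc by (simp add: tensor_assoc_pure vs tensor_map_pure[OF vs(3) tvs(1) vs(3) tvs(2) idh ij]
            pure_tensor_closed)
      then have "?r7 (?r6 (?r5 (pure_tensor K ?CA B (pure_tensor K C A c a) b))) =
        ?L (?ij a b) (\<lambda>b' a'.
          ?r7 (pure_tensor K C ?BA c (pure_tensor K B A b' a')))"
        using abc by - (simp only:, rule hom_eq_lift[where f = "\<lambda>u. ?r7 (pure_tensor K C ?BA c u)"],
            (rule lin hom_compose[OF r7] | assumption)+)
      also have "\<dots> = ?L (?ij a b) (\<lambda>b' a'. ?P c b' a')"
        using abc by - (rule lift_cong[OF vs(2,1) tv], (rule lin tensor_unassoc_pure | assumption)+,
           unfold T_def, (rule lin | assumption)+)
      finally show ?thesis .
    qed
    have f4: "?r7 (?r6 (?r5 (?r4 (?r3 (pure_tensor K A ?CB x (pure_tensor K C B c b)))))) =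
        ?L (?ik x c) (\<lambda>c' a.
          ?L (?ij a b) (\<lambda>b' a'. ?P c' b' a'))"
      if bc: "b \<in> carrier B" "c \<in> carrier C" for b c
    proof -
      have "?r4 (?r3 (pure_tensor K A ?CB x (pure_tensor K C B c b)))
          = pure_tensor K ?CA B (?ik x c) b"
        using bc x by (simp add: tensor_unassoc_pure vs tensor_map_pure[OF tvs(3) vs(2) tvs(4) vs(2) ik idh]
            pure_tensor_closed)
      then have "?r7 (?r6 (?r5 (?r4 (?r3 (pure_tensor K A ?CB x (pure_tensor K C B c b)))))) =
        ?L (?ik x c) (\<lambda>c' a.
          ?r7 (?r6 (?r5 (pure_tensor K ?CA B (pure_tensor K C A c' a) b))))"
        using bc
        by - (simp only:, rule hom_eq_lift[where f = "\<lambda>u. ?r7 (?r6 (?r5 (pure_tensor K ?CA B u b)))"],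
            (rule lin hom_compose[OF r7] hom_compose[OF r6] hom_compose[OF r5] | assumption)+)
      also have "\<dots> = ?L (?ik x c) (\<lambda>c' a.
          ?L (?ij a b) (\<lambda>b' a'. ?P c' b' a'))"
        using bc by - (rule lift_cong[OF vs(3,1) tv], (rule lin f6 | assumption)+,
           unfold T_def, (rule lin coaction_rules[OF ij] | assumption)+)
      finally show ?thesis .
    qed
    have "?r2 (?r1 ?abc)
        = pure_tensor K A ?CB x (?jk y z)"
      using x y z by (simp add: tensor_assoc_pure vs tensor_map_pure[OF vs(1) tvs(5) vs(1) tvs(6) idh jk]
            pure_tensor_closed)
    then have "?r7 (?r6 (?r5 (?r4 (?r3 (?r2 (?r1 ?abc)))))) =
        ?L (?jk y z) (\<lambda>c b.
          ?r7 (?r6 (?r5 (?r4 (?r3 (pure_tensor K A ?CB x (pure_tensor K C B c b)))))))"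
      by - (simp only:, rule hom_eq_lift[where f = "\<lambda>u. ?r7 (?r6 (?r5 (?r4 (?r3 (pure_tensor K A ?CB x u)))))"],
            (rule lin hom_compose[OF r7] hom_compose[OF r6] hom_compose[OF r5] hom_compose[OF r4]
              hom_compose[OF r3] | assumption)+)
    also have "\<dots> = ?L (?jk y z) (\<lambda>c b.
        ?L (?ik x c) (\<lambda>c' a.
          ?L (?ij a b) (\<lambda>b' a'. ?P c' b' a')))"
      by (rule lift_cong[OF vs(3,2) tv], (rule lin f4 | assumption)+,
          unfold T_def, (rule lin coaction_rules[OF ij] coaction_rules[OF ik] | assumption)+)
    finally show "?l5 (?l4 (?l3 (?l2 (?l1 ?abc))))
      = ?r7 (?r6 (?r5 (?r4 (?r3 (?r2 (?r1 ?abc))))))"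
      unfolding lhs by (rule sym)
  qed
  then show ?thesis
    unfolding yang_baxter_def Let_def S s by blast
qed

section \<open>Comodule and module algebras\<close>

lemma self_space_simps:
  "carrier (self_space K) = carrier K" "\<zero>\<^bsub>self_space K\<^esub> = \<zero>\<^bsub>K\<^esub>"
  "x \<oplus>\<^bsub>self_space K\<^esub> y = x \<oplus>\<^bsub>K\<^esub> y" "a \<odot>\<^bsub>self_space K\<^esub> x = a \<otimes>\<^bsub>K\<^esub> x"
  by (simp_all add: self_space_def)

lemma self_space_vectorspace [lin]:
  assumes "field K"
  shows "vectorspace K (self_space K)"
proof -
  interpret field K by fact
  show ?thesis
  proof (rule vs_criteria)
    show "\<forall>v\<in>carrier (self_space K). \<exists>w\<in>carrier (self_space K). v \<oplus>\<^bsub>self_space K\<^esub> w = \<zero>\<^bsub>self_space K\<^esub>"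
      by (auto simp: self_space_simps intro: r_neg)
    show "\<forall>v w. v \<in> carrier (self_space K) \<and> w \<in> carrier (self_space K) \<longrightarrow>
      v \<oplus>\<^bsub>self_space K\<^esub> w = w \<oplus>\<^bsub>self_space K\<^esub> v"
      using a_comm by (simp add: self_space_simps)
  qed (simp_all add: self_space_simps a_assoc m_assoc l_distr r_distr assms)
qed

lemma hom_scalar:
  assumes "vectorspace K U" "f \<in> module_hom K V (self_space K)" "u \<in> carrier U"
  shows "(\<lambda>x. f x \<odot>\<^bsub>U\<^esub> u) \<in> module_hom K V U"
proof -
  interpret U: vectorspace K U by fact
  have cl: "f x \<in> carrier K" if "x \<in> carrier V" for x
    using hom_closed[OF assms(2) that] by (simp add: self_space_simps)
  show ?thesis using assms(3)
    by (intro homI) (auto simp: cl module_hom_add[OF assms(2)] module_hom_smult[OF assms(2)]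
        self_space_simps U.smult_l_distr U.smult_assoc1)
qed

lemma hom_smult:
  assumes "vectorspace K U" "c \<in> carrier K" "g \<in> module_hom K V U"
  shows "(\<lambda>x. c \<odot>\<^bsub>U\<^esub> g x) \<in> module_hom K V U"
proof -
  interpret U: vectorspace K U by fact
  show ?thesis using assms(2)
    by (intro homI) (auto simp: hom_closed[OF assms(3)] module_hom_add[OF assms(3)] module_hom_smult[OF assms(3)]
        U.smult_r_distr U.smult_assoc1[symmetric] U.R.m_comm)
qed

context unital_algebra
begin

lemma is_vectorspace: "vectorspace K A" by unfold_locales

lemma mult_bilinear: "bilinear K A A A (\<lambda>x y. x \<otimes>\<^bsub>A\<^esub> y)"
  by (intro bilinearI homI) (simp_all add: smult_mult_left smult_mult_right alg.l_distr alg.r_distr)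

lemmas mult_lin = hom_bilinear_left[OF mult_bilinear] hom_bilinear_right[OF mult_bilinear]
  bilinear_closed[OF mult_bilinear] is_vectorspace alg.one_closed

end

lemma (in bialgebra) counit_closed: "h \<in> carrier H \<Longrightarrow> counit H h \<in> carrier K"
  using hom_closed[OF counit_linear] by (simp add: self_space_simps)

text \<open>
  What the left factor of a crossing has to satisfy. Both \<open>H\<close> and the Yetter-Drinfeld module
  algebras are instances.
\<close>

locale right_comodule_algebra = H: bialgebra K H + V: unital_algebra K V
  for K :: "('k, 'r) ring_scheme" and H :: "('k, 'h) bialgebra"
    and V :: "('k, 'v, 'm) module_scheme" and \<rho> :: "'v \<Rightarrow> ('v \<times> 'h \<Rightarrow> 'k) set" +
  assumes coaction_linear: "\<rho> \<in> module_hom K V (tensor K V H)"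
    and coaction_coassoc: "v \<in> carrier V \<Longrightarrow>
      tensor_lift K (tensor K V (tensor K H H)) (\<rho> v) (\<lambda>v0 v1.
        tensor_lift K (tensor K V (tensor K H H)) (\<rho> v0) (\<lambda>v00 v01.
          pure_tensor K V (tensor K H H) v00 (pure_tensor K H H v01 v1)))
      = tensor_lift K (tensor K V (tensor K H H)) (\<rho> v) (\<lambda>v0 v1.
          pure_tensor K V (tensor K H H) v0 (comult H v1))"
    and coaction_mult: "\<lbrakk>v \<in> carrier V; w \<in> carrier V\<rbrakk> \<Longrightarrow>
      \<rho> (v \<otimes>\<^bsub>V\<^esub> w) =
        tensor_lift K (tensor K V H) (\<rho> v) (\<lambda>v0 v1.
          tensor_lift K (tensor K V H) (\<rho> w) (\<lambda>w0 w1.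
            pure_tensor K V H (v0 \<otimes>\<^bsub>V\<^esub> w0) (v1 \<otimes>\<^bsub>H\<^esub> w1)))"
    and coaction_one: "\<rho> \<one>\<^bsub>V\<^esub> = pure_tensor K V H \<one>\<^bsub>V\<^esub> \<one>\<^bsub>H\<^esub>"

text \<open>
  What the right factor of a crossing has to satisfy, with the convention
  \<open>h (v w) = (h\<^sub>(\<^sub>2\<^sub>) v) (h\<^sub>(\<^sub>1\<^sub>) w)\<close>. Both the Yetter-Drinfeld module algebras and \<open>H\<^sup>*\<close> are instances.
\<close>

locale left_module_algebra = H: bialgebra K H + V: unital_algebra K V
  for K :: "('k, 'r) ring_scheme" and H :: "('k, 'h) bialgebra"
    and V :: "('k, 'v, 'm) module_scheme" and \<alpha> :: "'h \<Rightarrow> 'v \<Rightarrow> 'v" +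
  assumes action_bilinear: "bilinear K H V V \<alpha>"
    and action_mult: "\<lbrakk>g \<in> carrier H; h \<in> carrier H; v \<in> carrier V\<rbrakk> \<Longrightarrow> \<alpha> (g \<otimes>\<^bsub>H\<^esub> h) v = \<alpha> g (\<alpha> h v)"
    and action_one: "v \<in> carrier V \<Longrightarrow> \<alpha> \<one>\<^bsub>H\<^esub> v = v"
    and action_prod: "\<lbrakk>h \<in> carrier H; v \<in> carrier V; w \<in> carrier V\<rbrakk> \<Longrightarrow>
      \<alpha> h (v \<otimes>\<^bsub>V\<^esub> w) = tensor_lift K V (comult H h) (\<lambda>h1 h2. \<alpha> h2 v \<otimes>\<^bsub>V\<^esub> \<alpha> h1 w)"
    and action_unit: "h \<in> carrier H \<Longrightarrow> \<alpha> h \<one>\<^bsub>V\<^esub> = counit H h \<odot>\<^bsub>V\<^esub> \<one>\<^bsub>V\<^esub>"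
begin

lemmas action_lin = hom_bilinear_left[OF action_bilinear] hom_bilinear_right[OF action_bilinear]
  bilinear_closed[OF action_bilinear]

end

lemma (in bialgebra) right_comodule_algebra_self: "right_comodule_algebra K H H (comult H)"
  by unfold_locales (use comult_linear coassoc comult_mult comult_one in auto)

lemma (in yd_module_algebra) right_comodule_algebra: "right_comodule_algebra K H M (coact M)"
  by unfold_locales (use coact_linear coact_coassoc coact_prod coact_unit in auto)

lemma (in yd_module_algebra) left_module_algebra: "left_module_algebra K H M (act M)"
  by unfold_locales (use act_linear_left act_linear_right act_mult act_one act_prod act_unit
      in \<open>auto simp: bilinear_def\<close>)

context right_comodule_algebra
begin

lemmas coaction_lin = coaction_rules[OF coaction_linear V.is_vectorspace H.is_vectorspace]
lemmas comult_lin = coaction_rules[OF H.comult_linear H.is_vectorspace H.is_vectorspace]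

lemma coaction_cong:
  assumes "v \<in> carrier V" "vectorspace K U"
    and "\<And>x h. \<lbrakk>x \<in> carrier V; h \<in> carrier H\<rbrakk> \<Longrightarrow> f x h = g x h"
    and "\<And>x h. \<lbrakk>x \<in> carrier V; h \<in> carrier H\<rbrakk> \<Longrightarrow> g x h \<in> carrier U"
  shows "tensor_lift K U (\<rho> v) f = tensor_lift K U (\<rho> v) g"
  by (rule lift_cong[OF V.is_vectorspace H.is_vectorspace assms(2) hom_closed[OF coaction_linear assms(1)] assms(3,4)])

text \<open>
  Coassociativity is an equation in \<open>V \<otimes> (H \<otimes> H)\<close>. An arbitrary trilinear expression \<open>T\<close> is the image of
  a pure tensor under a linear map \<open>\<Phi>\<close> on that space, and applying \<open>\<Phi>\<close> to the axiom gives the rule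
  under which \<open>T(v\<^sub>(\<^sub>0\<^sub>)\<^sub>(\<^sub>0\<^sub>), v\<^sub>(\<^sub>0\<^sub>)\<^sub>(\<^sub>1\<^sub>), v\<^sub>(\<^sub>1\<^sub>))\<close> may be rewritten as
  \<open>T(v\<^sub>(\<^sub>0\<^sub>), v\<^sub>(\<^sub>1\<^sub>)\<^sub>(\<^sub>1\<^sub>), v\<^sub>(\<^sub>1\<^sub>)\<^sub>(\<^sub>2\<^sub>))\<close>.
\<close>

lemma lift_coassoc:
  assumes U [lin]: "vectorspace K U" and v: "v \<in> carrier V"
    and T1: "\<And>h h'. \<lbrakk>h \<in> carrier H; h' \<in> carrier H\<rbrakk> \<Longrightarrow> (\<lambda>x. T x h h') \<in> module_hom K V U"
    and T2: "\<And>x h'. \<lbrakk>x \<in> carrier V; h' \<in> carrier H\<rbrakk> \<Longrightarrow> (\<lambda>h. T x h h') \<in> module_hom K H U"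
    and T3: "\<And>x h. \<lbrakk>x \<in> carrier V; h \<in> carrier H\<rbrakk> \<Longrightarrow> (\<lambda>h'. T x h h') \<in> module_hom K H U"
  shows "tensor_lift K U (\<rho> v) (\<lambda>v0 v1. tensor_lift K U (\<rho> v0) (\<lambda>v00 v01. T v00 v01 v1))
    = tensor_lift K U (\<rho> v) (\<lambda>v0 v1. tensor_lift K U (comult H v1) (\<lambda>h1 h2. T v0 h1 h2))"
proof -
  let ?W = "tensor K V (tensor K H H)"
  note [lin] = V.is_vectorspace H.is_vectorspace v hom_closed[OF H.comult_linear]
  have B: "bilinear K H H U (T x)" if "x \<in> carrier V" for x
    using T2 T3 that by (intro bilinearI) auto
  have B2: "bilinear K V (tensor K H H) U (\<lambda>x q. tensor_lift K U q (T x))"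
    using T1 by - (rule lin lift_hom B hom_lift_body | assumption)+
  define \<Phi> where "\<Phi> = (\<lambda>t. tensor_lift K U t (\<lambda>x q. tensor_lift K U q (T x)))"
  have \<Phi>: "\<Phi> \<in> module_hom K ?W U" unfolding \<Phi>_def by (rule lift_hom lin B2)+
  have \<Phi>_pure: "\<Phi> (pure_tensor K V (tensor K H H) x q) = tensor_lift K U q (T x)"
    if "x \<in> carrier V" "q \<in> carrier (tensor K H H)" for x q
    unfolding \<Phi>_def using that by (intro lift_pure[OF _ _ _ B2]) (rule lin)+
  have "tensor_lift K U (\<rho> v) (\<lambda>v0 v1. tensor_lift K U (\<rho> v0) (\<lambda>v00 v01. T v00 v01 v1))
     = tensor_lift K U (\<rho> v) (\<lambda>v0 v1. \<Phi> (tensor_lift K ?W (\<rho> v0) (\<lambda>v00 v01.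
          pure_tensor K V (tensor K H H) v00 (pure_tensor K H H v01 v1))))"
  proof (rule coaction_cong[OF v U])
    fix x h assume x: "x \<in> carrier V" and h: "h \<in> carrier H"
    have "\<Phi> (tensor_lift K ?W (\<rho> x) (\<lambda>v00 v01. pure_tensor K V (tensor K H H) v00 (pure_tensor K H H v01 h)))
       = tensor_lift K U (\<rho> x) (\<lambda>v00 v01. \<Phi> (pure_tensor K V (tensor K H H) v00 (pure_tensor K H H v01 h)))"
      using x h by - (rule hom_lift[OF V.is_vectorspace H.is_vectorspace hom_closed[OF coaction_linear] _ U \<Phi>], (rule lin | assumption)+)
    also have "\<dots> = tensor_lift K U (\<rho> x) (\<lambda>v00 v01. T v00 v01 h)"
      using h by (intro coaction_cong[OF x U])
        (simp_all add: \<Phi>_pure pure_tensor_closed H.is_vectorspace lift_pure[OF _ _ U B] hom_closed[OF T1])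
    finally show "tensor_lift K U (\<rho> x) (\<lambda>v00 v01. T v00 v01 h) =
      \<Phi> (tensor_lift K ?W (\<rho> x) (\<lambda>v00 v01. pure_tensor K V (tensor K H H) v00 (pure_tensor K H H v01 h)))" ..
    show "\<Phi> (tensor_lift K ?W (\<rho> x) (\<lambda>v00 v01. pure_tensor K V (tensor K H H) v00 (pure_tensor K H H v01 h))) \<in> carrier U"
      using x h by - (rule hom_closed[OF \<Phi>], (rule lin coaction_lin | assumption)+)
  qed
  also have "\<dots> = \<Phi> (tensor_lift K ?W (\<rho> v) (\<lambda>v0 v1. tensor_lift K ?W (\<rho> v0) (\<lambda>v00 v01.
          pure_tensor K V (tensor K H H) v00 (pure_tensor K H H v01 v1))))"
    by (rule hom_lift[OF V.is_vectorspace H.is_vectorspace hom_closed[OF coaction_linear v] _ U \<Phi>, symmetric],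
        (rule lin coaction_lin | assumption)+)
  also have "\<dots> = \<Phi> (tensor_lift K ?W (\<rho> v) (\<lambda>v0 v1. pure_tensor K V (tensor K H H) v0 (comult H v1)))"
    unfolding coaction_coassoc[OF v] ..
  also have "\<dots> = tensor_lift K U (\<rho> v) (\<lambda>v0 v1. \<Phi> (pure_tensor K V (tensor K H H) v0 (comult H v1)))"
    by (rule hom_lift[OF V.is_vectorspace H.is_vectorspace hom_closed[OF coaction_linear v] _ U \<Phi>],
        (rule lin coaction_lin | assumption)+)
  also have "\<dots> = tensor_lift K U (\<rho> v) (\<lambda>v0 v1. tensor_lift K U (comult H v1) (\<lambda>h1 h2. T v0 h1 h2))"
    by (rule coaction_cong[OF v U], rule \<Phi>_pure, (rule lin comult_lin hom_closed[OF T1] | assumption)+)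
  finally show ?thesis .
qed

lemma lift_coaction_mult:
  assumes U [lin]: "vectorspace K U" and B: "bilinear K V H U b"
    and v: "v \<in> carrier V" and w: "w \<in> carrier V"
  shows "tensor_lift K U (\<rho> (v \<otimes>\<^bsub>V\<^esub> w)) b = tensor_lift K U (\<rho> v) (\<lambda>v0 v1.
    tensor_lift K U (\<rho> w) (\<lambda>w0 w1. b (v0 \<otimes>\<^bsub>V\<^esub> w0) (v1 \<otimes>\<^bsub>H\<^esub> w1)))"
proof -
  note [lin] = v w V.mult_lin H.mult_lin hom_closed[OF coaction_linear]
  have "tensor_lift K U (\<rho> (v \<otimes>\<^bsub>V\<^esub> w)) b = tensor_lift K U (\<rho> v) (\<lambda>v0 v1. tensor_lift K U (
      tensor_lift K (tensor K V H) (\<rho> w) (\<lambda>w0 w1. pure_tensor K V H (v0 \<otimes>\<^bsub>V\<^esub> w0) (v1 \<otimes>\<^bsub>H\<^esub> w1))) b)"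
    unfolding coaction_mult[OF v w]
    by (rule lift_lift, (rule lin B coaction_lin | assumption)+)
  also have "\<dots> = tensor_lift K U (\<rho> v) (\<lambda>v0 v1. tensor_lift K U (\<rho> w) (\<lambda>w0 w1.
      tensor_lift K U (pure_tensor K V H (v0 \<otimes>\<^bsub>V\<^esub> w0) (v1 \<otimes>\<^bsub>H\<^esub> w1)) b))"
    by (rule coaction_cong[OF v U], rule lift_lift,
        (rule lin B coaction_lin lift_closed bilinear_closed[OF B] | assumption)+)
  also have "\<dots> = tensor_lift K U (\<rho> v) (\<lambda>v0 v1.
    tensor_lift K U (\<rho> w) (\<lambda>w0 w1. b (v0 \<otimes>\<^bsub>V\<^esub> w0) (v1 \<otimes>\<^bsub>H\<^esub> w1)))"
    by (rule coaction_cong[OF v U], rule coaction_cong[OF w U], rule lift_pure,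
        (rule lin B coaction_lin bilinear_closed[OF B] | assumption)+)
  finally show ?thesis .
qed

lemma lift_coaction_one:
  assumes U: "vectorspace K U" and B: "bilinear K V H U b"
  shows "tensor_lift K U (\<rho> \<one>\<^bsub>V\<^esub>) b = b \<one>\<^bsub>V\<^esub> \<one>\<^bsub>H\<^esub>"
  unfolding coaction_one by (rule lift_pure[OF V.is_vectorspace H.is_vectorspace U B]) (rule V.mult_lin H.mult_lin)+

end

lemma (in bialgebra) lift_counit_right:
  assumes U: "vectorspace K U" and g: "g \<in> module_hom K H U" and h: "h \<in> carrier H"
  shows "tensor_lift K U (comult H h) (\<lambda>h1 h2. counit H h2 \<odot>\<^bsub>U\<^esub> g h1) = g h"
proof -
  interpret U: vectorspace K U by fact
  note ch = hom_closed[OF comult_linear h]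
  have "g h = g (tensor_lift K H (comult H h) (\<lambda>h1 h2. counit H h2 \<odot>\<^bsub>H\<^esub> h1))"
    by (simp add: counit_right[OF h])
  also have "\<dots> = tensor_lift K U (comult H h) (\<lambda>h1 h2. g (counit H h2 \<odot>\<^bsub>H\<^esub> h1))"
    by (rule hom_lift[OF is_vectorspace is_vectorspace ch is_vectorspace U g]) (simp add: counit_closed)
  also have "\<dots> = tensor_lift K U (comult H h) (\<lambda>h1 h2. counit H h2 \<odot>\<^bsub>U\<^esub> g h1)"
    by (rule lift_cong[OF is_vectorspace is_vectorspace U ch])
      (simp_all add: counit_closed module_hom_smult[OF g] hom_closed[OF g])
  finally show ?thesis ..
qed

lemma (in bialgebra) lift_counit_left:
  assumes U: "vectorspace K U" and g: "g \<in> module_hom K H U" and h: "h \<in> carrier H"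
  shows "tensor_lift K U (comult H h) (\<lambda>h1 h2. counit H h1 \<odot>\<^bsub>U\<^esub> g h2) = g h"
proof -
  interpret U: vectorspace K U by fact
  note ch = hom_closed[OF comult_linear h]
  have "g h = g (tensor_lift K H (comult H h) (\<lambda>h1 h2. counit H h1 \<odot>\<^bsub>H\<^esub> h2))"
    by (simp add: counit_left[OF h])
  also have "\<dots> = tensor_lift K U (comult H h) (\<lambda>h1 h2. g (counit H h1 \<odot>\<^bsub>H\<^esub> h2))"
    by (rule hom_lift[OF is_vectorspace is_vectorspace ch is_vectorspace U g]) (simp add: counit_closed)
  also have "\<dots> = tensor_lift K U (comult H h) (\<lambda>h1 h2. counit H h1 \<odot>\<^bsub>U\<^esub> g h2)"
    by (rule lift_cong[OF is_vectorspace is_vectorspace U ch])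
      (simp_all add: counit_closed module_hom_smult[OF g] hom_closed[OF g])
  finally show ?thesis ..
qed

text \<open>
  The Yetter-Drinfeld condition is an equation in \<open>M \<otimes> H\<close>; applying to it the linear map that \<open>b\<close>
  induces allows its use inside a larger Sweedler expression.
\<close>

lemma (in yd_module_algebra) lift_yetter_drinfeld:
  assumes U [lin]: "vectorspace K U" and B: "bilinear K M H U b"
    and h: "h \<in> carrier H" and v: "v \<in> carrier M"
  shows "tensor_lift K U (comult H h) (\<lambda>h1 h2. tensor_lift K U (coact M (act M h2 v)) (\<lambda>x0 x1. b x0 (x1 \<otimes>\<^bsub>H\<^esub> h1)))
    = tensor_lift K U (comult H h) (\<lambda>h1 h2. tensor_lift K U (coact M v) (\<lambda>v0 v1. b (act M h1 v0) (h2 \<otimes>\<^bsub>H\<^esub> v1)))"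
proof -
  interpret C: right_comodule_algebra K H M "coact M" by (rule right_comodule_algebra)
  interpret HC: right_comodule_algebra K H H "comult H" by (rule H.right_comodule_algebra_self)
  interpret A: left_module_algebra K H M "act M" by (rule left_module_algebra)
  note [lin] = h v H.mult_lin M.mult_lin A.action_lin
  note rules = C.coaction_lin HC.coaction_lin bilinear_closed[OF B]
  let ?\<Phi> = "\<lambda>t. tensor_lift K U t b"
  note \<Phi> = lift_hom[OF M.is_vectorspace H.is_vectorspace U B]
  have "tensor_lift K U (comult H h) (\<lambda>h1 h2. tensor_lift K U (coact M (act M h2 v)) (\<lambda>x0 x1. b x0 (x1 \<otimes>\<^bsub>H\<^esub> h1)))
    = tensor_lift K U (comult H h) (\<lambda>h1 h2. tensor_lift K U (coact M (act M h2 v)) (\<lambda>x0 x1.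
        ?\<Phi> (pure_tensor K M H x0 (x1 \<otimes>\<^bsub>H\<^esub> h1))))"
    by (rule HC.coaction_cong[OF h U], rule C.coaction_cong[OF _ U],
        (rule lin rules lift_pure[symmetric] B hom_closed[OF \<Phi>] | assumption)+)
  also have "\<dots> = tensor_lift K U (comult H h) (\<lambda>h1 h2. ?\<Phi> (tensor_lift K (tensor K M H) (coact M (act M h2 v)) (\<lambda>x0 x1.
        pure_tensor K M H x0 (x1 \<otimes>\<^bsub>H\<^esub> h1))))"
    by (rule HC.coaction_cong[OF h U], rule lift_lift[symmetric],
        (rule lin rules B hom_closed[OF coact_linear] hom_closed[OF \<Phi>] | assumption)+)
  also have "\<dots> = ?\<Phi> (tensor_lift K (tensor K M H) (comult H h) (\<lambda>h1 h2. tensor_lift K (tensor K M H) (coact M (act M h2 v)) (\<lambda>x0 x1.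
        pure_tensor K M H x0 (x1 \<otimes>\<^bsub>H\<^esub> h1))))"
    by (rule lift_lift[symmetric], (rule lin rules B hom_closed[OF H.comult_linear] | assumption)+)
  also have "\<dots> = ?\<Phi> (tensor_lift K (tensor K M H) (comult H h) (\<lambda>h1 h2. tensor_lift K (tensor K M H) (coact M v) (\<lambda>v0 v1.
        pure_tensor K M H (act M h1 v0) (h2 \<otimes>\<^bsub>H\<^esub> v1))))"
    unfolding yetter_drinfeld[OF h v] ..
  also have "\<dots> = tensor_lift K U (comult H h) (\<lambda>h1 h2. ?\<Phi> (tensor_lift K (tensor K M H) (coact M v) (\<lambda>v0 v1.
        pure_tensor K M H (act M h1 v0) (h2 \<otimes>\<^bsub>H\<^esub> v1))))"
    by (rule lift_lift, (rule lin rules B hom_closed[OF H.comult_linear] | assumption)+)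
  also have "\<dots> = tensor_lift K U (comult H h) (\<lambda>h1 h2. tensor_lift K U (coact M v) (\<lambda>v0 v1.
        ?\<Phi> (pure_tensor K M H (act M h1 v0) (h2 \<otimes>\<^bsub>H\<^esub> v1))))"
    by (rule HC.coaction_cong[OF h U], rule lift_lift,
        (rule lin rules B hom_closed[OF coact_linear] hom_closed[OF \<Phi>] | assumption)+)
  also have "\<dots> = tensor_lift K U (comult H h) (\<lambda>h1 h2. tensor_lift K U (coact M v) (\<lambda>v0 v1. b (act M h1 v0) (h2 \<otimes>\<^bsub>H\<^esub> v1)))"
    by (rule HC.coaction_cong[OF h U], rule C.coaction_cong[OF _ U],
        (rule lin rules lift_pure B | assumption)+)
  finally show ?thesis .
qed

section \<open>Crossings and unit braidings\<close>

text \<open>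
  The entries of a braided system share one type, so \<open>H\<close>, the \<open>M\<^sub>i\<close> and \<open>H\<^sup>*\<close> only occur in it as copies.
  Every element of the copy \<open>A'\<close> has the form \<open>e x\<close>, and calculations take place in \<open>A\<close>.
\<close>

definition tagging ::
  "('k, 'r) ring_scheme \<Rightarrow> ('k, 'v, 'm) module_scheme \<Rightarrow> ('v \<Rightarrow> 'u) \<Rightarrow> ('k, 'u) module \<Rightarrow> bool" where
  "tagging K A e A' \<longleftrightarrow> vectorspace K A' \<and> e \<in> module_hom K A A' \<and> carrier A' = e ` carrier A"

text \<open>
  The braiding \<open>x \<otimes> y \<mapsto> x\<^sub>(\<^sub>1\<^sub>) y \<otimes> x\<^sub>(\<^sub>0\<^sub>)\<close> between copies of \<open>A\<close> and \<open>B\<close>.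
\<close>

definition crossing ::
  "('k, 'r) ring_scheme \<Rightarrow> ('k, 'v, 'm) module_scheme \<Rightarrow> ('v \<Rightarrow> ('v \<times> 'h \<Rightarrow> 'k) set) \<Rightarrow> ('v \<Rightarrow> 'u)
    \<Rightarrow> ('k, 'u) module \<Rightarrow> ('k, 'w, 'n) module_scheme \<Rightarrow> ('h \<Rightarrow> 'w \<Rightarrow> 'w) \<Rightarrow> ('w \<Rightarrow> 'u)
    \<Rightarrow> ('k, 'u) module \<Rightarrow> (('u \<times> 'u \<Rightarrow> 'k) set \<Rightarrow> ('u \<times> 'u \<Rightarrow> 'k) set) \<Rightarrow> bool" where
  "crossing K A \<rho> e A' B \<alpha> f B' s \<longleftrightarrow>
    s \<in> module_hom K (tensor K A' B') (tensor K B' A') \<and>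
    (\<forall>x\<in>carrier A. \<forall>y\<in>carrier B. s (pure_tensor K A' B' (e x) (f y)) =
      tensor_lift K (tensor K B' A') (\<rho> x) (\<lambda>x0 x1. pure_tensor K B' A' (f (\<alpha> x1 y)) (e x0)))"

definition left_unit_braiding ::
  "('k, 'r) ring_scheme \<Rightarrow> ('k, 'v, 'm) module_scheme \<Rightarrow> ('v \<Rightarrow> 'u) \<Rightarrow> ('k, 'u) module
    \<Rightarrow> (('u \<times> 'u \<Rightarrow> 'k) set \<Rightarrow> ('u \<times> 'u \<Rightarrow> 'k) set) \<Rightarrow> bool" where
  "left_unit_braiding K A e A' s \<longleftrightarrow>
    s \<in> module_hom K (tensor K A' A') (tensor K A' A') \<and>
    (\<forall>x\<in>carrier A. \<forall>y\<in>carrier A. s (pure_tensor K A' A' (e x) (e y)) =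
      pure_tensor K A' A' (e \<one>\<^bsub>A\<^esub>) (e (x \<otimes>\<^bsub>A\<^esub> y)))"

definition right_unit_braiding ::
  "('k, 'r) ring_scheme \<Rightarrow> ('k, 'v, 'm) module_scheme \<Rightarrow> ('v \<Rightarrow> 'u) \<Rightarrow> ('k, 'u) module
    \<Rightarrow> (('u \<times> 'u \<Rightarrow> 'k) set \<Rightarrow> ('u \<times> 'u \<Rightarrow> 'k) set) \<Rightarrow> bool" where
  "right_unit_braiding K A e A' s \<longleftrightarrow>
    s \<in> module_hom K (tensor K A' A') (tensor K A' A') \<and>
    (\<forall>x\<in>carrier A. \<forall>y\<in>carrier A. s (pure_tensor K A' A' (e x) (e y)) =
      pure_tensor K A' A' (e (x \<otimes>\<^bsub>A\<^esub> y)) (e \<one>\<^bsub>A\<^esub>))"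

lemma taggingD:
  assumes "tagging K A e A'"
  shows "vectorspace K A'" "e \<in> module_hom K A A'" "x \<in> carrier A \<Longrightarrow> e x \<in> carrier A'"
    "x' \<in> carrier A' \<Longrightarrow> \<exists>x\<in>carrier A. x' = e x"
  using assms unfolding tagging_def by auto

lemma crossing_lift:
  assumes "crossing K A \<rho> e A' B \<alpha> f B' s" and "right_comodule_algebra K H A \<rho>"
    and "left_module_algebra K H B \<alpha>"
    and e: "tagging K A e A'" and f: "tagging K B f B'"
    and U [lin]: "vectorspace K U" and b: "bilinear K B' A' U b" and x: "x \<in> carrier A" and y: "y \<in> carrier B"
  shows "tensor_lift K U (s (pure_tensor K A' B' (e x) (f y))) b =
    tensor_lift K U (\<rho> x) (\<lambda>x0 x1. b (f (\<alpha> x1 y)) (e x0))"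
proof -
  interpret A: right_comodule_algebra K H A \<rho> by fact
  interpret B: left_module_algebra K H B \<alpha> by fact
  note [lin] = A.V.is_vectorspace B.V.is_vectorspace A.H.is_vectorspace x y taggingD(1,3)[OF e] taggingD(1,3)[OF f]
    B.action_lin hom_closed[OF A.coaction_linear] b lift_pure bilinear_closed[OF b]
  have eq: "s (pure_tensor K A' B' (e x) (f y)) =
      tensor_lift K (tensor K B' A') (\<rho> x) (\<lambda>x0 x1. pure_tensor K B' A' (f (\<alpha> x1 y)) (e x0))"
    using assms(1) x y by (simp add: crossing_def)
  have "tensor_lift K U (s (pure_tensor K A' B' (e x) (f y))) b =
    tensor_lift K U (\<rho> x) (\<lambda>x0 x1. tensor_lift K U (pure_tensor K B' A' (f (\<alpha> x1 y)) (e x0)) b)"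
    unfolding eq by (rule lift_lift, (rule lin | assumption)+)
  also have "\<dots> = tensor_lift K U (\<rho> x) (\<lambda>x0 x1. b (f (\<alpha> x1 y)) (e x0))"
    by (rule A.coaction_cong[OF x U], (rule lin | assumption)+)
  finally show ?thesis .
qed

text \<open>
  The left side is \<open>(x\<^sub>(\<^sub>2\<^sub>) y)\<^sub>(\<^sub>1\<^sub>) x\<^sub>(\<^sub>1\<^sub>) z \<otimes> (x\<^sub>(\<^sub>2\<^sub>) y)\<^sub>(\<^sub>0\<^sub>) \<otimes> x\<^sub>(\<^sub>0\<^sub>)\<close> and the right side is
  \<open>x\<^sub>(\<^sub>2\<^sub>) y\<^sub>(\<^sub>1\<^sub>) z \<otimes> x\<^sub>(\<^sub>1\<^sub>) y\<^sub>(\<^sub>0\<^sub>) \<otimes> x\<^sub>(\<^sub>0\<^sub>)\<close>, so the Yetter-Drinfeld condition for \<open>y\<close> identifies them.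
  The outer factors enter with one structure each, which is why \<open>H\<close> and \<open>H\<^sup>*\<close> are admitted there.
\<close>

lemma yang_baxter_distinct:
  fixes K :: "('k, 'r) ring_scheme" and A' B' C' :: "('k, 'u) module"
  assumes S: "space S i = A'" "space S j = B'" "space S k = C'"
    and s: "braid S (i, j) = s_ij" "braid S (i, k) = s_ik" "braid S (j, k) = s_jk"
    and coA: "right_comodule_algebra K H A \<rho>" and yd: "yd_module_algebra K H M" and modC: "left_module_algebra K H C \<gamma>"
    and e: "tagging K A e A'" and f: "tagging K M f B'" and g: "tagging K C g C'"
    and ij: "crossing K A \<rho> e A' M (act M) f B' s_ij"
    and ik: "crossing K A \<rho> e A' C \<gamma> g C' s_ik"
    and jk: "crossing K M (coact M) f B' C \<gamma> g C' s_jk"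
  shows "yang_baxter K S i j k"
proof -
  interpret A: right_comodule_algebra K H A \<rho> by fact
  interpret M: yd_module_algebra K H M by fact
  interpret C: left_module_algebra K H C \<gamma> by fact
  interpret MC: right_comodule_algebra K H M "coact M" by (rule M.right_comodule_algebra)
  interpret HC: right_comodule_algebra K H H "comult H" by (rule A.H.right_comodule_algebra_self)
  interpret MM: left_module_algebra K H M "act M" by (rule M.left_module_algebra)
  have ij': "s_ij \<in> module_hom K (tensor K A' B') (tensor K B' A')"
    and ik': "s_ik \<in> module_hom K (tensor K A' C') (tensor K C' A')"
    and jk': "s_jk \<in> module_hom K (tensor K B' C') (tensor K C' B')"
    using ij ik jk by (simp_all add: crossing_def)
  note [lin] = A.V.is_vectorspace M.M.is_vectorspace C.V.is_vectorspace A.H.is_vectorspace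
    taggingD(1,3)[OF e] taggingD(1,3)[OF f] taggingD(1,3)[OF g]
    hom_compose[OF taggingD(2)[OF e]] hom_compose[OF taggingD(2)[OF f]] hom_compose[OF taggingD(2)[OF g]]
    MM.action_lin C.action_lin A.H.mult_lin M.M.mult_lin
    hom_closed[OF A.coaction_linear] hom_closed[OF MC.coaction_linear] hom_closed[OF A.H.comult_linear]
    hom_closed[OF ij'] hom_closed[OF ik'] hom_closed[OF jk']
  note co = A.coaction_lin MC.coaction_lin HC.coaction_lin
    coaction_rules[OF ij'] coaction_rules[OF ik'] coaction_rules[OF jk']
  note cij = crossing_lift[OF ij coA M.left_module_algebra e f]
    and cik = crossing_lift[OF ik coA modC e g]
    and cjk = crossing_lift[OF jk M.right_comodule_algebra modC f g]
  show ?thesis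
  proof (rule yang_baxterI[OF S s _ _ _ ij' ik' jk'])
    show "vectorspace K A'" "vectorspace K B'" "vectorspace K C'" by (rule lin)+
    fix x' y' z' assume "x' \<in> carrier A'" "y' \<in> carrier B'" "z' \<in> carrier C'"
    then obtain x y z where [lin]: "x \<in> carrier A" "y \<in> carrier M" "z \<in> carrier C"
      and xyz: "x' = e x" "y' = f y" "z' = g z"
      using taggingD(4)[OF e] taggingD(4)[OF f] taggingD(4)[OF g] by metis
    let ?L = "tensor_lift K (tensor K (tensor K C' B') A')"
      and ?P = "\<lambda>c b a. pure_tensor K (tensor K C' B') A' (pure_tensor K C' B' c b) a"
      and ?ij = "\<lambda>a b. s_ij (pure_tensor K A' B' a b)"
      and ?ik = "\<lambda>a c. s_ik (pure_tensor K A' C' a c)" and ?jk = "\<lambda>b c. s_jk (pure_tensor K B' C' b c)"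
    have "?L (?ij x' y') (\<lambda>b a.
        ?L (?ik a z') (\<lambda>c a'.
          ?L (?jk b c) (\<lambda>c' b'. ?P c' b' a')))
      = ?L (\<rho> x) (\<lambda>x0 x1.
        ?L (?ik (e x0) (g z)) (\<lambda>c a'.
          ?L (?jk (f (act M x1 y)) c) (\<lambda>c' b'. ?P c' b' a')))"
      unfolding xyz by (rule cij, (rule lin co | assumption)+)
    also have "\<dots> = ?L (\<rho> x) (\<lambda>x0 x1. ?L (\<rho> x0) (\<lambda>x00 x01.
          ?L (?jk (f (act M x1 y)) (g (\<gamma> x01 z))) (\<lambda>c' b'. ?P c' b' (e x00))))"
      by (rule A.coaction_cong, (rule lin)+, rule cik, (rule lin co | assumption)+)
    also have "\<dots> = ?L (\<rho> x) (\<lambda>x0 x1. ?L (\<rho> x0) (\<lambda>x00 x01.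
          ?L (coact M (act M x1 y)) (\<lambda>y0 y1. ?P (g (\<gamma> y1 (\<gamma> x01 z))) (f y0) (e x00))))"
      by (rule A.coaction_cong, (rule lin)+, rule A.coaction_cong, assumption, (rule lin)+, rule cjk,
          (rule lin co | assumption)+)
    also have "\<dots> = ?L (\<rho> x) (\<lambda>x0 x1. ?L (comult H x1) (\<lambda>h1 h2.
          ?L (coact M (act M h2 y)) (\<lambda>y0 y1. ?P (g (\<gamma> y1 (\<gamma> h1 z))) (f y0) (e x0))))"
      by (rule A.lift_coassoc, (rule lin co | assumption)+)
    also have "\<dots> = ?L (\<rho> x) (\<lambda>x0 x1. ?L (comult H x1) (\<lambda>h1 h2.
          ?L (coact M (act M h2 y)) (\<lambda>y0 y1. ?P (g (\<gamma> (y1 \<otimes>\<^bsub>H\<^esub> h1) z)) (f y0) (e x0))))"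
      by (rule A.coaction_cong, (rule lin)+, rule HC.coaction_cong, assumption, (rule lin)+,
          rule MC.coaction_cong, (rule lin | assumption)+, subst C.action_mult, (rule lin refl | assumption)+,
          (rule lin co | assumption)+)
    \<comment> \<open>The right side above contains the left side of the Yetter-Drinfeld condition for \<open>h = x1\<close> and \<open>v = y\<close>.\<close>
    also have "\<dots> = ?L (\<rho> x) (\<lambda>x0 x1. ?L (comult H x1) (\<lambda>h1 h2.
          ?L (coact M y) (\<lambda>y0 y1. ?P (g (\<gamma> (h2 \<otimes>\<^bsub>H\<^esub> y1) z)) (f (act M h1 y0)) (e x0))))"
      by (rule A.coaction_cong, (rule lin)+, rule M.lift_yetter_drinfeld,
          (rule lin co | assumption)+)
    also have "\<dots> = ?L (\<rho> x) (\<lambda>x0 x1. ?L (\<rho> x0) (\<lambda>x00 x01.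
          ?L (coact M y) (\<lambda>y0 y1. ?P (g (\<gamma> (x1 \<otimes>\<^bsub>H\<^esub> y1) z)) (f (act M x01 y0)) (e x00))))"
      by (rule A.lift_coassoc[symmetric], (rule lin co | assumption)+)
    also have "\<dots> = ?L (\<rho> x) (\<lambda>x0 x1. ?L (coact M y) (\<lambda>y0 y1.
          ?L (\<rho> x0) (\<lambda>x00 x01. ?P (g (\<gamma> (x1 \<otimes>\<^bsub>H\<^esub> y1) z)) (f (act M x01 y0)) (e x00))))"
      by (rule A.coaction_cong, (rule lin)+, rule lift_swap, (rule lin co | assumption)+)
    also have "\<dots> = ?L (coact M y) (\<lambda>y0 y1. ?L (\<rho> x) (\<lambda>x0 x1.
          ?L (\<rho> x0) (\<lambda>x00 x01. ?P (g (\<gamma> (x1 \<otimes>\<^bsub>H\<^esub> y1) z)) (f (act M x01 y0)) (e x00))))"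
      by (rule lift_swap, (rule lin co | assumption)+)
    also have "\<dots> = ?L (coact M y) (\<lambda>y0 y1. ?L (\<rho> x) (\<lambda>x0 x1.
          ?L (\<rho> x0) (\<lambda>x00 x01. ?P (g (\<gamma> x1 (\<gamma> y1 z))) (f (act M x01 y0)) (e x00))))"
      by (rule MC.coaction_cong, (rule lin)+, rule A.coaction_cong, (rule lin)+,
          rule A.coaction_cong, (rule lin | assumption)+, subst C.action_mult, (rule lin refl | assumption)+,
          (rule lin co | assumption)+)
    also have "\<dots> = ?L (coact M y) (\<lambda>y0 y1. ?L (\<rho> x) (\<lambda>x0 x1.
          ?L (?ij (e x0) (f y0)) (\<lambda>b' a'. ?P (g (\<gamma> x1 (\<gamma> y1 z))) b' a')))"
      by (rule MC.coaction_cong, (rule lin)+, rule A.coaction_cong, (rule lin)+, rule cij[symmetric],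
          (rule lin co | assumption)+)
    also have "\<dots> = ?L (coact M y) (\<lambda>y0 y1.
        ?L (?ik (e x) (g (\<gamma> y1 z))) (\<lambda>c' a.
          ?L (?ij a (f y0)) (\<lambda>b' a'. ?P c' b' a')))"
      by (rule MC.coaction_cong, (rule lin)+, rule cik[symmetric], (rule lin co | assumption)+)
    also have "\<dots> = ?L (?jk y' z') (\<lambda>c b.
        ?L (?ik x' c) (\<lambda>c' a.
          ?L (?ij a b) (\<lambda>b' a'. ?P c' b' a')))"
      unfolding xyz by (rule cjk[symmetric], (rule lin co | assumption)+)
    finally show "?L (?ij x' y') (\<lambda>b a.
        ?L (?ik a z') (\<lambda>c a'.
          ?L (?jk b c) (\<lambda>c' b'. ?P c' b' a')))
      = ?L (?jk y' z') (\<lambda>c b.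
        ?L (?ik x' c) (\<lambda>c' a.
          ?L (?ij a b) (\<lambda>b' a'. ?P c' b' a')))" .
  qed
qed

text \<open>
  Both sides are \<open>1 \<otimes> 1 \<otimes> x y z\<close>.
\<close>

lemma yang_baxter_left_unit:
  fixes K :: "('k, 'r) ring_scheme" and A' :: "('k, 'u) module"
  assumes S: "space S i = A'" and s: "braid S (i, i) = s"
    and A: "unital_algebra K A" and e: "tagging K A e A'" and ii: "left_unit_braiding K A e A' s"
  shows "yang_baxter K S i i i"
proof -
  interpret A: unital_algebra K A by fact
  have s': "s \<in> module_hom K (tensor K A' A') (tensor K A' A')" using ii by (simp add: left_unit_braiding_def)
  have s_pure: "s (pure_tensor K A' A' (e x) (e y)) = pure_tensor K A' A' (e \<one>\<^bsub>A\<^esub>) (e (x \<otimes>\<^bsub>A\<^esub> y))"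
    if "x \<in> carrier A" "y \<in> carrier A" for x y using ii that by (simp add: left_unit_braiding_def)
  note [lin] = A.is_vectorspace taggingD(1,3)[OF e] hom_compose[OF taggingD(2)[OF e]] A.mult_lin hom_closed[OF s']
  note co = coaction_rules[OF s']
  show ?thesis
  proof (rule yang_baxterI[OF S S S s s s _ _ _ s' s' s'])
    show "vectorspace K A'" "vectorspace K A'" "vectorspace K A'" by (rule lin)+
    fix x' y' z' assume "x' \<in> carrier A'" "y' \<in> carrier A'" "z' \<in> carrier A'"
    then obtain x y z where [lin]: "x \<in> carrier A" "y \<in> carrier A" "z \<in> carrier A"
      and xyz: "x' = e x" "y' = e y" "z' = e z"
      using taggingD(4)[OF e] by metis
    let ?L = "tensor_lift K (tensor K (tensor K A' A') A')"
      and ?P = "\<lambda>c b a. pure_tensor K (tensor K A' A') A' (pure_tensor K A' A' c b) a"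
      and ?s = "\<lambda>x y. s (pure_tensor K A' A' x y)"
    have s_lift: "?L (?s (e x) (e y)) b = b (e \<one>\<^bsub>A\<^esub>) (e (x \<otimes>\<^bsub>A\<^esub> y))"
      if "bilinear K A' A' (tensor K (tensor K A' A') A') b" "x \<in> carrier A" "y \<in> carrier A" for b x y
      unfolding s_pure[OF that(2,3)] using that by - (rule lift_pure, (assumption | rule lin)+)
    have "?L (?s (e x) (e y)) (\<lambda>b a.
        ?L (?s a (e z)) (\<lambda>c a'.
          ?L (?s b c) (\<lambda>c' b'. ?P c' b' a')))
      = ?L (?s (e (x \<otimes>\<^bsub>A\<^esub> y)) (e z)) (\<lambda>c a'.
          ?L (?s (e \<one>\<^bsub>A\<^esub>) c) (\<lambda>c' b'. ?P c' b' a'))"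
      by (rule s_lift, (rule lin co | assumption)+)
    also have "\<dots> = ?L (?s (e \<one>\<^bsub>A\<^esub>) (e \<one>\<^bsub>A\<^esub>))
          (\<lambda>c' b'. ?P c' b' (e ((x \<otimes>\<^bsub>A\<^esub> y) \<otimes>\<^bsub>A\<^esub> z)))"
      by (rule s_lift, (rule lin co | assumption)+)
    also have "\<dots> = ?P (e \<one>\<^bsub>A\<^esub>) (e (\<one>\<^bsub>A\<^esub> \<otimes>\<^bsub>A\<^esub> \<one>\<^bsub>A\<^esub>)) (e ((x \<otimes>\<^bsub>A\<^esub> y) \<otimes>\<^bsub>A\<^esub> z))"
      by (rule s_lift, (rule lin co | assumption)+)
    also have "\<dots> = ?P (e \<one>\<^bsub>A\<^esub>) (e \<one>\<^bsub>A\<^esub>) (e ((x \<otimes>\<^bsub>A\<^esub> \<one>\<^bsub>A\<^esub>) \<otimes>\<^bsub>A\<^esub> (y \<otimes>\<^bsub>A\<^esub> z)))"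
      by (simp add: A.alg.m_assoc lin)
    also have "\<dots> = ?L (?s (e (x \<otimes>\<^bsub>A\<^esub> \<one>\<^bsub>A\<^esub>)) (e (y \<otimes>\<^bsub>A\<^esub> z))) (\<lambda>b' a'. ?P (e \<one>\<^bsub>A\<^esub>) b' a')"
      by (rule s_lift[symmetric], (rule lin co | assumption)+)
    also have "\<dots> = ?L (?s (e x) (e \<one>\<^bsub>A\<^esub>)) (\<lambda>c' a.
          ?L (?s a (e (y \<otimes>\<^bsub>A\<^esub> z))) (\<lambda>b' a'. ?P c' b' a'))"
      by (rule s_lift[symmetric], (rule lin co | assumption)+)
    also have "\<dots> = ?L (?s (e y) (e z)) (\<lambda>c b.
        ?L (?s (e x) c) (\<lambda>c' a.
          ?L (?s a b) (\<lambda>b' a'. ?P c' b' a')))"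
      by (rule s_lift[symmetric], (rule lin co | assumption)+)
    finally show "?L (?s x' y') (\<lambda>b a.
        ?L (?s a z') (\<lambda>c a'.
          ?L (?s b c) (\<lambda>c' b'. ?P c' b' a')))
      = ?L (?s y' z') (\<lambda>c b.
        ?L (?s x' c) (\<lambda>c' a.
          ?L (?s a b) (\<lambda>b' a'. ?P c' b' a')))"
      unfolding xyz .
  qed
qed

text \<open>
  Both sides are \<open>x y z \<otimes> 1 \<otimes> 1\<close>.
\<close>

lemma yang_baxter_right_unit:
  fixes K :: "('k, 'r) ring_scheme" and A' :: "('k, 'u) module"
  assumes S: "space S i = A'" and s: "braid S (i, i) = s"
    and A: "unital_algebra K A" and e: "tagging K A e A'" and ii: "right_unit_braiding K A e A' s"
  shows "yang_baxter K S i i i"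
proof -
  interpret A: unital_algebra K A by fact
  have s': "s \<in> module_hom K (tensor K A' A') (tensor K A' A')" using ii by (simp add: right_unit_braiding_def)
  have s_pure: "s (pure_tensor K A' A' (e x) (e y)) = pure_tensor K A' A' (e (x \<otimes>\<^bsub>A\<^esub> y)) (e \<one>\<^bsub>A\<^esub>)"
    if "x \<in> carrier A" "y \<in> carrier A" for x y using ii that by (simp add: right_unit_braiding_def)
  note [lin] = A.is_vectorspace taggingD(1,3)[OF e] hom_compose[OF taggingD(2)[OF e]] A.mult_lin hom_closed[OF s']
  note co = coaction_rules[OF s']
  show ?thesis
  proof (rule yang_baxterI[OF S S S s s s _ _ _ s' s' s'])
    show "vectorspace K A'" "vectorspace K A'" "vectorspace K A'" by (rule lin)+
    fix x' y' z' assume "x' \<in> carrier A'" "y' \<in> carrier A'" "z' \<in> carrier A'"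
    then obtain x y z where [lin]: "x \<in> carrier A" "y \<in> carrier A" "z \<in> carrier A"
      and xyz: "x' = e x" "y' = e y" "z' = e z"
      using taggingD(4)[OF e] by metis
    let ?L = "tensor_lift K (tensor K (tensor K A' A') A')"
      and ?P = "\<lambda>c b a. pure_tensor K (tensor K A' A') A' (pure_tensor K A' A' c b) a"
      and ?s = "\<lambda>x y. s (pure_tensor K A' A' x y)"
    have s_lift: "?L (?s (e x) (e y)) b = b (e (x \<otimes>\<^bsub>A\<^esub> y)) (e \<one>\<^bsub>A\<^esub>)"
      if "bilinear K A' A' (tensor K (tensor K A' A') A') b" "x \<in> carrier A" "y \<in> carrier A" for b x y
      unfolding s_pure[OF that(2,3)] using that by - (rule lift_pure, (assumption | rule lin)+)
    have "?L (?s (e x) (e y)) (\<lambda>b a.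
        ?L (?s a (e z)) (\<lambda>c a'.
          ?L (?s b c) (\<lambda>c' b'. ?P c' b' a')))
      = ?L (?s (e \<one>\<^bsub>A\<^esub>) (e z)) (\<lambda>c a'.
          ?L (?s (e (x \<otimes>\<^bsub>A\<^esub> y)) c) (\<lambda>c' b'. ?P c' b' a'))"
      by (rule s_lift, (rule lin co | assumption)+)
    also have "\<dots> = ?L (?s (e (x \<otimes>\<^bsub>A\<^esub> y)) (e (\<one>\<^bsub>A\<^esub> \<otimes>\<^bsub>A\<^esub> z)))
          (\<lambda>c' b'. ?P c' b' (e \<one>\<^bsub>A\<^esub>))"
      by (rule s_lift, (rule lin co | assumption)+)
    also have "\<dots> = ?P (e ((x \<otimes>\<^bsub>A\<^esub> y) \<otimes>\<^bsub>A\<^esub> (\<one>\<^bsub>A\<^esub> \<otimes>\<^bsub>A\<^esub> z))) (e \<one>\<^bsub>A\<^esub>) (e \<one>\<^bsub>A\<^esub>)"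
      by (rule s_lift, (rule lin co | assumption)+)
    also have "\<dots> = ?P (e (x \<otimes>\<^bsub>A\<^esub> (y \<otimes>\<^bsub>A\<^esub> z))) (e (\<one>\<^bsub>A\<^esub> \<otimes>\<^bsub>A\<^esub> \<one>\<^bsub>A\<^esub>)) (e \<one>\<^bsub>A\<^esub>)"
      by (simp add: A.alg.m_assoc lin)
    also have "\<dots> = ?L (?s (e \<one>\<^bsub>A\<^esub>) (e \<one>\<^bsub>A\<^esub>)) (\<lambda>b' a'. ?P (e (x \<otimes>\<^bsub>A\<^esub> (y \<otimes>\<^bsub>A\<^esub> z))) b' a')"
      by (rule s_lift[symmetric], (rule lin co | assumption)+)
    also have "\<dots> = ?L (?s (e x) (e (y \<otimes>\<^bsub>A\<^esub> z))) (\<lambda>c' a.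
          ?L (?s a (e \<one>\<^bsub>A\<^esub>)) (\<lambda>b' a'. ?P c' b' a'))"
      by (rule s_lift[symmetric], (rule lin co | assumption)+)
    also have "\<dots> = ?L (?s (e y) (e z)) (\<lambda>c b.
        ?L (?s (e x) c) (\<lambda>c' a.
          ?L (?s a b) (\<lambda>b' a'. ?P c' b' a')))"
      by (rule s_lift[symmetric], (rule lin co | assumption)+)
    finally show "?L (?s x' y') (\<lambda>b a.
        ?L (?s a z') (\<lambda>c a'.
          ?L (?s b c) (\<lambda>c' b'. ?P c' b' a')))
      = ?L (?s y' z') (\<lambda>c b.
        ?L (?s x' c) (\<lambda>c' a.
          ?L (?s a b) (\<lambda>b' a'. ?P c' b' a')))"
      unfolding xyz .
  qed
qed

text \<open>
  Whichever side the unit is on, the braiding \<open>s_ii\<close> factors through the product as a linear map \<open>Q\<close>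
  of one variable, and both factors of \<open>Q m\<close> crossing \<open>z\<close> amounts to \<open>m\<close> crossing \<open>z\<close>: the unit coacts
  by \<open>1 \<otimes> 1\<close>, so it passes \<open>z\<close> without changing it. Then the equation reads
  \<open>(x y)\<^sub>(\<^sub>1\<^sub>) z \<otimes> Q((x y)\<^sub>(\<^sub>0\<^sub>)) = x\<^sub>(\<^sub>1\<^sub>) y\<^sub>(\<^sub>1\<^sub>) z \<otimes> Q(x\<^sub>(\<^sub>0\<^sub>) y\<^sub>(\<^sub>0\<^sub>))\<close>, which is multiplicativity of the coaction.
\<close>

lemma yang_baxter_unit_crossing:
  fixes K :: "('k, 'r) ring_scheme" and A' C' :: "('k, 'u) module"
  assumes S: "space S i = A'" "space S k = C'"
    and s: "braid S (i, i) = s_ii" "braid S (i, k) = s_ik"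
    and coA: "right_comodule_algebra K H A \<rho>" and modC: "left_module_algebra K H C \<gamma>"
    and e: "tagging K A e A'" and g: "tagging K C g C'"
    and ii: "left_unit_braiding K A e A' s_ii \<or> right_unit_braiding K A e A' s_ii"
    and ik: "crossing K A \<rho> e A' C \<gamma> g C' s_ik"
  shows "yang_baxter K S i i k"
proof -
  interpret A: right_comodule_algebra K H A \<rho> by fact
  interpret C: left_module_algebra K H C \<gamma> by fact
  have ii': "s_ii \<in> module_hom K (tensor K A' A') (tensor K A' A')"
    using ii by (auto simp add: left_unit_braiding_def right_unit_braiding_def)
  have ik': "s_ik \<in> module_hom K (tensor K A' C') (tensor K C' A')"
    using ik by (simp add: crossing_def)
  note [lin] = A.V.is_vectorspace C.V.is_vectorspace A.H.is_vectorspace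
    taggingD(1,3)[OF e] taggingD(1,3)[OF g]
    hom_compose[OF taggingD(2)[OF e]] hom_compose[OF taggingD(2)[OF g]]
    C.action_lin A.H.mult_lin A.V.mult_lin
    hom_closed[OF A.coaction_linear] hom_closed[OF ii'] hom_closed[OF ik']
  note co = A.coaction_lin coaction_rules[OF ii'] coaction_rules[OF ik']
  note cik = crossing_lift[OF ik coA modC e g]
  let ?T = "tensor K (tensor K C' A') A'"
  let ?P = "\<lambda>c b a. pure_tensor K (tensor K C' A') A' (pure_tensor K C' A' c b) a"
  let ?L = "tensor_lift K ?T" and ?ii = "\<lambda>x y. s_ii (pure_tensor K A' A' x y)"
    and ?ik = "\<lambda>a c. s_ik (pure_tensor K A' C' a c)"
  let ?one = "e \<one>\<^bsub>A\<^esub>"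
  have "\<exists>Q\<in>module_hom K A (tensor K A' A').
      (\<forall>x\<in>carrier A. \<forall>y\<in>carrier A. (?ii (e x) (e y)) = Q (x \<otimes>\<^bsub>A\<^esub> y)) \<and>
      (\<forall>m\<in>carrier A. \<forall>z\<in>carrier C.
        ?L (Q m) (\<lambda>b a.
          ?L (?ik a (g z)) (\<lambda>c a'.
            ?L (?ik b c) (\<lambda>c' b'. ?P c' b' a')))
        = ?L (\<rho> m) (\<lambda>m0 m1. ?L (Q m0) (\<lambda>b a. ?P (g (\<gamma> m1 z)) b a)))"
    using ii
  proof
    assume left: "left_unit_braiding K A e A' s_ii"
    let ?Q = "\<lambda>m. pure_tensor K A' A' ?one (e m)"
    have Q: "?Q \<in> module_hom K A (tensor K A' A')" by (rule lin)+
    have "?L (?Q m) (\<lambda>b a.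
          ?L (?ik a (g z)) (\<lambda>c a'.
            ?L (?ik b c) (\<lambda>c' b'. ?P c' b' a')))
        = ?L (\<rho> m) (\<lambda>m0 m1. ?L (?Q m0) (\<lambda>b a. ?P (g (\<gamma> m1 z)) b a))"
      if mz [lin]: "m \<in> carrier A" "z \<in> carrier C" for m z
    proof -
      have "?L (?Q m) (\<lambda>b a.
          ?L (?ik a (g z)) (\<lambda>c a'.
            ?L (?ik b c) (\<lambda>c' b'. ?P c' b' a')))
        = ?L (?ik (e m) (g z)) (\<lambda>c a'.
            ?L (?ik ?one c) (\<lambda>c' b'. ?P c' b' a'))"
        by (rule lift_pure, (rule lin co | assumption)+)
      also have "\<dots> = ?L (\<rho> m) (\<lambda>m0 m1.
          ?L (?ik ?one (g (\<gamma> m1 z))) (\<lambda>c' b'. ?P c' b' (e m0)))"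
        by (rule cik, (rule lin co | assumption)+)
      also have "\<dots> = ?L (\<rho> m) (\<lambda>m0 m1.
          ?L (\<rho> \<one>\<^bsub>A\<^esub>) (\<lambda>u0 u1. ?P (g (\<gamma> u1 (\<gamma> m1 z))) (e u0) (e m0)))"
        by (rule A.coaction_cong, (rule lin)+, rule cik, (rule lin co | assumption)+)
      also have "\<dots> = ?L (\<rho> m) (\<lambda>m0 m1. ?P (g (\<gamma> \<one>\<^bsub>H\<^esub> (\<gamma> m1 z))) ?one (e m0))"
        by (rule A.coaction_cong, (rule lin)+, rule A.lift_coaction_one, (rule lin co | assumption)+)
      also have "\<dots> = ?L (\<rho> m) (\<lambda>m0 m1. ?L (?Q m0) (\<lambda>b a. ?P (g (\<gamma> m1 z)) b a))"
        by (rule A.coaction_cong, (rule lin)+, subst C.action_one, (rule lin | assumption)+,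
            rule lift_pure[symmetric], (rule lin co coaction_closed[OF Q] | assumption)+)
      finally show ?thesis .
    qed
    then show ?thesis using left Q by (intro bexI[of _ ?Q]) (auto simp: left_unit_braiding_def)
  next
    assume right: "right_unit_braiding K A e A' s_ii"
    let ?Q = "\<lambda>m. pure_tensor K A' A' (e m) ?one"
    have Q: "?Q \<in> module_hom K A (tensor K A' A')" by (rule lin)+
    have "?L (?Q m) (\<lambda>b a.
          ?L (?ik a (g z)) (\<lambda>c a'.
            ?L (?ik b c) (\<lambda>c' b'. ?P c' b' a')))
        = ?L (\<rho> m) (\<lambda>m0 m1. ?L (?Q m0) (\<lambda>b a. ?P (g (\<gamma> m1 z)) b a))"
      if mz [lin]: "m \<in> carrier A" "z \<in> carrier C" for m z
    proof -
      have "?L (?Q m) (\<lambda>b a.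
          ?L (?ik a (g z)) (\<lambda>c a'.
            ?L (?ik b c) (\<lambda>c' b'. ?P c' b' a')))
        = ?L (?ik ?one (g z)) (\<lambda>c a'.
            ?L (?ik (e m) c) (\<lambda>c' b'. ?P c' b' a'))"
        by (rule lift_pure, (rule lin co | assumption)+)
      also have "\<dots> = ?L (\<rho> \<one>\<^bsub>A\<^esub>) (\<lambda>u0 u1.
          ?L (?ik (e m) (g (\<gamma> u1 z))) (\<lambda>c' b'. ?P c' b' (e u0)))"
        by (rule cik, (rule lin co | assumption)+)
      also have "\<dots> = ?L (?ik (e m) (g (\<gamma> \<one>\<^bsub>H\<^esub> z))) (\<lambda>c' b'. ?P c' b' ?one)"
        by (rule A.lift_coaction_one, (rule lin co | assumption)+)
      also have "\<dots> = ?L (\<rho> m) (\<lambda>m0 m1. ?P (g (\<gamma> m1 (\<gamma> \<one>\<^bsub>H\<^esub> z))) (e m0) ?one)"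
        by (rule cik, (rule lin co | assumption)+)
      also have "\<dots> = ?L (\<rho> m) (\<lambda>m0 m1. ?L (?Q m0) (\<lambda>b a. ?P (g (\<gamma> m1 z)) b a))"
        by (rule A.coaction_cong, (rule lin)+, subst C.action_one, (rule lin | assumption)+,
            rule lift_pure[symmetric], (rule lin co coaction_closed[OF Q] | assumption)+)
      finally show ?thesis .
    qed
    then show ?thesis using right Q by (intro bexI[of _ ?Q]) (auto simp: right_unit_braiding_def)
  qed
  then obtain Q where Q: "Q \<in> module_hom K A (tensor K A' A')"
    and s_Q: "\<And>x y. \<lbrakk>x \<in> carrier A; y \<in> carrier A\<rbrakk> \<Longrightarrow> (?ii (e x) (e y)) = Q (x \<otimes>\<^bsub>A\<^esub> y)"
    and Q_cross: "\<And>m z. \<lbrakk>m \<in> carrier A; z \<in> carrier C\<rbrakk> \<Longrightarrow>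
        ?L (Q m) (\<lambda>b a.
          ?L (?ik a (g z)) (\<lambda>c a'.
            ?L (?ik b c) (\<lambda>c' b'. ?P c' b' a')))
        = ?L (\<rho> m) (\<lambda>m0 m1. ?L (Q m0) (\<lambda>b a. ?P (g (\<gamma> m1 z)) b a))"
    by metis
  note co = co coaction_rules[OF Q]
  show ?thesis
  proof (rule yang_baxterI[OF S(1,1,2) s(1,2,2) _ _ _ ii' ik' ik'])
    show "vectorspace K A'" "vectorspace K A'" "vectorspace K C'" by (rule lin)+
    fix x' y' z' assume "x' \<in> carrier A'" "y' \<in> carrier A'" "z' \<in> carrier C'"
    then obtain x y z where xyz_in [lin]: "x \<in> carrier A" "y \<in> carrier A" "z \<in> carrier C"
      and xyz: "x' = e x" "y' = e y" "z' = g z"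
      using taggingD(4)[OF e] taggingD(4)[OF g] by metis
    have "?L (?ii x' y') (\<lambda>b a.
        ?L (?ik a z') (\<lambda>c a'.
          ?L (?ik b c) (\<lambda>c' b'. ?P c' b' a')))
      = ?L (\<rho> (x \<otimes>\<^bsub>A\<^esub> y)) (\<lambda>m0 m1. ?L (Q m0) (\<lambda>b a. ?P (g (\<gamma> m1 z)) b a))"
      unfolding xyz s_Q[OF xyz_in(1,2)] by (rule Q_cross, (rule lin)+)
    also have "\<dots> = ?L (\<rho> x) (\<lambda>x0 x1. ?L (\<rho> y) (\<lambda>y0 y1.
          ?L (Q (x0 \<otimes>\<^bsub>A\<^esub> y0)) (\<lambda>b a. ?P (g (\<gamma> (x1 \<otimes>\<^bsub>H\<^esub> y1) z)) b a)))"
      by (rule A.lift_coaction_mult, (rule lin co | assumption)+)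
    also have "\<dots> = ?L (\<rho> y) (\<lambda>y0 y1. ?L (\<rho> x) (\<lambda>x0 x1.
          ?L (Q (x0 \<otimes>\<^bsub>A\<^esub> y0)) (\<lambda>b a. ?P (g (\<gamma> (x1 \<otimes>\<^bsub>H\<^esub> y1) z)) b a)))"
      by (rule lift_swap, (rule lin co | assumption)+)
    also have "\<dots> = ?L (\<rho> y) (\<lambda>y0 y1. ?L (\<rho> x) (\<lambda>x0 x1.
          ?L (?ii (e x0) (e y0)) (\<lambda>b' a'. ?P (g (\<gamma> x1 (\<gamma> y1 z))) b' a')))"
      by (rule A.coaction_cong, (rule lin)+, rule A.coaction_cong, (rule lin)+,
          subst C.action_mult, (rule lin | assumption)+, subst s_Q, (rule lin co refl | assumption)+)
    also have "\<dots> = ?L (\<rho> y) (\<lambda>y0 y1.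
        ?L (?ik (e x) (g (\<gamma> y1 z))) (\<lambda>c' a.
          ?L (?ii a (e y0)) (\<lambda>b' a'. ?P c' b' a')))"
      by (rule A.coaction_cong, (rule lin)+, rule cik[symmetric], (rule lin co | assumption)+)
    also have "\<dots> = ?L (?ik y' z') (\<lambda>c b.
        ?L (?ik x' c) (\<lambda>c' a.
          ?L (?ii a b) (\<lambda>b' a'. ?P c' b' a')))"
      unfolding xyz by (rule cik[symmetric], (rule lin co | assumption)+)
    finally show "?L (?ii x' y') (\<lambda>b a.
        ?L (?ik a z') (\<lambda>c a'.
          ?L (?ik b c) (\<lambda>c' b'. ?P c' b' a')))
      = ?L (?ik y' z') (\<lambda>c b.
        ?L (?ik x' c) (\<lambda>c' a.
          ?L (?ii a b) (\<lambda>b' a'. ?P c' b' a')))" .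
  qed
qed

text \<open>
  Both sides equal \<open>1 \<otimes> x\<^sub>(\<^sub>1\<^sub>) (y z) \<otimes> x\<^sub>(\<^sub>0\<^sub>)\<close>: on the left the two crossings of \<open>x\<close> combine by
  \<open>h (y z) = (h\<^sub>(\<^sub>2\<^sub>) y) (h\<^sub>(\<^sub>1\<^sub>) z)\<close>, on the right \<open>x\<close> crosses the unit by its counit. Only the unit on the
  left has to be treated, because the unit is on the right for \<open>H\<close> alone and \<open>H\<close> is the first entry.
\<close>

lemma yang_baxter_crossing_left_unit:
  fixes K :: "('k, 'r) ring_scheme" and A' B' :: "('k, 'u) module"
  assumes S: "space S i = A'" "space S j = B'"
    and s: "braid S (i, j) = s_ij" "braid S (j, j) = s_jj"
    and coA: "right_comodule_algebra K H A \<rho>" and modB: "left_module_algebra K H B \<beta>"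
    and e: "tagging K A e A'" and f: "tagging K B f B'"
    and jj: "left_unit_braiding K B f B' s_jj"
    and ij: "crossing K A \<rho> e A' B \<beta> f B' s_ij"
  shows "yang_baxter K S i j j"
proof -
  interpret A: right_comodule_algebra K H A \<rho> by fact
  interpret B: left_module_algebra K H B \<beta> by fact
  interpret HC: right_comodule_algebra K H H "comult H" by (rule A.H.right_comodule_algebra_self)
  have jj': "s_jj \<in> module_hom K (tensor K B' B') (tensor K B' B')"
    using jj by (simp add: left_unit_braiding_def)
  have ij': "s_ij \<in> module_hom K (tensor K A' B') (tensor K B' A')"
    using ij by (simp add: crossing_def)
  note [lin] = A.V.is_vectorspace B.V.is_vectorspace A.H.is_vectorspace
    taggingD(1,3)[OF e] taggingD(1,3)[OF f]
    hom_compose[OF taggingD(2)[OF e]] hom_compose[OF taggingD(2)[OF f]]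
    B.action_lin A.H.mult_lin B.V.mult_lin
    hom_closed[OF A.coaction_linear] hom_closed[OF A.H.comult_linear] hom_closed[OF jj'] hom_closed[OF ij']
  note co = A.coaction_lin HC.coaction_lin coaction_rules[OF jj'] coaction_rules[OF ij']
  note cij = crossing_lift[OF ij coA modB e f]
  let ?T = "tensor K (tensor K B' B') A'"
  let ?P = "\<lambda>c b a. pure_tensor K (tensor K B' B') A' (pure_tensor K B' B' c b) a"
  let ?one = "f \<one>\<^bsub>B\<^esub>"
  let ?L = "tensor_lift K ?T" and ?ij = "\<lambda>a b. s_ij (pure_tensor K A' B' a b)"
    and ?jj = "\<lambda>x y. s_jj (pure_tensor K B' B' x y)"
  have T: "vectorspace K ?T" by (rule lin)+
  interpret T: vectorspace K ?T by (rule T)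
  have cjj: "?L (?jj (f x) (f y)) b = b ?one (f (x \<otimes>\<^bsub>B\<^esub> y))"
    if "bilinear K B' B' ?T b" "x \<in> carrier B" "y \<in> carrier B" for b x y
  proof -
    have eq: "(?jj (f x) (f y)) = pure_tensor K B' B' ?one (f (x \<otimes>\<^bsub>B\<^esub> y))"
      using jj that by (simp add: left_unit_braiding_def)
    show ?thesis unfolding eq using that by - (rule lift_pure, (assumption | rule lin)+)
  qed
  show ?thesis
  proof (rule yang_baxterI[OF S(1,2,2) s(1,1,2) _ _ _ ij' ij' jj'])
    show "vectorspace K A'" "vectorspace K B'" "vectorspace K B'" by (rule lin)+
    fix x' y' z' assume "x' \<in> carrier A'" "y' \<in> carrier B'" "z' \<in> carrier B'"
    then obtain x y z where [lin]: "x \<in> carrier A" "y \<in> carrier B" "z \<in> carrier B"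
      and xyz: "x' = e x" "y' = f y" "z' = f z"
      using taggingD(4)[OF e] taggingD(4)[OF f] by metis
    have "?L (?ij x' y') (\<lambda>b a.
        ?L (?ij a z') (\<lambda>c a'.
          ?L (?jj b c) (\<lambda>c' b'. ?P c' b' a')))
      = ?L (\<rho> x) (\<lambda>x0 x1.
        ?L (?ij (e x0) (f z)) (\<lambda>c a'.
          ?L (?jj (f (\<beta> x1 y)) c) (\<lambda>c' b'. ?P c' b' a')))"
      unfolding xyz by (rule cij, (rule lin co | assumption)+)
    also have "\<dots> = ?L (\<rho> x) (\<lambda>x0 x1. ?L (\<rho> x0) (\<lambda>x00 x01.
          ?L (?jj (f (\<beta> x1 y)) (f (\<beta> x01 z))) (\<lambda>c' b'. ?P c' b' (e x00))))"
      by (rule A.coaction_cong, (rule lin)+, rule cij, (rule lin co | assumption)+)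
    also have "\<dots> = ?L (\<rho> x) (\<lambda>x0 x1. ?L (\<rho> x0) (\<lambda>x00 x01.
          ?P ?one (f (\<beta> x1 y \<otimes>\<^bsub>B\<^esub> \<beta> x01 z)) (e x00)))"
      by (rule A.coaction_cong, (rule lin)+, rule A.coaction_cong, assumption, (rule lin)+, rule cjj,
          (rule lin co | assumption)+)
    also have "\<dots> = ?L (\<rho> x) (\<lambda>x0 x1. ?L (comult H x1) (\<lambda>h1 h2.
          ?P ?one (f (\<beta> h2 y \<otimes>\<^bsub>B\<^esub> \<beta> h1 z)) (e x0)))"
      by (rule A.lift_coassoc, (rule lin co | assumption)+)
    also have "\<dots> = ?L (\<rho> x) (\<lambda>x0 x1. ?P ?one (f (\<beta> x1 (y \<otimes>\<^bsub>B\<^esub> z))) (e x0))"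
    proof (rule A.coaction_cong)
      fix a h assume a: "a \<in> carrier A" and h: "h \<in> carrier H"
      have "?P ?one (f (\<beta> h (y \<otimes>\<^bsub>B\<^esub> z))) (e a)
        = ?P ?one (f (tensor_lift K B (comult H h) (\<lambda>h1 h2. \<beta> h2 y \<otimes>\<^bsub>B\<^esub> \<beta> h1 z))) (e a)"
        using h by (simp add: B.action_prod lin)
      also have "\<dots> = ?L (comult H h) (\<lambda>h1 h2. ?P ?one (f (\<beta> h2 y \<otimes>\<^bsub>B\<^esub> \<beta> h1 z)) (e a))"
        using a h by - (rule hom_lift[where f = "\<lambda>u. ?P ?one (f u) (e a)"], (rule lin co | assumption)+)
      finally show "?L (comult H h) (\<lambda>h1 h2. ?P ?one (f (\<beta> h2 y \<otimes>\<^bsub>B\<^esub> \<beta> h1 z)) (e a))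
        = ?P ?one (f (\<beta> h (y \<otimes>\<^bsub>B\<^esub> z))) (e a)" ..
    qed ((rule lin | assumption)+)
    finally have lhs: "?L (?ij x' y') (\<lambda>b a.
        ?L (?ij a z') (\<lambda>c a'.
          ?L (?jj b c) (\<lambda>c' b'. ?P c' b' a')))
      = ?L (\<rho> x) (\<lambda>x0 x1. ?P ?one (f (\<beta> x1 (y \<otimes>\<^bsub>B\<^esub> z))) (e x0))" .
    have "?L (?jj y' z') (\<lambda>c b.
        ?L (?ij x' c) (\<lambda>c' a.
          ?L (?ij a b) (\<lambda>b' a'. ?P c' b' a')))
      = ?L (?ij (e x) ?one) (\<lambda>c' a.
          ?L (?ij a (f (y \<otimes>\<^bsub>B\<^esub> z))) (\<lambda>b' a'. ?P c' b' a'))"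
      unfolding xyz by (rule cjj, (rule lin co | assumption)+)
    also have "\<dots> = ?L (\<rho> x) (\<lambda>x0 x1.
          ?L (?ij (e x0) (f (y \<otimes>\<^bsub>B\<^esub> z))) (\<lambda>b' a'. ?P (f (\<beta> x1 \<one>\<^bsub>B\<^esub>)) b' a'))"
      by (rule cij, (rule lin co | assumption)+)
    also have "\<dots> = ?L (\<rho> x) (\<lambda>x0 x1. ?L (\<rho> x0) (\<lambda>x00 x01.
          ?P (f (\<beta> x1 \<one>\<^bsub>B\<^esub>)) (f (\<beta> x01 (y \<otimes>\<^bsub>B\<^esub> z))) (e x00)))"
      by (rule A.coaction_cong, (rule lin)+, rule cij, (rule lin co | assumption)+)
    also have "\<dots> = ?L (\<rho> x) (\<lambda>x0 x1. ?L (comult H x1) (\<lambda>h1 h2.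
          ?P (f (\<beta> h2 \<one>\<^bsub>B\<^esub>)) (f (\<beta> h1 (y \<otimes>\<^bsub>B\<^esub> z))) (e x0)))"
      by (rule A.lift_coassoc, (rule lin co | assumption)+)
    also have "\<dots> = ?L (\<rho> x) (\<lambda>x0 x1. ?L (comult H x1) (\<lambda>h1 h2.
          counit H h2 \<odot>\<^bsub>?T\<^esub> ?P ?one (f (\<beta> h1 (y \<otimes>\<^bsub>B\<^esub> z))) (e x0)))"
    proof (rule A.coaction_cong, (rule lin)+, rule HC.coaction_cong)
      fix a h h1 h2 assume *: "a \<in> carrier A" "h \<in> carrier H" "h1 \<in> carrier H" "h2 \<in> carrier H"
      have hom: "(\<lambda>u. ?P (f u) (f (\<beta> h1 (y \<otimes>\<^bsub>B\<^esub> z))) (e a)) \<in> module_hom K B ?T"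
        using * by - (rule lin | assumption)+
      show "?P (f (\<beta> h2 \<one>\<^bsub>B\<^esub>)) (f (\<beta> h1 (y \<otimes>\<^bsub>B\<^esub> z))) (e a)
        = counit H h2 \<odot>\<^bsub>?T\<^esub> ?P ?one (f (\<beta> h1 (y \<otimes>\<^bsub>B\<^esub> z))) (e a)"
        using * module_hom_smult[OF hom A.H.counit_closed] by (simp add: B.action_unit lin)
    qed (rule lin co T.smult_closed A.H.counit_closed | assumption)+
    also have "\<dots> = ?L (\<rho> x) (\<lambda>x0 x1. ?P ?one (f (\<beta> x1 (y \<otimes>\<^bsub>B\<^esub> z))) (e x0))"
      by (rule A.coaction_cong, (rule lin)+, rule A.H.lift_counit_right, (rule lin co | assumption)+)
    finally show "?L (?ij x' y') (\<lambda>b a.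
        ?L (?ij a z') (\<lambda>c a'.
          ?L (?jj b c) (\<lambda>c' b'. ?P c' b' a')))
      = ?L (?jj y' z') (\<lambda>c b.
        ?L (?ij x' c) (\<lambda>c' a.
          ?L (?ij a b) (\<lambda>b' a'. ?P c' b' a')))"
      unfolding lhs ..
  qed
qed

section \<open>The dual algebra\<close>

lemma hom_sum_of_homs:
  assumes V: "vectorspace K V" and U: "vectorspace K U" and "\<And>b. b \<in> B \<Longrightarrow> (\<lambda>x. f b x) \<in> module_hom K V U"
  shows "(\<lambda>x. \<Oplus>\<^bsub>U\<^esub>b\<in>B. f b x) \<in> module_hom K V U"
proof -
  interpret U: vectorspace K U by fact
  interpret V: vectorspace K V by fact
  have zero: "(\<lambda>x. \<zero>\<^bsub>U\<^esub>) \<in> module_hom K V U" by (rule homI) auto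
  show ?thesis using assms(3)
  proof (induction B rule: infinite_finite_induct)
    case (insert b B)
    then have IH: "(\<lambda>x. \<Oplus>\<^bsub>U\<^esub>b\<in>B. f b x) \<in> module_hom K V U" and b: "f b \<in> module_hom K V U" by auto
    have eq: "(\<Oplus>\<^bsub>U\<^esub>c\<in>insert b B. f c x) = f b x \<oplus>\<^bsub>U\<^esub> (\<Oplus>\<^bsub>U\<^esub>c\<in>B. f c x)" if "x \<in> carrier V" for x
      using insert.hyps that hom_closed[OF insert.prems]
      by (intro U.M.finsum_insert) auto
    have "(\<lambda>x. f b x \<oplus>\<^bsub>U\<^esub> (\<Oplus>\<^bsub>U\<^esub>c\<in>B. f c x)) \<in> module_hom K V U"
      using hom_closed[OF b] hom_closed[OF IH]
      by (intro homI) (simp_all add: module_hom_add[OF b] module_hom_add[OF IH] module_hom_smult[OF b]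
          module_hom_smult[OF IH] U.smult_r_distr U.M.a_ac)
    then show ?case by (rule hom_cong[OF V, rotated]) (simp add: eq)
  qed (simp_all add: zero)
qed

text \<open>
  Expanding the left components of a tensor in coordinates collects everything else in the right
  components. Both sides are linear in \<open>t\<close>, so it is enough to expand a pure tensor.
\<close>

lemma tensor_coordinates_left:
  assumes vs [lin]: "vectorspace K A" "vectorspace K V"
    and a: "\<And>b. b \<in> B \<Longrightarrow> a b \<in> carrier A"
    and c: "\<And>b. b \<in> B \<Longrightarrow> c b \<in> module_hom K A (self_space K)"
    and coords: "\<And>x. x \<in> carrier A \<Longrightarrow> x = (\<Oplus>\<^bsub>A\<^esub>b\<in>B. c b x \<odot>\<^bsub>A\<^esub> a b)"
    and t: "t \<in> carrier (tensor K A V)"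
  shows "t = (\<Oplus>\<^bsub>tensor K A V\<^esub>b\<in>B. pure_tensor K A V (a b) (tensor_lift K V t (\<lambda>x v. c b x \<odot>\<^bsub>V\<^esub> v)))"
proof -
  interpret A: vectorspace K A by fact
  interpret V: vectorspace K V by fact
  have TV: "vectorspace K (tensor K A V)" by (rule lin)+
  interpret T: vectorspace K "tensor K A V" by (rule TV)
  have cK: "c b x \<in> carrier K" if "b \<in> B" "x \<in> carrier A" for b x
    using hom_closed[OF c[OF that(1)] that(2)] by (simp add: self_space_simps)
  have bil: "bilinear K A V V (\<lambda>x v. c b x \<odot>\<^bsub>V\<^esub> v)" if "b \<in> B" for b
    by (rule bilinearI) (auto intro: hom_scalar[OF vs(2) c[OF that]] hom_smult[OF vs(2) cK[OF that] hom_id])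
  let ?f = "\<lambda>t. \<Oplus>\<^bsub>tensor K A V\<^esub>b\<in>B. pure_tensor K A V (a b) (tensor_lift K V t (\<lambda>x v. c b x \<odot>\<^bsub>V\<^esub> v))"
  have f: "?f \<in> module_hom K (tensor K A V) (tensor K A V)"
    by (rule hom_sum_of_homs, (rule lin a bil lift_hom | assumption)+)
  have "t = ?f t"
  proof (rule hom_tensor_eqI[OF vs TV hom_id f t])
    fix x v assume x: "x \<in> carrier A" and v: "v \<in> carrier V"
    have "pure_tensor K A V x v = pure_tensor K A V (\<Oplus>\<^bsub>A\<^esub>b\<in>B. c b x \<odot>\<^bsub>A\<^esub> a b) v"
      using coords[OF x] by simp
    also have "\<dots> = (\<Oplus>\<^bsub>tensor K A V\<^esub>b\<in>B. pure_tensor K A V (c b x \<odot>\<^bsub>A\<^esub> a b) v)"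
      using x v a cK by (intro hom_finsum[OF vs(1) TV]) (auto intro!: lin)
    also have "\<dots> = ?f (pure_tensor K A V x v)"
    proof (rule T.M.finsum_cong'[OF refl])
      show "(\<lambda>b. pure_tensor K A V (a b) (tensor_lift K V (pure_tensor K A V x v) (\<lambda>x v. c b x \<odot>\<^bsub>V\<^esub> v)))
          \<in> B \<rightarrow> carrier (tensor K A V)"
        using a x v bil cK by (auto intro!: pure_tensor_closed vs simp: lift_pure[OF vs vs(2) bil])
      fix b assume b: "b \<in> B"
      have l: "(\<lambda>u. pure_tensor K A V u v) \<in> module_hom K A (tensor K A V)"
        and r: "(\<lambda>u. pure_tensor K A V (a b) u) \<in> module_hom K V (tensor K A V)"
        using v a[OF b] by - (rule lin | assumption)+
      show "pure_tensor K A V (c b x \<odot>\<^bsub>A\<^esub> a b) v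
        = pure_tensor K A V (a b) (tensor_lift K V (pure_tensor K A V x v) (\<lambda>x v. c b x \<odot>\<^bsub>V\<^esub> v))"
        using module_hom_smult[OF l cK[OF b x] a[OF b]] module_hom_smult[OF r cK[OF b x] v]
        by (simp add: lift_pure[OF vs vs(2) bil[OF b] x v])
    qed
    finally show "pure_tensor K A V x v = ?f (pure_tensor K A V x v)" .
  qed
  then show ?thesis .
qed

lemma tensor_coordinates_right:
  assumes vs [lin]: "vectorspace K V" "vectorspace K A"
    and a: "\<And>b. b \<in> B \<Longrightarrow> a b \<in> carrier A"
    and c: "\<And>b. b \<in> B \<Longrightarrow> c b \<in> module_hom K A (self_space K)"
    and coords: "\<And>x. x \<in> carrier A \<Longrightarrow> x = (\<Oplus>\<^bsub>A\<^esub>b\<in>B. c b x \<odot>\<^bsub>A\<^esub> a b)"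
    and t: "t \<in> carrier (tensor K V A)"
  shows "t = (\<Oplus>\<^bsub>tensor K V A\<^esub>b\<in>B. pure_tensor K V A (tensor_lift K V t (\<lambda>v x. c b x \<odot>\<^bsub>V\<^esub> v)) (a b))"
proof -
  interpret A: vectorspace K A by fact
  interpret V: vectorspace K V by fact
  have TV: "vectorspace K (tensor K V A)" by (rule lin)+
  interpret T: vectorspace K "tensor K V A" by (rule TV)
  have cK: "c b x \<in> carrier K" if "b \<in> B" "x \<in> carrier A" for b x
    using hom_closed[OF c[OF that(1)] that(2)] by (simp add: self_space_simps)
  have bil: "bilinear K V A V (\<lambda>v x. c b x \<odot>\<^bsub>V\<^esub> v)" if "b \<in> B" for b
    by (rule bilinearI) (auto intro: hom_scalar[OF vs(1) c[OF that]] hom_smult[OF vs(1) cK[OF that] hom_id])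
  let ?f = "\<lambda>t. \<Oplus>\<^bsub>tensor K V A\<^esub>b\<in>B. pure_tensor K V A (tensor_lift K V t (\<lambda>v x. c b x \<odot>\<^bsub>V\<^esub> v)) (a b)"
  have f: "?f \<in> module_hom K (tensor K V A) (tensor K V A)"
    by (rule hom_sum_of_homs, (rule lin a bil lift_hom | assumption)+)
  have "t = ?f t"
  proof (rule hom_tensor_eqI[OF vs TV hom_id f t])
    fix v x assume x: "x \<in> carrier A" and v: "v \<in> carrier V"
    have "pure_tensor K V A v x = pure_tensor K V A v (\<Oplus>\<^bsub>A\<^esub>b\<in>B. c b x \<odot>\<^bsub>A\<^esub> a b)"
      using coords[OF x] by simp
    also have "\<dots> = (\<Oplus>\<^bsub>tensor K V A\<^esub>b\<in>B. pure_tensor K V A v (c b x \<odot>\<^bsub>A\<^esub> a b))"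
      using x v a cK by (intro hom_finsum[OF vs(2) TV]) (auto intro!: lin)
    also have "\<dots> = ?f (pure_tensor K V A v x)"
    proof (rule T.M.finsum_cong'[OF refl])
      show "(\<lambda>b. pure_tensor K V A (tensor_lift K V (pure_tensor K V A v x) (\<lambda>v x. c b x \<odot>\<^bsub>V\<^esub> v)) (a b))
          \<in> B \<rightarrow> carrier (tensor K V A)"
        using a x v bil cK by (auto intro!: pure_tensor_closed vs simp: lift_pure[OF vs vs(1) bil])
      fix b assume b: "b \<in> B"
      have l: "(\<lambda>u. pure_tensor K V A v u) \<in> module_hom K A (tensor K V A)"
        and r: "(\<lambda>u. pure_tensor K V A u (a b)) \<in> module_hom K V (tensor K V A)"
        using v a[OF b] by - (rule lin | assumption)+
      show "pure_tensor K V A v (c b x \<odot>\<^bsub>A\<^esub> a b)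
        = pure_tensor K V A (tensor_lift K V (pure_tensor K V A v x) (\<lambda>v x. c b x \<odot>\<^bsub>V\<^esub> v)) (a b)"
        using module_hom_smult[OF l cK[OF b x] a[OF b]] module_hom_smult[OF r cK[OF b x] v]
        by (simp add: lift_pure[OF vs vs(1) bil[OF b] v x])
    qed
    finally show "pure_tensor K V A v x = ?f (pure_tensor K V A v x)" .
  qed
  then show ?thesis .
qed

lemma dual_space_simps:
  "carrier (dual_space K H) = module_hom K H (self_space K) \<inter> extensional (carrier H)"
  "\<zero>\<^bsub>dual_space K H\<^esub> = (\<lambda>h\<in>carrier H. \<zero>\<^bsub>K\<^esub>)"
  "\<one>\<^bsub>dual_space K H\<^esub> = (\<lambda>h\<in>carrier H. counit H h)"
  "l \<oplus>\<^bsub>dual_space K H\<^esub> l' = (\<lambda>h\<in>carrier H. l h \<oplus>\<^bsub>K\<^esub> l' h)"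
  "c \<odot>\<^bsub>dual_space K H\<^esub> l = (\<lambda>h\<in>carrier H. c \<otimes>\<^bsub>K\<^esub> l h)"
  "l \<otimes>\<^bsub>dual_space K H\<^esub> l' = (\<lambda>h\<in>carrier H.
       tensor_lift K (self_space K) (comult H h) (\<lambda>h1 h2. l h2 \<otimes>\<^bsub>K\<^esub> l' h1))"
  by (simp_all add: dual_space_def)

text \<open>
  The action \<open>h l = l\<^sub>(\<^sub>1\<^sub>)(h) l\<^sub>(\<^sub>2\<^sub>)\<close>, written without the comultiplication of the dual, so that it is
  defined for \<open>H\<close> of any dimension.
\<close>

definition dual_action :: "('k, 'h) bialgebra \<Rightarrow> 'h \<Rightarrow> ('h \<Rightarrow> 'k) \<Rightarrow> 'h \<Rightarrow> 'k" where
  "dual_action H h l = (\<lambda>x\<in>carrier H. l (x \<otimes>\<^bsub>H\<^esub> h))"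

context bialgebra
begin

abbreviation D where "D \<equiv> dual_space K H"

lemma dual_hom: "l \<in> carrier D \<Longrightarrow> (\<lambda>x. l x) \<in> module_hom K H (self_space K)"
  by (simp add: dual_space_simps)

lemma dual_closed: "\<lbrakk>l \<in> carrier D; h \<in> carrier H\<rbrakk> \<Longrightarrow> l h \<in> carrier K"
  using hom_closed[OF dual_hom] by (simp add: self_space_simps)

lemma restrict_dual:
  assumes "f \<in> module_hom K H (self_space K)"
  shows "(\<lambda>h\<in>carrier H. f h) \<in> carrier D"
  unfolding dual_space_simps
  by (rule IntI, rule hom_cong[OF is_vectorspace _ assms]) auto

lemma dual_eqI:
  "\<lbrakk>l \<in> carrier D; l' \<in> carrier D; \<And>h. h \<in> carrier H \<Longrightarrow> l h = l' h\<rbrakk> \<Longrightarrow> l = l'"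
  by (auto simp: dual_space_simps intro: extensionalityI)

lemma self_vectorspace: "vectorspace K (self_space K)"
  by (rule self_space_vectorspace) unfold_locales

lemma dual_vectorspace: "vectorspace K D"
proof -
  have cl: "l \<oplus>\<^bsub>D\<^esub> l' \<in> carrier D" if l: "l \<in> carrier D" "l' \<in> carrier D" for l l'
    unfolding dual_space_simps(4)
    using dual_closed[OF l(1)] dual_closed[OF l(2)] module_hom_add[OF dual_hom[OF l(1)]] module_hom_add[OF dual_hom[OF l(2)]]
      module_hom_smult[OF dual_hom[OF l(1)]] module_hom_smult[OF dual_hom[OF l(2)]]
    by (intro restrict_dual homI) (simp_all add: self_space_simps R.a_ac R.r_distr)
  have sm: "c \<odot>\<^bsub>D\<^esub> l \<in> carrier D" if c: "c \<in> carrier K" and l: "l \<in> carrier D" for c l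
    unfolding dual_space_simps(5)
    using c dual_closed[OF l] module_hom_add[OF dual_hom[OF l]] module_hom_smult[OF dual_hom[OF l]]
    by (intro restrict_dual homI) (simp_all add: self_space_simps R.m_ac R.r_distr)
  have z: "\<zero>\<^bsub>D\<^esub> \<in> carrier D"
    unfolding dual_space_simps(2) by (intro restrict_dual homI) (simp_all add: self_space_simps)
  show ?thesis
  proof (rule vs_criteria)
    show "field K" by unfold_locales
    show "\<zero>\<^bsub>D\<^esub> \<in> carrier D" by (rule z)
    show "\<forall>v w. v \<in> carrier D \<and> w \<in> carrier D \<longrightarrow> v \<oplus>\<^bsub>D\<^esub> w \<in> carrier D" using cl by blast
    show "\<forall>c v. c \<in> carrier K \<and> v \<in> carrier D \<longrightarrow> c \<odot>\<^bsub>D\<^esub> v \<in> carrier D" using sm by blast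
    show "\<forall>v\<in>carrier D. \<exists>w\<in>carrier D. v \<oplus>\<^bsub>D\<^esub> w = \<zero>\<^bsub>D\<^esub>"
    proof
      fix l assume l: "l \<in> carrier D"
      have "l h \<oplus>\<^bsub>K\<^esub> \<ominus>\<^bsub>K\<^esub> \<one>\<^bsub>K\<^esub> \<otimes>\<^bsub>K\<^esub> l h = \<zero>\<^bsub>K\<^esub>" if "h \<in> carrier H" for h
        using dual_closed[OF l that] by (simp add: R.l_minus R.r_neg)
      then have "l \<oplus>\<^bsub>D\<^esub> (\<ominus>\<^bsub>K\<^esub> \<one>\<^bsub>K\<^esub>) \<odot>\<^bsub>D\<^esub> l = \<zero>\<^bsub>D\<^esub>"
        by (auto simp: dual_space_simps(2,4,5))
      then show "\<exists>w\<in>carrier D. l \<oplus>\<^bsub>D\<^esub> w = \<zero>\<^bsub>D\<^esub>" using sm[OF _ l] by blast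
    qed
    show "\<forall>v w. v \<in> carrier D \<and> w \<in> carrier D \<longrightarrow> v \<oplus>\<^bsub>D\<^esub> w = w \<oplus>\<^bsub>D\<^esub> v"
      by (auto simp: dual_space_simps(4) dual_closed R.a_comm intro!: restrict_ext)
    show "\<forall>u v w. u \<in> carrier D \<and> v \<in> carrier D \<and> w \<in> carrier D \<longrightarrow>
      (u \<oplus>\<^bsub>D\<^esub> v) \<oplus>\<^bsub>D\<^esub> w = u \<oplus>\<^bsub>D\<^esub> (v \<oplus>\<^bsub>D\<^esub> w)"
      by (auto simp: dual_space_simps(4) dual_closed R.a_assoc intro!: restrict_ext)
    show "\<forall>v\<in>carrier D. v \<oplus>\<^bsub>D\<^esub> \<zero>\<^bsub>D\<^esub> = v"
      using cl[OF _ z] by (auto intro!: dual_eqI simp: dual_space_simps(2,4) dual_closed)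
    show "\<forall>a b v. a \<in> carrier K \<and> b \<in> carrier K \<and> v \<in> carrier D \<longrightarrow>
      (a \<otimes>\<^bsub>K\<^esub> b) \<odot>\<^bsub>D\<^esub> v = a \<odot>\<^bsub>D\<^esub> (b \<odot>\<^bsub>D\<^esub> v)"
      by (auto simp: dual_space_simps(5) dual_closed R.m_assoc intro!: restrict_ext)
    show "\<forall>v\<in>carrier D. \<one>\<^bsub>K\<^esub> \<odot>\<^bsub>D\<^esub> v = v"
      using sm by (auto intro!: dual_eqI simp: dual_space_simps(5) dual_closed)
    show "\<forall>a b v. a \<in> carrier K \<and> b \<in> carrier K \<and> v \<in> carrier D \<longrightarrow>
      (a \<oplus>\<^bsub>K\<^esub> b) \<odot>\<^bsub>D\<^esub> v = a \<odot>\<^bsub>D\<^esub> v \<oplus>\<^bsub>D\<^esub> b \<odot>\<^bsub>D\<^esub> v"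
      by (auto simp: dual_space_simps(4,5) dual_closed R.l_distr intro!: restrict_ext)
    show "\<forall>a v w. a \<in> carrier K \<and> v \<in> carrier D \<and> w \<in> carrier D \<longrightarrow>
      a \<odot>\<^bsub>D\<^esub> (v \<oplus>\<^bsub>D\<^esub> w) = a \<odot>\<^bsub>D\<^esub> v \<oplus>\<^bsub>D\<^esub> a \<odot>\<^bsub>D\<^esub> w"
      by (auto simp: dual_space_simps(4,5) dual_closed R.r_distr intro!: restrict_ext)
  qed
qed

lemma dual_eval_hom: "h \<in> carrier H \<Longrightarrow> (\<lambda>l. l h) \<in> module_hom K D (self_space K)"
  by (rule homI) (simp_all add: dual_closed self_space_simps(1) dual_space_simps(4,5) self_space_simps(3,4))

lemma hom_mult_left: "\<lbrakk>c \<in> carrier K; (\<lambda>x. g x) \<in> module_hom K V (self_space K)\<rbrakk>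
    \<Longrightarrow> (\<lambda>x. c \<otimes>\<^bsub>K\<^esub> g x) \<in> module_hom K V (self_space K)"
  using hom_smult[OF self_vectorspace] by (simp add: self_space_simps)

lemma hom_mult_right: "\<lbrakk>c \<in> carrier K; (\<lambda>x. g x) \<in> module_hom K V (self_space K)\<rbrakk>
    \<Longrightarrow> (\<lambda>x. g x \<otimes>\<^bsub>K\<^esub> c) \<in> module_hom K V (self_space K)"
  using hom_scalar[OF self_vectorspace] by (simp add: self_space_simps)

lemma self_closed: "c \<in> carrier K \<Longrightarrow> c \<in> carrier (self_space K)"
  by (simp add: self_space_simps)

lemmas dual_lin = self_vectorspace is_vectorspace dual_vectorspace self_closed hom_mult_left hom_mult_right R.m_closed dual_closed
  mult_lin coaction_rules[OF comult_linear is_vectorspace is_vectorspace] hom_closed[OF comult_linear]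

lemma comult_cong:
  assumes "h \<in> carrier H" "vectorspace K U"
    and "\<And>x y. \<lbrakk>x \<in> carrier H; y \<in> carrier H\<rbrakk> \<Longrightarrow> f x y = g x y"
    and "\<And>x y. \<lbrakk>x \<in> carrier H; y \<in> carrier H\<rbrakk> \<Longrightarrow> g x y \<in> carrier U"
  shows "tensor_lift K U (comult H h) f = tensor_lift K U (comult H h) g"
  by (rule lift_cong[OF is_vectorspace is_vectorspace assms(2) hom_closed[OF comult_linear assms(1)] assms(3,4)])

lemma lift_self_closed:
  assumes "h \<in> carrier H" "\<And>x y. \<lbrakk>x \<in> carrier H; y \<in> carrier H\<rbrakk> \<Longrightarrow> f x y \<in> carrier K"
  shows "tensor_lift K (self_space K) (comult H h) f \<in> carrier K"
  using coaction_closed[OF comult_linear is_vectorspace is_vectorspace self_vectorspace assms(1), of f] assms(2)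
  by (simp add: self_space_simps)

lemma dual_mult_closed:
  assumes l: "l \<in> carrier D" "l' \<in> carrier D"
  shows "l \<otimes>\<^bsub>D\<^esub> l' \<in> carrier D"
  unfolding dual_space_simps(6) using l
  by - (rule restrict_dual, (rule lin dual_lin hom_compose[OF dual_hom[OF l(1)]] hom_compose[OF dual_hom[OF l(2)]] | assumption)+)

lemma dual_one_closed: "\<one>\<^bsub>D\<^esub> \<in> carrier D"
  unfolding dual_space_simps(3) by (rule restrict_dual[OF counit_linear])

lemma dual_mult_eval:
  "h \<in> carrier H \<Longrightarrow> (l \<otimes>\<^bsub>D\<^esub> l') h = tensor_lift K (self_space K) (comult H h) (\<lambda>h1 h2. l h2 \<otimes>\<^bsub>K\<^esub> l' h1)"
  by (simp add: dual_space_simps)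

lemma dual_mult_assoc:
  assumes l [lin]: "l1 \<in> carrier D" "l2 \<in> carrier D" "l3 \<in> carrier D"
  shows "(l1 \<otimes>\<^bsub>D\<^esub> l2) \<otimes>\<^bsub>D\<^esub> l3 = l1 \<otimes>\<^bsub>D\<^esub> (l2 \<otimes>\<^bsub>D\<^esub> l3)"
proof (rule dual_eqI)
  interpret C: right_comodule_algebra K H H "comult H" by (rule right_comodule_algebra_self)
  fix h assume h [lin]: "h \<in> carrier H"
  let ?K = "self_space K"
  note homs [lin] = hom_compose[OF dual_hom[OF l(1)]] hom_compose[OF dual_hom[OF l(2)]] hom_compose[OF dual_hom[OF l(3)]]
  note dual_lin = lift_self_closed dual_lin
  have "((l1 \<otimes>\<^bsub>D\<^esub> l2) \<otimes>\<^bsub>D\<^esub> l3) h = tensor_lift K ?K (comult H h) (\<lambda>h1 h2.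
      tensor_lift K ?K (comult H h2) (\<lambda>a b. l1 b \<otimes>\<^bsub>K\<^esub> l2 a) \<otimes>\<^bsub>K\<^esub> l3 h1)"
    unfolding dual_mult_eval[OF h]
    by (rule comult_cong, (rule lin dual_lin)+, simp add: dual_mult_eval, (rule lin dual_lin | assumption)+)
  also have "\<dots> = tensor_lift K ?K (comult H h) (\<lambda>h1 h2.
      tensor_lift K ?K (comult H h2) (\<lambda>a b. (l1 b \<otimes>\<^bsub>K\<^esub> l2 a) \<otimes>\<^bsub>K\<^esub> l3 h1))"
    by (rule comult_cong, (rule lin dual_lin)+,
        rule hom_lift[where f = "\<lambda>u. u \<otimes>\<^bsub>K\<^esub> l3 _", OF is_vectorspace is_vectorspace _ self_vectorspace self_vectorspace],
        (rule lin dual_lin | assumption)+)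
  also have "\<dots> = tensor_lift K ?K (comult H h) (\<lambda>h1 h2.
      tensor_lift K ?K (comult H h1) (\<lambda>a b. (l1 h2 \<otimes>\<^bsub>K\<^esub> l2 b) \<otimes>\<^bsub>K\<^esub> l3 a))"
    by (rule C.lift_coassoc[symmetric], (rule lin dual_lin | assumption)+)
  also have "\<dots> = tensor_lift K ?K (comult H h) (\<lambda>h1 h2.
      tensor_lift K ?K (comult H h1) (\<lambda>a b. l1 h2 \<otimes>\<^bsub>K\<^esub> (l2 b \<otimes>\<^bsub>K\<^esub> l3 a)))"
    by (rule comult_cong, (rule lin dual_lin)+, rule comult_cong, (rule lin dual_lin | assumption)+,
        rule R.m_assoc, (rule lin dual_lin | assumption)+)
  also have "\<dots> = tensor_lift K ?K (comult H h) (\<lambda>h1 h2.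
      l1 h2 \<otimes>\<^bsub>K\<^esub> tensor_lift K ?K (comult H h1) (\<lambda>a b. l2 b \<otimes>\<^bsub>K\<^esub> l3 a))"
    by (rule comult_cong, (rule lin dual_lin)+,
        rule hom_lift[where f = "\<lambda>u. l1 _ \<otimes>\<^bsub>K\<^esub> u", OF is_vectorspace is_vectorspace _ self_vectorspace self_vectorspace, symmetric],
        (rule lin dual_lin | assumption)+)
  also have "\<dots> = (l1 \<otimes>\<^bsub>D\<^esub> (l2 \<otimes>\<^bsub>D\<^esub> l3)) h"
    unfolding dual_mult_eval[OF h]
    by (rule comult_cong, (rule lin dual_lin)+, simp add: dual_mult_eval, (rule lin dual_lin dual_mult_closed | assumption)+)
  finally show "((l1 \<otimes>\<^bsub>D\<^esub> l2) \<otimes>\<^bsub>D\<^esub> l3) h = (l1 \<otimes>\<^bsub>D\<^esub> (l2 \<otimes>\<^bsub>D\<^esub> l3)) h" .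
qed (intro dual_mult_closed l)+

end

context bialgebra
begin

lemma dual_one_eval: "h \<in> carrier H \<Longrightarrow> \<one>\<^bsub>D\<^esub> h = counit H h"
  by (simp add: dual_space_simps)

lemma dual_add_eval: "h \<in> carrier H \<Longrightarrow> (l \<oplus>\<^bsub>D\<^esub> l') h = l h \<oplus>\<^bsub>K\<^esub> l' h"
  and dual_smult_eval: "h \<in> carrier H \<Longrightarrow> (c \<odot>\<^bsub>D\<^esub> l) h = c \<otimes>\<^bsub>K\<^esub> l h"
  by (simp_all add: dual_space_simps)

lemma dual_mult_bilinear: "bilinear K D D D (\<lambda>l l'. l \<otimes>\<^bsub>D\<^esub> l')"
proof -
  interpret D: vectorspace K D by (rule dual_vectorspace)
  let ?K = "self_space K"
  have left: "(\<lambda>l. (l \<otimes>\<^bsub>D\<^esub> l') h) \<in> module_hom K D ?K" if l': "l' \<in> carrier D" and h: "h \<in> carrier H" for l' h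
    unfolding dual_mult_eval[OF h] using that
    by - (rule coaction_body[OF comult_linear], (rule lin dual_lin dual_eval_hom | assumption)+)
  have right: "(\<lambda>l'. (l \<otimes>\<^bsub>D\<^esub> l') h) \<in> module_hom K D ?K" if l: "l \<in> carrier D" and h: "h \<in> carrier H" for l h
    unfolding dual_mult_eval[OF h] using that
    by - (rule coaction_body[OF comult_linear], (rule lin dual_lin dual_eval_hom | assumption)+)
  have pointwise: "f \<in> module_hom K D D"
    if "\<And>l. l \<in> carrier D \<Longrightarrow> f l \<in> carrier D" "\<And>h. h \<in> carrier H \<Longrightarrow> (\<lambda>l. f l h) \<in> module_hom K D ?K" for f
    using that(1) module_hom_add[OF that(2)] module_hom_smult[OF that(2)]
    by (intro homI) (auto intro!: dual_eqI simp: dual_add_eval dual_smult_eval self_space_simps)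
  show ?thesis
    by (intro bilinearI pointwise dual_mult_closed left right)
qed

lemma dual_unital_algebra: "unital_algebra K D"
proof -
  interpret D: vectorspace K D by (rule dual_vectorspace)
  have one_left: "\<one>\<^bsub>D\<^esub> \<otimes>\<^bsub>D\<^esub> l = l" if l: "l \<in> carrier D" for l
  proof (rule dual_eqI[OF dual_mult_closed[OF dual_one_closed l] l])
    fix h assume h: "h \<in> carrier H"
    have "(\<one>\<^bsub>D\<^esub> \<otimes>\<^bsub>D\<^esub> l) h = tensor_lift K (self_space K) (comult H h) (\<lambda>h1 h2. counit H h2 \<odot>\<^bsub>self_space K\<^esub> l h1)"
      unfolding dual_mult_eval[OF h]
      by (rule comult_cong[OF h self_vectorspace]) (simp_all add: dual_one_eval self_space_simps counit_closed dual_closed[OF l])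
    then show "(\<one>\<^bsub>D\<^esub> \<otimes>\<^bsub>D\<^esub> l) h = l h" using lift_counit_right[OF self_vectorspace dual_hom[OF l] h] by simp
  qed
  have one_right: "l \<otimes>\<^bsub>D\<^esub> \<one>\<^bsub>D\<^esub> = l" if l: "l \<in> carrier D" for l
  proof (rule dual_eqI[OF dual_mult_closed[OF l dual_one_closed] l])
    fix h assume h: "h \<in> carrier H"
    have "(l \<otimes>\<^bsub>D\<^esub> \<one>\<^bsub>D\<^esub>) h = tensor_lift K (self_space K) (comult H h) (\<lambda>h1 h2. counit H h1 \<odot>\<^bsub>self_space K\<^esub> l h2)"
      unfolding dual_mult_eval[OF h]
      by (rule comult_cong[OF h self_vectorspace])
        (simp_all add: dual_one_eval self_space_simps counit_closed dual_closed[OF l] R.m_comm)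
    then show "(l \<otimes>\<^bsub>D\<^esub> \<one>\<^bsub>D\<^esub>) h = l h" using lift_counit_left[OF self_vectorspace dual_hom[OF l] h] by simp
  qed
  note add_left = module_hom_add[OF bilinear_left[OF dual_mult_bilinear]]
    and add_right = module_hom_add[OF bilinear_right[OF dual_mult_bilinear]]
    and smult_left = module_hom_smult[OF bilinear_left[OF dual_mult_bilinear]]
    and smult_right = module_hom_smult[OF bilinear_right[OF dual_mult_bilinear]]
  have "ring D"
  proof (rule ringI)
    show "abelian_group D" by unfold_locales
    show "monoid D"
      by (rule monoidI) (simp_all add: dual_mult_closed dual_one_closed one_left one_right dual_mult_assoc)
  qed (simp_all add: add_left add_right)
  then show ?thesis
    by (intro unital_algebra.intro unital_algebra_axioms.intro dual_vectorspace)
      (simp_all add: smult_left smult_right)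
qed

lemma dual_action_eval: "x \<in> carrier H \<Longrightarrow> dual_action H h l x = l (x \<otimes>\<^bsub>H\<^esub> h)"
  by (simp add: dual_action_def)

lemma dual_action_closed:
  assumes h: "h \<in> carrier H" and l: "l \<in> carrier D"
  shows "dual_action H h l \<in> carrier D"
  unfolding dual_action_def using h
  by - (rule restrict_dual, (rule lin dual_lin hom_compose[OF dual_hom[OF l]] | assumption)+)

text \<open>
  In the rainbow convention \<open>(l l')(x h) = l(x\<^sub>(\<^sub>2\<^sub>) h\<^sub>(\<^sub>2\<^sub>)) l'(x\<^sub>(\<^sub>1\<^sub>) h\<^sub>(\<^sub>1\<^sub>))\<close> because the comultiplication of \<open>H\<close> is
  multiplicative, and this is the value of \<open>(h\<^sub>(\<^sub>2\<^sub>) l) (h\<^sub>(\<^sub>1\<^sub>) l')\<close> at \<open>x\<close>.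
\<close>

lemma dual_left_module_algebra: "left_module_algebra K H D (dual_action H)"
proof -
  interpret D: unital_algebra K D by (rule dual_unital_algebra)
  interpret C: right_comodule_algebra K H H "comult H" by (rule right_comodule_algebra_self)
  let ?K = "self_space K"
  have bil: "bilinear K H D D (dual_action H)"
  proof (rule bilinearI; rule homI)
    fix h l l' assume "h \<in> carrier H" "l \<in> carrier D" "l' \<in> carrier D"
    then show "dual_action H h (l \<oplus>\<^bsub>D\<^esub> l') = dual_action H h l \<oplus>\<^bsub>D\<^esub> dual_action H h l'"
      by (intro dual_eqI) (simp_all add: dual_action_closed dual_action_eval dual_add_eval)
  next
    fix h l c assume "h \<in> carrier H" "l \<in> carrier D" "c \<in> carrier K"
    then show "dual_action H h (c \<odot>\<^bsub>D\<^esub> l) = c \<odot>\<^bsub>D\<^esub> dual_action H h l"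
      by (intro dual_eqI) (simp_all add: dual_action_closed dual_action_eval dual_smult_eval)
  next
    fix h h' l assume *: "h \<in> carrier H" "h' \<in> carrier H" "l \<in> carrier D"
    then show "dual_action H (h \<oplus>\<^bsub>H\<^esub> h') l = dual_action H h l \<oplus>\<^bsub>D\<^esub> dual_action H h' l"
      using module_hom_add[OF dual_hom[OF *(3)]]
      by (intro dual_eqI)
        (simp_all add: dual_action_closed dual_action_eval dual_add_eval alg.r_distr self_space_simps)
  next
    fix h c l assume *: "h \<in> carrier H" "c \<in> carrier K" "l \<in> carrier D"
    then show "dual_action H (c \<odot>\<^bsub>H\<^esub> h) l = c \<odot>\<^bsub>D\<^esub> dual_action H h l"
      using module_hom_smult[OF dual_hom[OF *(3)]]
      by (intro dual_eqI)
        (simp_all add: dual_action_closed dual_action_eval dual_smult_eval smult_mult_right self_space_simps)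
  qed (auto simp: dual_action_closed)
  have prod: "dual_action H h (l \<otimes>\<^bsub>D\<^esub> l')
      = tensor_lift K D (comult H h) (\<lambda>h1 h2. dual_action H h2 l \<otimes>\<^bsub>D\<^esub> dual_action H h1 l')"
    if h [lin]: "h \<in> carrier H" and l [lin]: "l \<in> carrier D" and l' [lin]: "l' \<in> carrier D" for h l l'
  proof (rule dual_eqI)
    note [lin] = D.mult_lin dual_action_closed lift_self_closed
      hom_compose[OF dual_hom[OF l]] hom_compose[OF dual_hom[OF l']]
    show "dual_action H h (l \<otimes>\<^bsub>D\<^esub> l') \<in> carrier D" by (rule lin)+
    show "tensor_lift K D (comult H h) (\<lambda>h1 h2. dual_action H h2 l \<otimes>\<^bsub>D\<^esub> dual_action H h1 l') \<in> carrier D"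
      by (rule lin dual_lin | assumption)+
    fix x assume x [lin]: "x \<in> carrier H"
    have "dual_action H h (l \<otimes>\<^bsub>D\<^esub> l') x
      = tensor_lift K ?K (comult H (x \<otimes>\<^bsub>H\<^esub> h)) (\<lambda>a b. l b \<otimes>\<^bsub>K\<^esub> l' a)"
      by (simp add: dual_action_eval[OF x] dual_mult_eval x h)
    also have "\<dots> = tensor_lift K ?K (comult H x) (\<lambda>x1 x2. tensor_lift K ?K (comult H h) (\<lambda>h1 h2.
        l (x2 \<otimes>\<^bsub>H\<^esub> h2) \<otimes>\<^bsub>K\<^esub> l' (x1 \<otimes>\<^bsub>H\<^esub> h1)))"
      by (rule C.lift_coaction_mult, (rule lin dual_lin | assumption)+)
    also have "\<dots> = tensor_lift K ?K (comult H h) (\<lambda>h1 h2. tensor_lift K ?K (comult H x) (\<lambda>x1 x2.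
        l (x2 \<otimes>\<^bsub>H\<^esub> h2) \<otimes>\<^bsub>K\<^esub> l' (x1 \<otimes>\<^bsub>H\<^esub> h1)))"
      by (rule lift_swap, (rule lin dual_lin | assumption)+)
    also have "\<dots> = tensor_lift K ?K (comult H h) (\<lambda>h1 h2. tensor_lift K ?K (comult H x) (\<lambda>x1 x2.
        dual_action H h2 l x2 \<otimes>\<^bsub>K\<^esub> dual_action H h1 l' x1))"
      by (rule comult_cong, (rule lin dual_lin)+, rule comult_cong, (rule lin dual_lin)+,
          simp add: dual_action_eval, (rule lin dual_lin | assumption)+)
    also have "\<dots> = tensor_lift K ?K (comult H h) (\<lambda>h1 h2. (dual_action H h2 l \<otimes>\<^bsub>D\<^esub> dual_action H h1 l') x)"
      by (rule comult_cong, (rule lin dual_lin)+, simp add: dual_mult_eval[OF x], (rule lin dual_lin | assumption)+)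
    also have "\<dots> = tensor_lift K D (comult H h) (\<lambda>h1 h2. dual_action H h2 l \<otimes>\<^bsub>D\<^esub> dual_action H h1 l') x"
      by (rule hom_lift[where f = "\<lambda>u. u x", OF is_vectorspace is_vectorspace _ dual_vectorspace self_vectorspace
            dual_eval_hom[OF x], symmetric], (rule lin dual_lin | assumption)+)
    finally show "dual_action H h (l \<otimes>\<^bsub>D\<^esub> l') x
      = tensor_lift K D (comult H h) (\<lambda>h1 h2. dual_action H h2 l \<otimes>\<^bsub>D\<^esub> dual_action H h1 l') x" .
  qed
  show ?thesis
  proof (intro left_module_algebra.intro left_module_algebra_axioms.intro dual_unital_algebra bil)
    show "bialgebra K H" by unfold_locales
    fix g h l assume *: "g \<in> carrier H" "h \<in> carrier H" "l \<in> carrier D"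
    then show "dual_action H (g \<otimes>\<^bsub>H\<^esub> h) l = dual_action H g (dual_action H h l)"
      by (intro dual_eqI) (simp_all add: dual_action_closed dual_action_eval alg.m_assoc)
  next
    fix l assume "l \<in> carrier D"
    then show "dual_action H \<one>\<^bsub>H\<^esub> l = l"
      by (intro dual_eqI) (simp_all add: dual_action_closed dual_action_eval)
  next
    fix h assume h: "h \<in> carrier H"
    then have "counit H h \<odot>\<^bsub>D\<^esub> \<one>\<^bsub>D\<^esub> \<in> carrier D"
      by (intro D.smult_closed counit_closed dual_one_closed)
    then show "dual_action H h \<one>\<^bsub>D\<^esub> = counit H h \<odot>\<^bsub>D\<^esub> \<one>\<^bsub>D\<^esub>"
      using h by (intro dual_eqI) (simp_all add: dual_action_closed dual_one_closed dual_action_eval dual_one_eval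
          dual_smult_eval counit_mult counit_closed R.m_comm)
  qed (rule prod)
qed

lemma dual_basis:
  assumes "fin_dim"
  obtains B and c :: "'h \<Rightarrow> 'h \<Rightarrow> 'k" where "finite B" "B \<subseteq> carrier H" "\<And>b. b \<in> B \<Longrightarrow> c b \<in> carrier D"
    "\<And>x. x \<in> carrier H \<Longrightarrow> x = (\<Oplus>\<^bsub>H\<^esub>b\<in>B. c b x \<odot>\<^bsub>H\<^esub> b)"
proof -
  obtain B where B: "finite B" "basis B" using finite_basis_exists[OF assms] by blast
  then have BH: "B \<subseteq> carrier H" by (simp add: basis_def)
  have ex1: "\<exists>!a. a \<in> B \<rightarrow>\<^sub>E carrier K \<and> lincomb a B = v" if "v \<in> carrier H" for v
    using basis_criterion[OF B(1) BH] B(2) that by blast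
  define coord where "coord v = (THE a. a \<in> B \<rightarrow>\<^sub>E carrier K \<and> lincomb a B = v)" for v
  have coord: "coord v \<in> B \<rightarrow>\<^sub>E carrier K" "lincomb (coord v) B = v" if "v \<in> carrier H" for v
    using theI'[OF ex1[OF that]] unfolding coord_def by auto
  have coordI: "coord v = a" if "a \<in> B \<rightarrow>\<^sub>E carrier K" "lincomb a B = v" for a v
  proof -
    have "v \<in> carrier H" using that BH by (auto intro!: lincomb_closed)
    then show ?thesis using ex1 coord that by blast
  qed
  define c where "c b = (\<lambda>v\<in>carrier H. coord v b)" for b
  have cK: "coord v b \<in> carrier K" if "v \<in> carrier H" "b \<in> B" for v b using coord(1)[OF that(1)] that(2) by auto
  have bH: "b \<in> carrier H" if "b \<in> B" for b using that BH by auto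
  have sum: "v = (\<Oplus>\<^bsub>H\<^esub>b\<in>B. coord v b \<odot>\<^bsub>H\<^esub> b)" if "v \<in> carrier H" for v
    using coord(2)[OF that] unfolding lincomb_def by simp
  have add: "coord (v \<oplus>\<^bsub>H\<^esub> w) = (\<lambda>b\<in>B. coord v b \<oplus>\<^bsub>K\<^esub> coord w b)" if v: "v \<in> carrier H" and w: "w \<in> carrier H" for v w
  proof (rule coordI)
    show "(\<lambda>b\<in>B. coord v b \<oplus>\<^bsub>K\<^esub> coord w b) \<in> B \<rightarrow>\<^sub>E carrier K" using cK v w by auto
    have "lincomb (\<lambda>b\<in>B. coord v b \<oplus>\<^bsub>K\<^esub> coord w b) B = (\<Oplus>\<^bsub>H\<^esub>b\<in>B. coord v b \<odot>\<^bsub>H\<^esub> b \<oplus>\<^bsub>H\<^esub> coord w b \<odot>\<^bsub>H\<^esub> b)"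
      unfolding lincomb_def using cK[OF v] cK[OF w] bH
      by (intro M.finsum_cong') (auto simp: smult_l_distr)
    also have "\<dots> = v \<oplus>\<^bsub>H\<^esub> w"
      using cK[OF v] cK[OF w] bH by (subst M.finsum_addf) (auto simp: sum[OF v, symmetric] sum[OF w, symmetric])
    finally show "lincomb (\<lambda>b\<in>B. coord v b \<oplus>\<^bsub>K\<^esub> coord w b) B = v \<oplus>\<^bsub>H\<^esub> w" .
  qed
  have smult: "coord (a \<odot>\<^bsub>H\<^esub> v) = (\<lambda>b\<in>B. a \<otimes>\<^bsub>K\<^esub> coord v b)" if v: "v \<in> carrier H" and a: "a \<in> carrier K" for a v
  proof (rule coordI)
    show "(\<lambda>b\<in>B. a \<otimes>\<^bsub>K\<^esub> coord v b) \<in> B \<rightarrow>\<^sub>E carrier K" using cK v a by auto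
    have "lincomb (\<lambda>b\<in>B. a \<otimes>\<^bsub>K\<^esub> coord v b) B = (\<Oplus>\<^bsub>H\<^esub>b\<in>B. a \<odot>\<^bsub>H\<^esub> (coord v b \<odot>\<^bsub>H\<^esub> b))"
      unfolding lincomb_def using cK[OF v] a bH
      by (intro M.finsum_cong') (auto simp: smult_assoc1)
    also have "\<dots> = a \<odot>\<^bsub>H\<^esub> (\<Oplus>\<^bsub>H\<^esub>b\<in>B. coord v b \<odot>\<^bsub>H\<^esub> b)"
      using cK[OF v] a bH by (intro finsum_smult[symmetric]) auto
    finally show "lincomb (\<lambda>b\<in>B. a \<otimes>\<^bsub>K\<^esub> coord v b) B = a \<odot>\<^bsub>H\<^esub> v" using sum[OF v] by simp
  qed
  have "c b \<in> carrier D" if "b \<in> B" for b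
    unfolding c_def using that cK
    by (intro restrict_dual homI) (auto simp: self_space_simps add smult)
  moreover have "x = (\<Oplus>\<^bsub>H\<^esub>b\<in>B. c b x \<odot>\<^bsub>H\<^esub> b)" if "x \<in> carrier H" for x
    using sum[OF that] that by (simp add: c_def)
  ultimately show thesis using that[OF B(1) BH] by blast
qed

text \<open>
  The coordinates of a tensor with respect to a basis of \<open>H\<close> are obtained by applying the functionals
  of the dual basis.
\<close>

lemma separated_by_functionals:
  assumes fin: "fin_dim" and V: "vectorspace K V"
    and t: "t \<in> carrier (tensor K V H)" and u: "u \<in> carrier (tensor K V H)"
    and eq: "\<And>l. l \<in> carrier D \<Longrightarrow> tensor_lift K V t (\<lambda>v h. l h \<odot>\<^bsub>V\<^esub> v) = tensor_lift K V u (\<lambda>v h. l h \<odot>\<^bsub>V\<^esub> v)"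
  shows "t = u"
proof -
  obtain B c where B: "finite B" "B \<subseteq> carrier H" "\<And>b. b \<in> B \<Longrightarrow> c b \<in> carrier D"
    "\<And>x. x \<in> carrier H \<Longrightarrow> x = (\<Oplus>\<^bsub>H\<^esub>b\<in>B. c b x \<odot>\<^bsub>H\<^esub> b)"
    using dual_basis[OF fin] by blast
  note co = tensor_coordinates_right[OF V is_vectorspace, of B "\<lambda>b. b" c, OF _ dual_hom[OF B(3)] B(4)]
  interpret V: vectorspace K V by fact
  have TV: "vectorspace K (tensor K V H)" by (rule lin V is_vectorspace)+
  interpret T: vectorspace K "tensor K V H" by (rule TV)
  have "t = (\<Oplus>\<^bsub>tensor K V H\<^esub>b\<in>B. pure_tensor K V H (tensor_lift K V t (\<lambda>v x. c b x \<odot>\<^bsub>V\<^esub> v)) b)"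
    using B(2) t by (intro co) auto
  also have "\<dots> = (\<Oplus>\<^bsub>tensor K V H\<^esub>b\<in>B. pure_tensor K V H (tensor_lift K V u (\<lambda>v x. c b x \<odot>\<^bsub>V\<^esub> v)) b)"
    using B(2,3) u eq
    by (intro T.M.finsum_cong') (auto intro!: pure_tensor_closed V is_vectorspace lift_closed V.smult_closed dual_closed)
  also have "\<dots> = u" using B(2) u by (intro co[symmetric]) auto
  finally show ?thesis .
qed

text \<open>
  With a basis \<open>b\<close> and dual basis \<open>c b\<close>, any tensor with the required property has coordinate \<open>b l\<close> at
  \<open>c b\<close>, so \<open>\<Sum>\<^sub>b c b \<otimes> b l\<close> is the only candidate; it has the property because
  \<open>\<Sum>\<^sub>b c b(h') l(h b) = l(h h')\<close>.
\<close>

lemma dual_comult_props: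
  assumes fin: "fin_dim" and l: "l \<in> carrier D"
  shows dual_comult_closed: "dual_comult K H l \<in> carrier (tensor K D D)"
    and dual_comult_eval: "\<lbrakk>h \<in> carrier H; h' \<in> carrier H\<rbrakk> \<Longrightarrow>
      l (h \<otimes>\<^bsub>H\<^esub> h') = tensor_lift K (self_space K) (dual_comult K H l) (\<lambda>l1 l2. l1 h' \<otimes>\<^bsub>K\<^esub> l2 h)"
proof -
  let ?K = "self_space K"
  let ?DD = "tensor K D D"
  interpret D: vectorspace K D by (rule dual_vectorspace)
  have TD: "vectorspace K ?DD" by (rule lin dual_vectorspace)+
  interpret T: vectorspace K ?DD by (rule TD)
  interpret SK: vectorspace K ?K by (rule self_vectorspace)
  obtain B c where B: "finite B" "B \<subseteq> carrier H" "\<And>b. b \<in> B \<Longrightarrow> c b \<in> carrier D"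
    "\<And>x. x \<in> carrier H \<Longrightarrow> x = (\<Oplus>\<^bsub>H\<^esub>b\<in>B. c b x \<odot>\<^bsub>H\<^esub> b)"
    using dual_basis[OF fin] by blast
  have bH: "b \<in> carrier H" if "b \<in> B" for b using that B(2) by auto
  have expand: "l x = (\<Oplus>\<^bsub>?K\<^esub>b\<in>B. c b x \<otimes>\<^bsub>K\<^esub> l b)" if l: "l \<in> carrier D" and x: "x \<in> carrier H" for l x
  proof -
    have "l x = l (\<Oplus>\<^bsub>H\<^esub>b\<in>B. c b x \<odot>\<^bsub>H\<^esub> b)" using B(4)[OF x] by simp
    also have "\<dots> = (\<Oplus>\<^bsub>?K\<^esub>b\<in>B. l (c b x \<odot>\<^bsub>H\<^esub> b))"
      using bH dual_closed[OF B(3) x] by (intro hom_finsum[OF is_vectorspace self_vectorspace dual_hom[OF l]]) auto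
    also have "\<dots> = (\<Oplus>\<^bsub>?K\<^esub>b\<in>B. c b x \<otimes>\<^bsub>K\<^esub> l b)"
      using bH dual_closed[OF B(3) x] dual_closed[OF l] module_hom_smult[OF dual_hom[OF l]]
      by (intro SK.M.finsum_cong') (auto simp: self_space_simps)
    finally show ?thesis .
  qed
  have sum_eval: "(\<Oplus>\<^bsub>D\<^esub>b\<in>B. f b) x = (\<Oplus>\<^bsub>?K\<^esub>b\<in>B. f b x)" if "x \<in> carrier H" "f \<in> B \<rightarrow> carrier D" for f x
    using hom_finsum[OF dual_vectorspace self_vectorspace dual_eval_hom[OF that(1)] that(2)] .
  \<comment> \<open>The coordinate of \<open>m\<close> at \<open>c b\<close> is its value at \<open>b\<close>, so evaluations serve as coordinate functionals on the dual.\<close>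
  have coords: "m = (\<Oplus>\<^bsub>D\<^esub>b\<in>B. m b \<odot>\<^bsub>D\<^esub> c b)" if m: "m \<in> carrier D" for m
  proof (rule dual_eqI[OF m])
    have mem: "(\<lambda>b. m b \<odot>\<^bsub>D\<^esub> c b) \<in> B \<rightarrow> carrier D" using B(3) dual_closed[OF m] bH by auto
    then show "(\<Oplus>\<^bsub>D\<^esub>b\<in>B. m b \<odot>\<^bsub>D\<^esub> c b) \<in> carrier D" by (rule D.M.finsum_closed)
    fix x assume x: "x \<in> carrier H"
    have "(\<Oplus>\<^bsub>?K\<^esub>b\<in>B. (m b \<odot>\<^bsub>D\<^esub> c b) x) = (\<Oplus>\<^bsub>?K\<^esub>b\<in>B. c b x \<otimes>\<^bsub>K\<^esub> m b)"
      using dual_closed[OF m] bH dual_closed[OF B(3) x]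
      by (intro SK.M.finsum_cong') (auto simp: dual_smult_eval x self_space_simps R.m_comm)
    then show "m x = (\<Oplus>\<^bsub>D\<^esub>b\<in>B. m b \<odot>\<^bsub>D\<^esub> c b) x"
      using expand[OF m x] sum_eval[OF x mem] by simp
  qed
  have bil: "bilinear K D D ?K (\<lambda>l1 l2. l1 h' \<otimes>\<^bsub>K\<^esub> l2 h)" if "h \<in> carrier H" "h' \<in> carrier H" for h h'
    using that by - (rule bilinearI, (rule lin dual_lin dual_eval_hom | assumption)+)
  have bilD: "bilinear K D D D (\<lambda>l1 l2. l1 h \<odot>\<^bsub>D\<^esub> l2)" if h: "h \<in> carrier H" for h
    using dual_closed[OF _ h]
    by (intro bilinearI hom_scalar[OF dual_vectorspace dual_eval_hom[OF h]] hom_smult[OF dual_vectorspace _ hom_id])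
  define good where "good t \<longleftrightarrow> t \<in> carrier ?DD \<and>
     (\<forall>h\<in>carrier H. \<forall>h'\<in>carrier H. l (h \<otimes>\<^bsub>H\<^esub> h') = tensor_lift K ?K t (\<lambda>l1 l2. l1 h' \<otimes>\<^bsub>K\<^esub> l2 h))" for t
  have exists: "good (\<Oplus>\<^bsub>?DD\<^esub>b\<in>B. pure_tensor K D D (c b) (dual_action H b l))"
    unfolding good_def
  proof (intro conjI ballI)
    have mem: "(\<lambda>b. pure_tensor K D D (c b) (dual_action H b l)) \<in> B \<rightarrow> carrier ?DD"
      using B(3) bH by (auto intro!: pure_tensor_closed dual_vectorspace dual_action_closed l)
    then show "(\<Oplus>\<^bsub>?DD\<^esub>b\<in>B. pure_tensor K D D (c b) (dual_action H b l)) \<in> carrier ?DD" by (rule T.M.finsum_closed)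
    fix h h' assume h: "h \<in> carrier H" and h': "h' \<in> carrier H"
    \<comment> \<open>With \<open>h\<close> fixed, both sides are the functional \<open>m\<close> at \<open>h'\<close>: directly, and expanded in the dual basis.\<close>
    define m where "m = (\<lambda>x\<in>carrier H. l (h \<otimes>\<^bsub>H\<^esub> x))"
    have m: "m \<in> carrier D" unfolding m_def using h
      by - (rule restrict_dual, (rule lin dual_lin hom_compose[OF dual_hom[OF l]] | assumption)+)
    have "tensor_lift K ?K (\<Oplus>\<^bsub>?DD\<^esub>b\<in>B. pure_tensor K D D (c b) (dual_action H b l)) (\<lambda>l1 l2. l1 h' \<otimes>\<^bsub>K\<^esub> l2 h)
      = (\<Oplus>\<^bsub>?K\<^esub>b\<in>B. tensor_lift K ?K (pure_tensor K D D (c b) (dual_action H b l)) (\<lambda>l1 l2. l1 h' \<otimes>\<^bsub>K\<^esub> l2 h))"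
      by (rule hom_finsum[OF TD self_vectorspace lift_hom[OF dual_vectorspace dual_vectorspace self_vectorspace bil[OF h h']] mem])
    also have "\<dots> = (\<Oplus>\<^bsub>?K\<^esub>b\<in>B. c b h' \<otimes>\<^bsub>K\<^esub> m b)"
      using B(3) bH h h' dual_closed[OF B(3) h'] dual_closed[OF l]
      by (intro SK.M.finsum_cong')
        (auto simp: self_space_simps m_def dual_action_eval dual_action_closed l
          lift_pure[OF dual_vectorspace dual_vectorspace self_vectorspace bil[OF h h']])
    also have "\<dots> = m h'" by (rule expand[OF m h', symmetric])
    finally show "l (h \<otimes>\<^bsub>H\<^esub> h') = tensor_lift K ?K (\<Oplus>\<^bsub>?DD\<^esub>b\<in>B. pure_tensor K D D (c b) (dual_action H b l)) (\<lambda>l1 l2. l1 h' \<otimes>\<^bsub>K\<^esub> l2 h)"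
      by (simp add: m_def h')
  qed
  have unique: "t = (\<Oplus>\<^bsub>?DD\<^esub>b\<in>B. pure_tensor K D D (c b) (dual_action H b l))" if t: "good t" for t
  proof -
    have tDD: "t \<in> carrier ?DD" using t by (simp add: good_def)
    have w: "tensor_lift K D t (\<lambda>l1 l2. l1 b \<odot>\<^bsub>D\<^esub> l2) = dual_action H b l" if b: "b \<in> B" for b
    proof (rule dual_eqI)
      show "tensor_lift K D t (\<lambda>l1 l2. l1 b \<odot>\<^bsub>D\<^esub> l2) \<in> carrier D"
        by (rule hom_closed[OF lift_hom[OF dual_vectorspace dual_vectorspace dual_vectorspace bilD[OF bH[OF b]]] tDD])
      show "dual_action H b l \<in> carrier D" by (rule dual_action_closed[OF bH[OF b] l])
      fix h assume h: "h \<in> carrier H"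
      have "tensor_lift K D t (\<lambda>l1 l2. l1 b \<odot>\<^bsub>D\<^esub> l2) h = tensor_lift K ?K t (\<lambda>l1 l2. (l1 b \<odot>\<^bsub>D\<^esub> l2) h)"
        using bilinear_closed[OF bilD[OF bH[OF b]]]
        by (rule hom_lift[where f = "\<lambda>u. u h", OF dual_vectorspace dual_vectorspace tDD dual_vectorspace self_vectorspace dual_eval_hom[OF h]])
      also have "\<dots> = l (h \<otimes>\<^bsub>H\<^esub> b)" using t h bH[OF b] by (simp add: good_def dual_smult_eval)
      finally show "tensor_lift K D t (\<lambda>l1 l2. l1 b \<odot>\<^bsub>D\<^esub> l2) h = dual_action H b l h"
        by (simp add: dual_action_eval h)
    qed
    have "t = (\<Oplus>\<^bsub>?DD\<^esub>b\<in>B. pure_tensor K D D (c b) (tensor_lift K D t (\<lambda>l1 l2. l1 b \<odot>\<^bsub>D\<^esub> l2)))"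
      using bH B(3) coords tDD
      by (intro tensor_coordinates_left[OF dual_vectorspace dual_vectorspace, where c = "\<lambda>b l. l b"] dual_eval_hom) auto
    also have "\<dots> = (\<Oplus>\<^bsub>?DD\<^esub>b\<in>B. pure_tensor K D D (c b) (dual_action H b l))"
      using B(3) bH by (intro T.M.finsum_cong') (auto simp: w intro!: pure_tensor_closed dual_vectorspace dual_action_closed l)
    finally show ?thesis .
  qed
  have "dual_comult K H l = (THE t. good t)" by (simp add: dual_comult_def good_def)
  then have "good (dual_comult K H l)" using theI[of good, OF exists unique] by simp
  then show "dual_comult K H l \<in> carrier ?DD"
    "\<lbrakk>h \<in> carrier H; h' \<in> carrier H\<rbrakk> \<Longrightarrow>
      l (h \<otimes>\<^bsub>H\<^esub> h') = tensor_lift K ?K (dual_comult K H l) (\<lambda>l1 l2. l1 h' \<otimes>\<^bsub>K\<^esub> l2 h)"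
    by (simp_all add: good_def)
qed

text \<open>
  This eliminates the comultiplication of the dual from the braidings, which use it in the
  combination \<open>l\<^sub>(\<^sub>1\<^sub>)(h) l\<^sub>(\<^sub>2\<^sub>)\<close> only.
\<close>

lemma lift_dual_comult:
  assumes fin: "fin_dim" and l: "l \<in> carrier D" and h: "h \<in> carrier H"
    and U: "vectorspace K U" and g: "g \<in> module_hom K D U"
  shows "tensor_lift K U (dual_comult K H l) (\<lambda>l1 l2. l1 h \<odot>\<^bsub>U\<^esub> g l2) = g (dual_action H h l)"
proof -
  interpret D: vectorspace K D by (rule dual_vectorspace)
  interpret U: vectorspace K U by fact
  note t = dual_comult_closed[OF fin l]
  have cl: "l1 h \<odot>\<^bsub>D\<^esub> l2 \<in> carrier D" if "l1 \<in> carrier D" "l2 \<in> carrier D" for l1 l2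
    using that dual_closed[OF _ h] by simp
  have "tensor_lift K D (dual_comult K H l) (\<lambda>l1 l2. l1 h \<odot>\<^bsub>D\<^esub> l2) = dual_action H h l"
  proof (rule dual_eqI)
    show "tensor_lift K D (dual_comult K H l) (\<lambda>l1 l2. l1 h \<odot>\<^bsub>D\<^esub> l2) \<in> carrier D"
      using cl by (rule lift_closed[OF dual_vectorspace dual_vectorspace dual_vectorspace t])
    show "dual_action H h l \<in> carrier D" by (rule dual_action_closed[OF h l])
    fix x assume x: "x \<in> carrier H"
    have "tensor_lift K D (dual_comult K H l) (\<lambda>l1 l2. l1 h \<odot>\<^bsub>D\<^esub> l2) x
      = tensor_lift K (self_space K) (dual_comult K H l) (\<lambda>l1 l2. (l1 h \<odot>\<^bsub>D\<^esub> l2) x)"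
      using cl by (rule hom_lift[where f = "\<lambda>u. u x", OF dual_vectorspace dual_vectorspace t dual_vectorspace self_vectorspace dual_eval_hom[OF x]])
    then show "tensor_lift K D (dual_comult K H l) (\<lambda>l1 l2. l1 h \<odot>\<^bsub>D\<^esub> l2) x = dual_action H h l x"
      using dual_comult_eval[OF fin l x h] by (simp add: dual_smult_eval x dual_action_eval)
  qed
  then have "g (dual_action H h l) = g (tensor_lift K D (dual_comult K H l) (\<lambda>l1 l2. l1 h \<odot>\<^bsub>D\<^esub> l2))" by simp
  also have "\<dots> = tensor_lift K U (dual_comult K H l) (\<lambda>l1 l2. g (l1 h \<odot>\<^bsub>D\<^esub> l2))"
    using cl by (rule hom_lift[OF dual_vectorspace dual_vectorspace t dual_vectorspace U g])
  also have "\<dots> = tensor_lift K U (dual_comult K H l) (\<lambda>l1 l2. l1 h \<odot>\<^bsub>U\<^esub> g l2)"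
    using dual_closed[OF _ h] module_hom_smult[OF g] hom_closed[OF g]
    by (intro lift_cong[OF dual_vectorspace dual_vectorspace U t]) auto
  finally show ?thesis ..
qed

end

section \<open>The braided system of a family of Yetter-Drinfeld module algebras\<close>

lemma tagged_space_simps:
  assumes "inj_on e (carrier V)"
  shows "carrier (tagged_space e V) = e ` carrier V" "\<zero>\<^bsub>tagged_space e V\<^esub> = e \<zero>\<^bsub>V\<^esub>"
    "\<lbrakk>x \<in> carrier V; y \<in> carrier V\<rbrakk> \<Longrightarrow> e x \<oplus>\<^bsub>tagged_space e V\<^esub> e y = e (x \<oplus>\<^bsub>V\<^esub> y)"
    "x \<in> carrier V \<Longrightarrow> a \<odot>\<^bsub>tagged_space e V\<^esub> e x = e (a \<odot>\<^bsub>V\<^esub> x)"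
  by (simp_all add: tagged_space_def Let_def the_inv_into_f_f[OF assms])

lemma tagging_tagged_space:
  assumes V: "vectorspace K V" and inj: "inj_on e (carrier V)"
  shows "tagging K V e (tagged_space e V)"
proof -
  interpret V: vectorspace K V by fact
  note simps = tagged_space_simps[OF inj]
  let ?E = "tagged_space e V"
  have "vectorspace K ?E"
  proof (rule vs_criteria)
    show "field K" by unfold_locales
    show "\<forall>v\<in>carrier ?E. \<exists>w\<in>carrier ?E. v \<oplus>\<^bsub>?E\<^esub> w = \<zero>\<^bsub>?E\<^esub>"
    proof
      fix v assume "v \<in> carrier ?E"
      then obtain x where x: "x \<in> carrier V" "v = e x" by (auto simp: simps(1))
      have "v \<oplus>\<^bsub>?E\<^esub> e (\<ominus>\<^bsub>V\<^esub> x) = \<zero>\<^bsub>?E\<^esub>"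
        unfolding x(2) using x(1) V.M.r_neg[OF x(1)] by (subst simps(3)) (simp_all add: simps(2))
      then show "\<exists>w\<in>carrier ?E. v \<oplus>\<^bsub>?E\<^esub> w = \<zero>\<^bsub>?E\<^esub>"
        using x(1) by (intro bexI[of _ "e (\<ominus>\<^bsub>V\<^esub> x)"]) (auto simp: simps(1))
    qed
  next
    show "\<forall>v w. v \<in> carrier ?E \<and> w \<in> carrier ?E \<longrightarrow> v \<oplus>\<^bsub>?E\<^esub> w = w \<oplus>\<^bsub>?E\<^esub> v"
      using V.M.a_comm by (auto simp: simps)
  next
    show "\<forall>a b v. a \<in> carrier K \<and> b \<in> carrier K \<and> v \<in> carrier ?E \<longrightarrow>
      (a \<oplus>\<^bsub>K\<^esub> b) \<odot>\<^bsub>?E\<^esub> v = a \<odot>\<^bsub>?E\<^esub> v \<oplus>\<^bsub>?E\<^esub> b \<odot>\<^bsub>?E\<^esub> v"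
      using V.smult_l_distr by (auto simp: simps)
    show "\<forall>a v w. a \<in> carrier K \<and> v \<in> carrier ?E \<and> w \<in> carrier ?E \<longrightarrow>
      a \<odot>\<^bsub>?E\<^esub> (v \<oplus>\<^bsub>?E\<^esub> w) = a \<odot>\<^bsub>?E\<^esub> v \<oplus>\<^bsub>?E\<^esub> a \<odot>\<^bsub>?E\<^esub> w"
      using V.smult_r_distr by (auto simp: simps)
    show "\<forall>a b v. a \<in> carrier K \<and> b \<in> carrier K \<and> v \<in> carrier ?E \<longrightarrow>
      (a \<otimes>\<^bsub>K\<^esub> b) \<odot>\<^bsub>?E\<^esub> v = a \<odot>\<^bsub>?E\<^esub> (b \<odot>\<^bsub>?E\<^esub> v)"
      using V.smult_assoc1 by (auto simp: simps)
  qed (auto simp: simps V.M.a_assoc)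
  moreover have "e \<in> module_hom K V ?E" by (rule homI) (simp_all add: simps)
  ultimately show ?thesis by (simp add: tagging_def simps)
qed

text \<open>
  A copy carries the structure transported along the tag, so linearity of a map on it is tested on
  tagged elements.
\<close>

lemma hom_tagged:
  assumes V: "vectorspace K V" and e: "tagging K V e V'" and g: "g \<in> module_hom K V U"
    and f: "\<And>x. x \<in> carrier V \<Longrightarrow> f (e x) = g x"
  shows "f \<in> module_hom K V' U"
proof -
  interpret V: vectorspace K V by fact
  note eh = taggingD(2)[OF e]
  have tag: "\<exists>x\<in>carrier V. v = e x" if "v \<in> carrier V'" for v using taggingD(4)[OF e that] .
  show ?thesis
  proof (rule homI)
    fix v assume "v \<in> carrier V'"
    then show "f v \<in> carrier U" using tag f hom_closed[OF g] by fastforce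
  next
    fix v w assume "v \<in> carrier V'" "w \<in> carrier V'"
    then obtain x y where "x \<in> carrier V" "y \<in> carrier V" "v = e x" "w = e y" using tag by metis
    then show "f (v \<oplus>\<^bsub>V'\<^esub> w) = f v \<oplus>\<^bsub>U\<^esub> f w"
      by (simp add: module_hom_add[OF eh, symmetric] f module_hom_add[OF g])
  next
    fix a v assume a: "a \<in> carrier K" and "v \<in> carrier V'"
    then obtain x where "x \<in> carrier V" "v = e x" using tag by metis
    then show "f (a \<odot>\<^bsub>V'\<^esub> v) = a \<odot>\<^bsub>U\<^esub> f v"
      using a by (simp add: module_hom_smult[OF eh, symmetric] f module_hom_smult[OF g])
  qed
qed

lemma bilinear_tagged:
  assumes V: "vectorspace K V" and W: "vectorspace K W" and e: "tagging K V e V'" and f: "tagging K W f W'"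
    and b: "bilinear K V W U b" and \<beta>: "\<And>x y. \<lbrakk>x \<in> carrier V; y \<in> carrier W\<rbrakk> \<Longrightarrow> \<beta> (e x) (f y) = b x y"
  shows "bilinear K V' W' U \<beta>"
proof (rule bilinearI)
  fix v assume "v \<in> carrier V'"
  then obtain x where x: "x \<in> carrier V" "v = e x" using taggingD(4)[OF e] by blast
  show "(\<lambda>w. \<beta> v w) \<in> module_hom K W' U"
    by (rule hom_tagged[OF W f bilinear_right[OF b x(1)]]) (simp add: x \<beta>)
next
  fix w assume "w \<in> carrier W'"
  then obtain y where y: "y \<in> carrier W" "w = f y" using taggingD(4)[OF f] by blast
  show "(\<lambda>v. \<beta> v w) \<in> module_hom K V' U"
    by (rule hom_tagged[OF V e bilinear_left[OF b y(1)]]) (simp add: y \<beta>)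
qed

lemma restricted_lift:
  assumes V: "vectorspace K V" and W: "vectorspace K W" and e: "tagging K V e V'" and f: "tagging K W f W'"
    and U: "vectorspace K U"
    and b: "bilinear K V W U b" and \<beta>: "\<And>x y. \<lbrakk>x \<in> carrier V; y \<in> carrier W\<rbrakk> \<Longrightarrow> \<beta> (e x) (f y) = b x y"
  defines "s \<equiv> (\<lambda>t\<in>carrier (tensor K V' W'). tensor_lift K U t \<beta>)"
  shows "s \<in> module_hom K (tensor K V' W') U"
    and "\<lbrakk>x \<in> carrier V; y \<in> carrier W\<rbrakk> \<Longrightarrow> s (pure_tensor K V' W' (e x) (f y)) = b x y"
proof -
  note vs = taggingD(1)[OF e] taggingD(1)[OF f]
  have bil: "bilinear K V' W' U \<beta>" by (rule bilinear_tagged[OF V W e f b \<beta>])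
  show "s \<in> module_hom K (tensor K V' W') U" unfolding s_def
    by (rule hom_cong[OF tensor_vectorspace[OF vs] _ lift_hom[OF vs U bil]]) simp
  show "s (pure_tensor K V' W' (e x) (f y)) = b x y" if "x \<in> carrier V" "y \<in> carrier W"
    unfolding s_def using that taggingD(3)[OF e] taggingD(3)[OF f]
    by (simp add: pure_tensor_closed vs lift_pure[OF vs U bil] \<beta>)
qed

lemma crossing_bilinear:
  assumes coA: "right_comodule_algebra K H A \<rho>" and modB: "left_module_algebra K H B \<alpha>"
    and e: "tagging K A e A'" and f: "tagging K B f B'"
  shows "bilinear K A B (tensor K B' A')
    (\<lambda>x y. tensor_lift K (tensor K B' A') (\<rho> x) (\<lambda>x0 x1. pure_tensor K B' A' (f (\<alpha> x1 y)) (e x0)))"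
proof -
  interpret A: right_comodule_algebra K H A \<rho> by fact
  interpret B: left_module_algebra K H B \<alpha> by fact
  note [lin] = A.V.is_vectorspace B.V.is_vectorspace A.H.is_vectorspace taggingD(1,3)[OF e] taggingD(1,3)[OF f]
    hom_compose[OF taggingD(2)[OF e]] hom_compose[OF taggingD(2)[OF f]] B.action_lin
  show ?thesis by (rule lin A.coaction_lin | assumption)+
qed

lemma crossingI:
  assumes coA: "right_comodule_algebra K H A \<rho>" and modB: "left_module_algebra K H B \<alpha>"
    and e: "tagging K A e A'" and f: "tagging K B f B'"
    and \<beta>: "\<And>x y. \<lbrakk>x \<in> carrier A; y \<in> carrier B\<rbrakk> \<Longrightarrow> \<beta> (e x) (f y) =
      tensor_lift K (tensor K B' A') (\<rho> x) (\<lambda>x0 x1. pure_tensor K B' A' (f (\<alpha> x1 y)) (e x0))"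
  shows "crossing K A \<rho> e A' B \<alpha> f B' (\<lambda>t\<in>carrier (tensor K A' B'). tensor_lift K (tensor K B' A') t \<beta>)"
proof -
  interpret A: right_comodule_algebra K H A \<rho> by fact
  interpret B: left_module_algebra K H B \<alpha> by fact
  note rl = restricted_lift[OF A.V.is_vectorspace B.V.is_vectorspace e f
      tensor_vectorspace[OF taggingD(1)[OF f] taggingD(1)[OF e]] crossing_bilinear[OF coA modB e f] \<beta>]
  show ?thesis unfolding crossing_def using rl by simp
qed

lemma left_unit_braidingI:
  assumes A: "unital_algebra K A" and e: "tagging K A e A'"
    and \<beta>: "\<And>x y. \<lbrakk>x \<in> carrier A; y \<in> carrier A\<rbrakk> \<Longrightarrow> \<beta> (e x) (e y) = pure_tensor K A' A' (e \<one>\<^bsub>A\<^esub>) (e (x \<otimes>\<^bsub>A\<^esub> y))"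
  shows "left_unit_braiding K A e A' (\<lambda>t\<in>carrier (tensor K A' A'). tensor_lift K (tensor K A' A') t \<beta>)"
proof -
  interpret A: unital_algebra K A by fact
  note [lin] = A.is_vectorspace taggingD(1,3)[OF e] hom_compose[OF taggingD(2)[OF e]] A.mult_lin
  have bil: "bilinear K A A (tensor K A' A') (\<lambda>x y. pure_tensor K A' A' (e \<one>\<^bsub>A\<^esub>) (e (x \<otimes>\<^bsub>A\<^esub> y)))"
    by (rule lin | assumption)+
  note rl = restricted_lift[OF A.is_vectorspace A.is_vectorspace e e
      tensor_vectorspace[OF taggingD(1)[OF e] taggingD(1)[OF e]] bil \<beta>]
  show ?thesis unfolding left_unit_braiding_def using rl by simp
qed

lemma right_unit_braidingI:
  assumes A: "unital_algebra K A" and e: "tagging K A e A'"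
    and \<beta>: "\<And>x y. \<lbrakk>x \<in> carrier A; y \<in> carrier A\<rbrakk> \<Longrightarrow> \<beta> (e x) (e y) = pure_tensor K A' A' (e (x \<otimes>\<^bsub>A\<^esub> y)) (e \<one>\<^bsub>A\<^esub>)"
  shows "right_unit_braiding K A e A' (\<lambda>t\<in>carrier (tensor K A' A'). tensor_lift K (tensor K A' A') t \<beta>)"
proof -
  interpret A: unital_algebra K A by fact
  note [lin] = A.is_vectorspace taggingD(1,3)[OF e] hom_compose[OF taggingD(2)[OF e]] A.mult_lin
  have bil: "bilinear K A A (tensor K A' A') (\<lambda>x y. pure_tensor K A' A' (e (x \<otimes>\<^bsub>A\<^esub> y)) (e \<one>\<^bsub>A\<^esub>))"
    by (rule lin | assumption)+
  note rl = restricted_lift[OF A.is_vectorspace A.is_vectorspace e e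
      tensor_vectorspace[OF taggingD(1)[OF e] taggingD(1)[OF e]] bil \<beta>]
  show ?thesis unfolding right_unit_braiding_def using rl by simp
qed

lemma dual_crossing_formula:
  assumes coA: "right_comodule_algebra K H A \<rho>" and fin: "vectorspace.fin_dim K H"
    and e: "tagging K A e A'" and f: "tagging K (dual_space K H) f D'"
    and x: "x \<in> carrier A" and l: "l \<in> carrier (dual_space K H)"
  defines "T \<equiv> tensor K D' A'"
  shows "tensor_lift K T (dual_comult K H l) (\<lambda>l1 l2. tensor_lift K T (\<rho> x) (\<lambda>x0 x1.
      l1 x1 \<odot>\<^bsub>T\<^esub> pure_tensor K D' A' (f l2) (e x0)))
    = tensor_lift K T (\<rho> x) (\<lambda>x0 x1. pure_tensor K D' A' (f (dual_action H x1 l)) (e x0))"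
proof -
  interpret A: right_comodule_algebra K H A \<rho> by fact
  note [lin] = A.V.is_vectorspace A.H.is_vectorspace A.H.dual_vectorspace taggingD(1,3)[OF e] taggingD(1,3)[OF f]
    hom_compose[OF taggingD(2)[OF e]] hom_compose[OF taggingD(2)[OF f]] A.H.dual_action_closed
  have T [lin]: "vectorspace K T" unfolding T_def by (rule lin)+
  interpret T: vectorspace K T by (rule T)
  have P: "pure_tensor K D' A' (f l2) (e x0) \<in> carrier T" if "l2 \<in> carrier (dual_space K H)" "x0 \<in> carrier A" for l2 x0
    unfolding T_def using that by - (rule lin | assumption)+
  have "tensor_lift K T (dual_comult K H l) (\<lambda>l1 l2. tensor_lift K T (\<rho> x) (\<lambda>x0 x1.
      l1 x1 \<odot>\<^bsub>T\<^esub> pure_tensor K D' A' (f l2) (e x0)))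
    = tensor_lift K T (\<rho> x) (\<lambda>x0 x1. tensor_lift K T (dual_comult K H l) (\<lambda>l1 l2.
      l1 x1 \<odot>\<^bsub>T\<^esub> pure_tensor K D' A' (f l2) (e x0)))"
    by (rule lift_swap[OF A.H.dual_vectorspace A.H.dual_vectorspace A.H.dual_comult_closed[OF fin l]
          A.V.is_vectorspace A.H.is_vectorspace hom_closed[OF A.coaction_linear x] T])
      (auto intro!: T.smult_closed A.H.dual_closed P)
  also have "\<dots> = tensor_lift K T (\<rho> x) (\<lambda>x0 x1. pure_tensor K D' A' (f (dual_action H x1 l)) (e x0))"
    using l by - (rule A.coaction_cong[OF x T], rule A.H.lift_dual_comult[OF fin l, where g = "\<lambda>u. pure_tensor K D' A' (f u) (e _)"],
      unfold T_def, (rule lin | assumption)+)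
  finally show ?thesis .
qed

text \<open>
  The object of the braided category attached to a family; \<open>M\<^sub>i\<close> sits at position \<open>i + 1\<close>.
\<close>

locale yd_family = bialgebra K H
  for K :: "('k, 'r) ring_scheme" and H :: "('k, 'h) bialgebra" +
  fixes r :: nat and M :: "nat \<Rightarrow> ('k, 'h, 'v) yd_algebra"
  assumes fin: "vectorspace.fin_dim K H"
    and yd: "\<And>i. i \<in> {1..r} \<Longrightarrow> yd_module_algebra K H (M i)"
begin

abbreviation V where "V i \<equiv> ibr_space K H r M i"
abbreviation s where "s i j \<equiv> braid (ibr_obj K H r M) (i, j)"

lemma mid: "\<lbrakk>2 \<le> i; i \<le> r + 1\<rbrakk> \<Longrightarrow> yd_module_algebra K H (M (i - 1))"
  by (rule yd) auto

lemma position_cases: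
  assumes "1 \<le> i" "i \<le> r + 2"
  obtains "i = 1" | "2 \<le> i" "i \<le> r + 1" | "i = r + 2"
  using assms by linarith

lemma tag_H: "tagging K H InH (V 1)"
  unfolding ibr_space_def using is_vectorspace by (simp add: tagging_tagged_space inj_on_def)

lemma tag_D: "tagging K D InD (V (r + 2))"
  unfolding ibr_space_def using dual_vectorspace by (simp add: tagging_tagged_space inj_on_def)

lemma tag_M:
  assumes "2 \<le> i" "i \<le> r + 1"
  shows "tagging K (M (i - 1)) InM (V i)"
proof -
  interpret yd_module_algebra K H "M (i - 1)" using mid[OF assms] .
  show ?thesis unfolding ibr_space_def using M.is_vectorspace assms
    by (simp add: tagging_tagged_space inj_on_def)
qed

lemma s_eq:
  assumes "1 \<le> i" "i \<le> j" "j \<le> r + 2"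
  shows "s i j = (\<lambda>t\<in>carrier (tensor K (V i) (V j)).
         tensor_lift K (tensor K (V j) (V i)) t (ibr_braid_pure K H r M i j))"
  using assms by (simp add: ibr_obj_def)

lemma coM: "\<lbrakk>2 \<le> i; i \<le> r + 1\<rbrakk> \<Longrightarrow> right_comodule_algebra K H (M (i - 1)) (coact (M (i - 1)))"
  by (rule yd_module_algebra.right_comodule_algebra[OF mid])

lemma modM: "\<lbrakk>2 \<le> i; i \<le> r + 1\<rbrakk> \<Longrightarrow> left_module_algebra K H (M (i - 1)) (act (M (i - 1)))"
  by (rule yd_module_algebra.left_module_algebra[OF mid])

lemma crossing_HM:
  assumes j: "2 \<le> j" "j \<le> r + 1"
  shows "crossing K H (comult H) InH (V 1) (M (j - 1)) (act (M (j - 1))) InM (V j) (s 1 j)"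
proof -
  have "1 \<le> j" "j \<le> r + 2" using j by auto
  then show ?thesis unfolding s_eq[OF order_refl \<open>1 \<le> j\<close> \<open>j \<le> r + 2\<close>]
    by (intro crossingI[OF right_comodule_algebra_self modM[OF j] tag_H tag_M[OF j]])
      (simp add: ibr_braid_pure_def Let_def)
qed

lemma crossing_HD: "crossing K H (comult H) InH (V 1) D (dual_action H) InD (V (r + 2)) (s 1 (r + 2))"
proof -
  have r: "1 \<le> r + 2" "r + 2 \<le> r + 2" by auto
  show ?thesis unfolding s_eq[OF order_refl r]
    by (rule crossingI[OF right_comodule_algebra_self dual_left_module_algebra tag_H tag_D])
      (simp only: ibr_braid_pure_def Let_def prod.case summand.case
        dual_crossing_formula[OF right_comodule_algebra_self fin tag_H tag_D])
qed

lemma crossing_MD: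
  assumes i: "2 \<le> i" "i \<le> r + 1"
  shows "crossing K (M (i - 1)) (coact (M (i - 1))) InM (V i) D (dual_action H) InD (V (r + 2)) (s i (r + 2))"
proof -
  have r: "1 \<le> i" "i \<le> r + 2" "r + 2 \<le> r + 2" using i by auto
  show ?thesis unfolding s_eq[OF r]
    by (rule crossingI[OF coM[OF i] dual_left_module_algebra tag_M[OF i] tag_D])
      (simp only: ibr_braid_pure_def Let_def prod.case summand.case
        dual_crossing_formula[OF coM[OF i] fin tag_M[OF i] tag_D])
qed

lemma crossing_MM:
  assumes i: "2 \<le> i" "i \<le> r + 1" and j: "2 \<le> j" "j \<le> r + 1" and "i < j"
  shows "crossing K (M (i - 1)) (coact (M (i - 1))) InM (V i) (M (j - 1)) (act (M (j - 1))) InM (V j) (s i j)"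
proof -
  have r: "1 \<le> i" "i \<le> j" "j \<le> r + 2" using assms by auto
  show ?thesis unfolding s_eq[OF r]
    using \<open>i < j\<close> by (intro crossingI[OF coM[OF i] modM[OF j] tag_M[OF i] tag_M[OF j]])
      (simp add: ibr_braid_pure_def Let_def)
qed

lemma unit_H: "right_unit_braiding K H InH (V 1) (s 1 1)"
proof -
  have r: "1 \<le> r + 2" by auto
  have "unital_algebra K H" by unfold_locales
  then show ?thesis unfolding s_eq[OF order_refl order_refl r]
    by (rule right_unit_braidingI[OF _ tag_H]) (simp add: ibr_braid_pure_def Let_def)
qed

lemma unit_M:
  assumes i: "2 \<le> i" "i \<le> r + 1"
  shows "left_unit_braiding K (M (i - 1)) InM (V i) (s i i)"
proof -
  interpret yd_module_algebra K H "M (i - 1)" by (rule mid[OF i])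
  have r: "1 \<le> i" "i \<le> r + 2" using i by auto
  have "unital_algebra K (M (i - 1))" by unfold_locales
  then show ?thesis unfolding s_eq[OF r(1) order_refl r(2)]
    by (rule left_unit_braidingI[OF _ tag_M[OF i]]) (simp add: ibr_braid_pure_def Let_def)
qed

lemma unit_D: "left_unit_braiding K D InD (V (r + 2)) (s (r + 2) (r + 2))"
proof -
  have r: "1 \<le> r + 2" by auto
  show ?thesis unfolding s_eq[OF r order_refl order_refl]
    by (rule left_unit_braidingI[OF dual_unital_algebra tag_D]) (simp add: ibr_braid_pure_def Let_def)
qed

lemma space_obj: "space (ibr_obj K H r M) i = V i"
  by (simp add: ibr_obj_def)

lemma V_vectorspace:
  assumes "1 \<le> i" "i \<le> r + 2"
  shows "vectorspace K (V i)"
  using assms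
proof (rule position_cases)
  assume "i = 1"
  show ?thesis unfolding \<open>i = 1\<close> by (rule taggingD(1)[OF tag_H])
next
  assume "2 \<le> i" "i \<le> r + 1"
  show ?thesis by (rule taggingD(1)[OF tag_M]) fact+
next
  assume "i = r + 2"
  show ?thesis unfolding \<open>i = r + 2\<close> by (rule taggingD(1)[OF tag_D])
qed

lemmas s_homs = crossing_HM[unfolded crossing_def, THEN conjunct1]
  crossing_HD[unfolded crossing_def, THEN conjunct1]
  crossing_MM[unfolded crossing_def, THEN conjunct1]
  crossing_MD[unfolded crossing_def, THEN conjunct1]
  unit_H[unfolded right_unit_braiding_def, THEN conjunct1]
  unit_M[unfolded left_unit_braiding_def, THEN conjunct1]
  unit_D[unfolded left_unit_braiding_def, THEN conjunct1]

lemma s_hom: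
  assumes "1 \<le> i" "i \<le> j" "j \<le> r + 2"
  shows "s i j \<in> module_hom K (tensor K (V i) (V j)) (tensor K (V j) (V i))"
proof -
  have i: "1 \<le> i" "i \<le> r + 2" using assms by auto
  show ?thesis
  proof (cases "i = j")
    case True
    show ?thesis unfolding True[symmetric] using i
    proof (rule position_cases)
      assume "i = 1"
      show "s i i \<in> module_hom K (tensor K (V i) (V i)) (tensor K (V i) (V i))"
        unfolding \<open>i = 1\<close> by (rule s_homs(5))
    next
      assume im: "2 \<le> i" "i \<le> r + 1"
      show "s i i \<in> module_hom K (tensor K (V i) (V i)) (tensor K (V i) (V i))"
        by (rule s_homs(6)[OF im])
    next
      assume "i = r + 2"
      show "s i i \<in> module_hom K (tensor K (V i) (V i)) (tensor K (V i) (V i))"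
        unfolding \<open>i = r + 2\<close> by (rule s_homs(7))
    qed
  next
    case False
    then have ij: "i < j" using assms(2) by simp
    have "i = 1 \<or> 2 \<le> i" "i \<le> r + 1" using ij assms by auto
    moreover have "j \<le> r + 1 \<or> j = r + 2" "2 \<le> j" using ij assms by auto
    ultimately consider "i = 1" "2 \<le> j" "j \<le> r + 1" | "i = 1" "j = r + 2"
      | "2 \<le> i" "i \<le> r + 1" "2 \<le> j" "j \<le> r + 1" | "2 \<le> i" "i \<le> r + 1" "j = r + 2" by blast
    then show ?thesis
    proof cases
      case 1 show ?thesis unfolding 1(1) by (rule s_homs(1)[OF 1(2,3)])
    next
      case 2 show ?thesis unfolding 2 by (rule s_homs(2))
    next
      case 3 show ?thesis by (rule s_homs(3)[OF 3 ij])
    next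
      case 4 show ?thesis unfolding 4(3) by (rule s_homs(4)[OF 4(1,2)])
    qed
  qed
qed

lemma yang_baxter:
  assumes "1 \<le> i" "i \<le> j" "j \<le> k" "k \<le> r + 2"
  shows "yang_baxter K (ibr_obj K H r M) i j k"
proof -
  note sp = space_obj
  have i: "1 \<le> i" "i \<le> r + 2" and j: "1 \<le> j" "j \<le> r + 2" and k: "1 \<le> k" "k \<le> r + 2" using assms by auto
  note coH = right_comodule_algebra_self and modD = dual_left_module_algebra
  have algH: "unital_algebra K H" by unfold_locales
  have algM: "unital_algebra K (M (i - 1))" if "2 \<le> i" "i \<le> r + 1" for i
    using yd_module_algebra.axioms(2)[OF mid[OF that]] .
  consider "i < j" "j < k" | "i = j" "j < k" | "i < j" "j = k" | "i = j" "j = k" using assms(2,3) by linarith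
  then show ?thesis
  proof cases
    case 1
    have jm: "2 \<le> j" "j \<le> r + 1" using 1 i k by auto
    note yb = yang_baxter_distinct[OF sp sp sp refl refl refl _ mid[OF jm] _ _ tag_M[OF jm]]
    show ?thesis using i
    proof (rule position_cases)
      assume "i = 1"
      show ?thesis using k
      proof (rule position_cases)
        assume km: "2 \<le> k" "k \<le> r + 1"
        show ?thesis unfolding \<open>i = 1\<close>
          by (rule yb[OF coH modM[OF km] tag_H tag_M[OF km] crossing_HM[OF jm] crossing_HM[OF km] crossing_MM[OF jm km 1(2)]])
      next
        assume "k = r + 2"
        show ?thesis unfolding \<open>i = 1\<close> \<open>k = r + 2\<close>
          by (rule yb[OF coH modD tag_H tag_D crossing_HM[OF jm] crossing_HD crossing_MD[OF jm]])
      qed (use 1 j in auto)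
    next
      assume im: "2 \<le> i" "i \<le> r + 1"
      show ?thesis using k
      proof (rule position_cases)
        assume km: "2 \<le> k" "k \<le> r + 1"
        show ?thesis
          by (rule yb[OF coM[OF im] modM[OF km] tag_M[OF im] tag_M[OF km] crossing_MM[OF im jm 1(1)]
                crossing_MM[OF im km less_trans[OF 1]] crossing_MM[OF jm km 1(2)]])
      next
        assume "k = r + 2"
        show ?thesis unfolding \<open>k = r + 2\<close>
          by (rule yb[OF coM[OF im] modD tag_M[OF im] tag_D crossing_MM[OF im jm 1(1)] crossing_MD[OF im] crossing_MD[OF jm]])
      qed (use 1 j in auto)
    qed (use 1 jm in auto)
  next
    case 2
    note yb = yang_baxter_unit_crossing[OF sp sp refl refl]
    show ?thesis unfolding \<open>i = j\<close> using j
    proof (rule position_cases)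
      assume "j = 1"
      show "yang_baxter K (ibr_obj K H r M) j j k" using k
      proof (rule position_cases)
        assume km: "2 \<le> k" "k \<le> r + 1"
        show ?thesis unfolding \<open>j = 1\<close>
          by (rule yb[OF coH modM[OF km] tag_H tag_M[OF km] disjI2[OF unit_H] crossing_HM[OF km]])
      next
        assume "k = r + 2"
        show ?thesis unfolding \<open>j = 1\<close> \<open>k = r + 2\<close>
          by (rule yb[OF coH modD tag_H tag_D disjI2[OF unit_H] crossing_HD])
      qed (use 2 j in auto)
    next
      assume jm: "2 \<le> j" "j \<le> r + 1"
      show "yang_baxter K (ibr_obj K H r M) j j k" using k
      proof (rule position_cases)
        assume km: "2 \<le> k" "k \<le> r + 1"
        show ?thesis
          by (rule yb[OF coM[OF jm] modM[OF km] tag_M[OF jm] tag_M[OF km] disjI1[OF unit_M[OF jm]] crossing_MM[OF jm km 2(2)]])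
      next
        assume "k = r + 2"
        show ?thesis unfolding \<open>k = r + 2\<close>
          by (rule yb[OF coM[OF jm] modD tag_M[OF jm] tag_D disjI1[OF unit_M[OF jm]] crossing_MD[OF jm]])
      qed (use 2 j in auto)
    qed (use 2 k in auto)
  next
    case 3
    note yb = yang_baxter_crossing_left_unit[OF sp sp refl refl]
    show ?thesis unfolding \<open>j = k\<close>[symmetric] using i
    proof (rule position_cases)
      assume "i = 1"
      show "yang_baxter K (ibr_obj K H r M) i j j" using j
      proof (rule position_cases)
        assume jm: "2 \<le> j" "j \<le> r + 1"
        show ?thesis unfolding \<open>i = 1\<close>
          by (rule yb[OF coH modM[OF jm] tag_H tag_M[OF jm] unit_M[OF jm] crossing_HM[OF jm]])
      next
        assume "j = r + 2"
        show ?thesis unfolding \<open>i = 1\<close> \<open>j = r + 2\<close>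
          by (rule yb[OF coH modD tag_H tag_D unit_D crossing_HD])
      qed (use 3 i in auto)
    next
      assume im: "2 \<le> i" "i \<le> r + 1"
      show "yang_baxter K (ibr_obj K H r M) i j j" using j
      proof (rule position_cases)
        assume jm: "2 \<le> j" "j \<le> r + 1"
        show ?thesis
          by (rule yb[OF coM[OF im] modM[OF jm] tag_M[OF im] tag_M[OF jm] unit_M[OF jm] crossing_MM[OF im jm 3(1)]])
      next
        assume "j = r + 2"
        show ?thesis unfolding \<open>j = r + 2\<close>
          by (rule yb[OF coM[OF im] modD tag_M[OF im] tag_D unit_D crossing_MD[OF im]])
      qed (use 3 i in auto)
    qed (use 3 j in auto)
  next
    case 4
    show ?thesis unfolding \<open>i = j\<close> \<open>j = k\<close> using k
    proof (rule position_cases)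
      assume "k = 1"
      show "yang_baxter K (ibr_obj K H r M) k k k" unfolding \<open>k = 1\<close>
        by (rule yang_baxter_right_unit[OF sp refl algH tag_H unit_H])
    next
      assume km: "2 \<le> k" "k \<le> r + 1"
      show "yang_baxter K (ibr_obj K H r M) k k k"
        by (rule yang_baxter_left_unit[OF sp refl algM[OF km] tag_M[OF km] unit_M[OF km]])
    next
      assume "k = r + 2"
      show "yang_baxter K (ibr_obj K H r M) k k k" unfolding \<open>k = r + 2\<close>
        by (rule yang_baxter_left_unit[OF sp refl dual_unital_algebra tag_D unit_D])
    qed
  qed
qed

lemma braided_system_ibr: "braided_system K (r + 2) (ibr_obj K H r M)"
  unfolding braided_system_def
proof (intro conjI ballI allI impI)
  show "space (ibr_obj K H r M) \<in> extensional {1..r + 2}" by (simp add: ibr_obj_def ibr_space_def)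
  show "vectorspace K (space (ibr_obj K H r M) i)" if "i \<in> {1..r + 2}" for i
    using V_vectorspace that by (simp add: space_obj)
  show "yang_baxter K (ibr_obj K H r M) i j k" if "1 \<le> i \<and> i \<le> j \<and> j \<le> k \<and> k \<le> r + 2" for i j k
    using yang_baxter that by blast
  show "braid (ibr_obj K H r M) \<in> (\<Pi>\<^sub>E (i, j)\<in>{(i, j). 1 \<le> i \<and> i \<le> j \<and> j \<le> r + 2}.
       module_hom K (tensor K (space (ibr_obj K H r M) i) (space (ibr_obj K H r M) j))
         (tensor K (space (ibr_obj K H r M) j) (space (ibr_obj K H r M) i))
         \<inter> extensional (carrier (tensor K (space (ibr_obj K H r M) i) (space (ibr_obj K H r M) j))))"
  proof (rule PiE_I)
    fix p assume "p \<in> {(i, j). 1 \<le> i \<and> i \<le> j \<and> j \<le> r + 2}"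
    then obtain i j where p: "p = (i, j)" and ij: "1 \<le> i" "i \<le> j" "j \<le> r + 2" by auto
    have "s i j \<in> extensional (carrier (tensor K (V i) (V j)))" unfolding s_eq[OF ij] by simp
    then show "braid (ibr_obj K H r M) p \<in> (case p of (i, j) \<Rightarrow>
       module_hom K (tensor K (space (ibr_obj K H r M) i) (space (ibr_obj K H r M) j))
         (tensor K (space (ibr_obj K H r M) j) (space (ibr_obj K H r M) i))
         \<inter> extensional (carrier (tensor K (space (ibr_obj K H r M) i) (space (ibr_obj K H r M) j))))"
      using s_hom[OF ij] by (simp add: p space_obj)
  next
    fix p assume "p \<notin> {(i, j). 1 \<le> i \<and> i \<le> j \<and> j \<le> r + 2}"
    then show "braid (ibr_obj K H r M) p = undefined" by (simp add: ibr_obj_def)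
  qed
qed

end

section \<open>Naturality of the braidings\<close>

text \<open>
  In its application \<open>w\<close> is the coaction of \<open>\<phi> x\<close>, and \<open>eq\<close> says that \<open>\<phi>\<close> is colinear; then \<open>\<phi>\<close> may be
  moved inside the Sweedler components.
\<close>

lemma lift_comodule_map:
  assumes coA: "right_comodule_algebra K H A \<rho>" and A2: "vectorspace K A2"
    and \<phi>: "\<phi> \<in> module_hom K A A2" and x: "x \<in> carrier A"
    and eq: "w = tensor_lift K (tensor K A2 H) (\<rho> x) (\<lambda>x0 x1. pure_tensor K A2 H (\<phi> x0) x1)"
    and U: "vectorspace K U" and b: "bilinear K A2 H U b"
  shows "tensor_lift K U w b = tensor_lift K U (\<rho> x) (\<lambda>x0 x1. b (\<phi> x0) x1)"
proof -
  interpret A: right_comodule_algebra K H A \<rho> by fact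
  note [lin] = A.V.is_vectorspace A.H.is_vectorspace A2 U hom_closed[OF \<phi>] hom_closed[OF A.coaction_linear] x
  have "tensor_lift K U w b = tensor_lift K U (\<rho> x) (\<lambda>x0 x1. tensor_lift K U (pure_tensor K A2 H (\<phi> x0) x1) b)"
    unfolding eq by (rule lift_lift, (rule lin b | assumption)+)
  also have "\<dots> = tensor_lift K U (\<rho> x) (\<lambda>x0 x1. b (\<phi> x0) x1)"
    by (rule A.coaction_cong[OF x U], rule lift_pure, (rule lin b bilinear_closed[OF b] | assumption)+)
  finally show ?thesis .
qed

lemma tensor_map_crossing:
  assumes s: "crossing K A \<rho> e A' B \<alpha> f B' s"
    and coA: "right_comodule_algebra K H A \<rho>" and modB: "left_module_algebra K H B \<alpha>"
    and e: "tagging K A e A'" and f: "tagging K B f B'"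
    and vs: "vectorspace K A2'" "vectorspace K B2'"
    and F: "F \<in> module_hom K A' A2'" and G: "G \<in> module_hom K B' B2'"
    and x: "x \<in> carrier A" and y: "y \<in> carrier B"
  shows "tensor_map K B' A' B2' A2' G F (s (pure_tensor K A' B' (e x) (f y)))
    = tensor_lift K (tensor K B2' A2') (\<rho> x) (\<lambda>x0 x1. pure_tensor K B2' A2' (G (f (\<alpha> x1 y))) (F (e x0)))"
proof -
  interpret A: right_comodule_algebra K H A \<rho> by fact
  interpret B: left_module_algebra K H B \<alpha> by fact
  note [lin] = A.V.is_vectorspace A.H.is_vectorspace B.V.is_vectorspace vs taggingD(1,3)[OF e] taggingD(1,3)[OF f]
    B.action_lin hom_closed[OF F] hom_closed[OF G] x y
  have U: "vectorspace K (tensor K B' A')" "vectorspace K (tensor K B2' A2')" by (rule lin)+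
  have "tensor_map K B' A' B2' A2' G F (s (pure_tensor K A' B' (e x) (f y)))
    = tensor_map K B' A' B2' A2' G F (tensor_lift K (tensor K B' A') (\<rho> x) (\<lambda>x0 x1. pure_tensor K B' A' (f (\<alpha> x1 y)) (e x0)))"
    using s x y by (simp add: crossing_def)
  also have "\<dots> = tensor_lift K (tensor K B2' A2') (\<rho> x) (\<lambda>x0 x1.
      tensor_map K B' A' B2' A2' G F (pure_tensor K B' A' (f (\<alpha> x1 y)) (e x0)))"
    by (rule hom_lift[OF A.V.is_vectorspace A.H.is_vectorspace hom_closed[OF A.coaction_linear x] U], rule tensor_map_hom,
        (rule lin F G | assumption)+)
  also have "\<dots> = tensor_lift K (tensor K B2' A2') (\<rho> x) (\<lambda>x0 x1. pure_tensor K B2' A2' (G (f (\<alpha> x1 y))) (F (e x0)))"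
    by (rule A.coaction_cong[OF x U(2)], rule tensor_map_pure, (rule lin F G | assumption)+)
  finally show ?thesis .
qed

lemma hom_tensor_tagged_eqI:
  assumes e: "tagging K A e A'" and f: "tagging K B f B'" and U: "vectorspace K U"
    and F: "F \<in> module_hom K (tensor K A' B') U" and G: "G \<in> module_hom K (tensor K A' B') U"
    and t: "t \<in> carrier (tensor K A' B')"
    and eq: "\<And>x y. \<lbrakk>x \<in> carrier A; y \<in> carrier B\<rbrakk> \<Longrightarrow> F (pure_tensor K A' B' (e x) (f y)) = G (pure_tensor K A' B' (e x) (f y))"
  shows "F t = G t"
proof (rule hom_tensor_eqI[OF taggingD(1)[OF e] taggingD(1)[OF f] U F G t])
  fix a b assume "a \<in> carrier A'" "b \<in> carrier B'"
  then show "F (pure_tensor K A' B' a b) = G (pure_tensor K A' B' a b)"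
    using taggingD(4)[OF e] taggingD(4)[OF f] eq by metis
qed

text \<open>
  The crossing of \<open>\<phi> x\<close> and \<open>\<psi> y\<close> is \<open>x\<^sub>(\<^sub>1\<^sub>) \<psi> y \<otimes> \<phi> x\<^sub>(\<^sub>0\<^sub>)\<close> as \<open>\<phi>\<close> is colinear, and this is
  \<open>\<psi> (x\<^sub>(\<^sub>1\<^sub>) y) \<otimes> \<phi> x\<^sub>(\<^sub>0\<^sub>)\<close> as \<open>\<psi>\<close> is equivariant.
\<close>

lemma crossing_natural:
  assumes s: "crossing K A \<rho> e A' B \<alpha> f B' s" and s2: "crossing K A2 \<rho>2 e2 A2' B2 \<alpha>2 f2 B2' s2"
    and coA: "right_comodule_algebra K H A \<rho>" and modB: "left_module_algebra K H B \<alpha>"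
    and modB2: "left_module_algebra K H B2 \<alpha>2"
    and e: "tagging K A e A'" and f: "tagging K B f B'" and e2: "tagging K A2 e2 A2'" and f2: "tagging K B2 f2 B2'"
    and A2: "vectorspace K A2"
    and \<phi>: "\<phi> \<in> module_hom K A A2" and \<psi>: "\<psi> \<in> module_hom K B B2"
    and colinear: "\<And>x. x \<in> carrier A \<Longrightarrow>
      \<rho>2 (\<phi> x) = tensor_lift K (tensor K A2 H) (\<rho> x) (\<lambda>x0 x1. pure_tensor K A2 H (\<phi> x0) x1)"
    and equivariant: "\<And>h y. \<lbrakk>h \<in> carrier H; y \<in> carrier B\<rbrakk> \<Longrightarrow> \<psi> (\<alpha> h y) = \<alpha>2 h (\<psi> y)"
    and F: "F \<in> module_hom K A' A2'" "\<And>x. x \<in> carrier A \<Longrightarrow> F (e x) = e2 (\<phi> x)"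
    and G: "G \<in> module_hom K B' B2'" "\<And>y. y \<in> carrier B \<Longrightarrow> G (f y) = f2 (\<psi> y)"
    and t: "t \<in> carrier (tensor K A' B')"
  shows "tensor_map K B' A' B2' A2' G F (s t) = s2 (tensor_map K A' B' A2' B2' F G t)"
proof -
  interpret A: right_comodule_algebra K H A \<rho> by fact
  interpret B: left_module_algebra K H B \<alpha> by fact
  interpret B2: left_module_algebra K H B2 \<alpha>2 by fact
  note [lin] = A.V.is_vectorspace A.H.is_vectorspace B.V.is_vectorspace B2.V.is_vectorspace A2
    taggingD(1,3)[OF e] taggingD(1,3)[OF f] taggingD(1,3)[OF e2] taggingD(1,3)[OF f2]
    hom_compose[OF taggingD(2)[OF e2]] hom_compose[OF taggingD(2)[OF f2]]
    B.action_lin B2.action_lin hom_closed[OF \<phi>] hom_closed[OF \<psi>]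
  have sh: "s \<in> module_hom K (tensor K A' B') (tensor K B' A')"
    and s2h: "s2 \<in> module_hom K (tensor K A2' B2') (tensor K B2' A2')" using s s2 by (simp_all add: crossing_def)
  have T: "vectorspace K (tensor K B2' A2')" by (rule lin)+
  have FG: "tensor_map K A' B' A2' B2' F G \<in> module_hom K (tensor K A' B') (tensor K A2' B2')"
    and GF: "tensor_map K B' A' B2' A2' G F \<in> module_hom K (tensor K B' A') (tensor K B2' A2')"
    by (rule tensor_map_hom, (rule lin F G)+)+
  show ?thesis
  proof (rule hom_tensor_tagged_eqI[OF e f T hom_compose[OF GF sh] hom_compose[OF s2h FG] t])
    fix x y assume x [lin]: "x \<in> carrier A" and y [lin]: "y \<in> carrier B"
    have "s2 (tensor_map K A' B' A2' B2' F G (pure_tensor K A' B' (e x) (f y)))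
      = s2 (pure_tensor K A2' B2' (e2 (\<phi> x)) (f2 (\<psi> y)))"
      by (subst tensor_map_pure) (simp_all add: F G x y lin)
    also have "\<dots> = tensor_lift K (tensor K B2' A2') (\<rho>2 (\<phi> x)) (\<lambda>x0 x1. pure_tensor K B2' A2' (f2 (\<alpha>2 x1 (\<psi> y))) (e2 x0))"
      using s2 by (simp add: crossing_def lin)
    also have "\<dots> = tensor_lift K (tensor K B2' A2') (\<rho> x) (\<lambda>x0 x1. pure_tensor K B2' A2' (f2 (\<alpha>2 x1 (\<psi> y))) (e2 (\<phi> x0)))"
      by (rule lift_comodule_map[OF coA A2 \<phi> x colinear[OF x] T], (rule lin | assumption)+)
    also have "\<dots> = tensor_lift K (tensor K B2' A2') (\<rho> x) (\<lambda>x0 x1. pure_tensor K B2' A2' (G (f (\<alpha> x1 y))) (F (e x0)))"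
      using y by (intro A.coaction_cong[OF x T]) (simp_all add: F G equivariant lin)
    also have "\<dots> = tensor_map K B' A' B2' A2' G F (s (pure_tensor K A' B' (e x) (f y)))"
      by (rule tensor_map_crossing[OF s coA modB e f _ _ F(1) G(1) x y, symmetric]) (rule lin)+
    finally show "tensor_map K B' A' B2' A2' G F (s (pure_tensor K A' B' (e x) (f y)))
      = s2 (tensor_map K A' B' A2' B2' F G (pure_tensor K A' B' (e x) (f y)))" ..
  qed
qed

lemma unit_braiding_natural:
  assumes s: "left_unit_braiding K A e A' s \<and> left_unit_braiding K A2 e2 A2' s2 \<or>
      right_unit_braiding K A e A' s \<and> right_unit_braiding K A2 e2 A2' s2"
    and A: "unital_algebra K A" and A2: "unital_algebra K A2"
    and e: "tagging K A e A'" and e2: "tagging K A2 e2 A2'"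
    and \<phi>: "\<And>x. x \<in> carrier A \<Longrightarrow> \<phi> x \<in> carrier A2"
      "\<And>x y. \<lbrakk>x \<in> carrier A; y \<in> carrier A\<rbrakk> \<Longrightarrow> \<phi> (x \<otimes>\<^bsub>A\<^esub> y) = \<phi> x \<otimes>\<^bsub>A2\<^esub> \<phi> y" "\<phi> \<one>\<^bsub>A\<^esub> = \<one>\<^bsub>A2\<^esub>"
    and F: "F \<in> module_hom K A' A2'" "\<And>x. x \<in> carrier A \<Longrightarrow> F (e x) = e2 (\<phi> x)"
    and t: "t \<in> carrier (tensor K A' A')"
  shows "tensor_map K A' A' A2' A2' F F (s t) = s2 (tensor_map K A' A' A2' A2' F F t)"
proof -
  interpret A: unital_algebra K A by fact
  interpret A2: unital_algebra K A2 by fact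
  note [lin] = A.is_vectorspace A2.is_vectorspace taggingD(1,3)[OF e] taggingD(1,3)[OF e2] A.mult_lin A2.mult_lin
  have sh: "s \<in> module_hom K (tensor K A' A') (tensor K A' A')"
    and s2h: "s2 \<in> module_hom K (tensor K A2' A2') (tensor K A2' A2')"
    using s by (auto simp add: left_unit_braiding_def right_unit_braiding_def)
  have T: "vectorspace K (tensor K A2' A2')" by (rule lin)+
  have FF: "tensor_map K A' A' A2' A2' F F \<in> module_hom K (tensor K A' A') (tensor K A2' A2')"
    by (rule tensor_map_hom, (rule lin F)+)
  have FFp: "tensor_map K A' A' A2' A2' F F (pure_tensor K A' A' (e x) (e y)) = pure_tensor K A2' A2' (e2 (\<phi> x)) (e2 (\<phi> y))"
    if "x \<in> carrier A" "y \<in> carrier A" for x y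
    using that by (subst tensor_map_pure) (simp_all add: F lin)
  show ?thesis
  proof (rule hom_tensor_tagged_eqI[OF e e T hom_compose[OF FF sh] hom_compose[OF s2h FF] t])
    fix x y assume x: "x \<in> carrier A" and y: "y \<in> carrier A"
    show "tensor_map K A' A' A2' A2' F F (s (pure_tensor K A' A' (e x) (e y)))
      = s2 (tensor_map K A' A' A2' A2' F F (pure_tensor K A' A' (e x) (e y)))"
      using s x y by (auto simp: left_unit_braiding_def right_unit_braiding_def FFp \<phi>)
  qed
qed

lemma tensor_map_ident:
  assumes vs [lin]: "vectorspace K A" "vectorspace K B"
    and F: "\<And>x. x \<in> carrier A \<Longrightarrow> F x = x" and G: "\<And>y. y \<in> carrier B \<Longrightarrow> G y = y"
    and t: "t \<in> carrier (tensor K A B)"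
  shows "tensor_map K A B A B F G t = t"
proof -
  have h: "F \<in> module_hom K A A" "G \<in> module_hom K B B"
    using F G by (auto intro: hom_cong[OF vs(1) _ hom_id] hom_cong[OF vs(2) _ hom_id])
  show ?thesis
    by (rule hom_tensor_eqI[OF vs tensor_vectorspace[OF vs] tensor_map_hom[OF vs vs h] hom_id t])
      (simp add: tensor_map_pure[OF vs vs h] F G)
qed

lemma tensor_map_comp:
  assumes vs: "vectorspace K A" "vectorspace K B" "vectorspace K A2" "vectorspace K B2" "vectorspace K A3" "vectorspace K B3"
    and f: "f \<in> module_hom K A A2" "g \<in> module_hom K B B2" and f': "f' \<in> module_hom K A2 A3" "g' \<in> module_hom K B2 B3"
    and F: "\<And>x. x \<in> carrier A \<Longrightarrow> F x = f' (f x)" and G: "\<And>y. y \<in> carrier B \<Longrightarrow> G y = g' (g y)"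
    and t: "t \<in> carrier (tensor K A B)"
  shows "tensor_map K A B A3 B3 F G t = tensor_map K A2 B2 A3 B3 f' g' (tensor_map K A B A2 B2 f g t)"
proof -
  have h: "F \<in> module_hom K A A3" "G \<in> module_hom K B B3"
    using F G by (auto intro: hom_cong[OF vs(1) _ hom_compose[OF f'(1) f(1)]] hom_cong[OF vs(2) _ hom_compose[OF f'(2) f(2)]])
  show ?thesis
    by (rule hom_tensor_eqI[OF vs(1,2) tensor_vectorspace[OF vs(5,6)] tensor_map_hom[OF vs(1,2,5,6) h]
          hom_compose[OF tensor_map_hom[OF vs(3-6) f'] tensor_map_hom[OF vs(1-4) f]] t])
      (simp add: tensor_map_pure[OF vs(1,2,5,6) h] tensor_map_pure[OF vs(1-4) f] tensor_map_pure[OF vs(3-6) f']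
        F G hom_closed[OF f(1)] hom_closed[OF f(2)])
qed

section \<open>The categories\<close>

lemma yd_homI:
  assumes "f \<in> extensional (carrier M)" "f \<in> module_hom K M N"
    and "\<And>x y. \<lbrakk>x \<in> carrier M; y \<in> carrier M\<rbrakk> \<Longrightarrow> f (x \<otimes>\<^bsub>M\<^esub> y) = f x \<otimes>\<^bsub>N\<^esub> f y" "f \<one>\<^bsub>M\<^esub> = \<one>\<^bsub>N\<^esub>"
    and "\<And>h v. \<lbrakk>h \<in> carrier H; v \<in> carrier M\<rbrakk> \<Longrightarrow> f (act M h v) = act N h (f v)"
    and "\<And>v. v \<in> carrier M \<Longrightarrow>
      coact N (f v) = tensor_lift K (tensor K N H) (coact M v) (\<lambda>v0 v1. pure_tensor K N H (f v0) v1)"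
  shows "f \<in> yd_hom K H M N"
  using assms unfolding yd_hom_def ring_hom_def by (auto simp: hom_closed module_hom_add)

lemma yd_homD:
  assumes "f \<in> yd_hom K H M N"
  shows "f \<in> extensional (carrier M)" "f \<in> module_hom K M N"
    and "\<And>x y. \<lbrakk>x \<in> carrier M; y \<in> carrier M\<rbrakk> \<Longrightarrow> f (x \<otimes>\<^bsub>M\<^esub> y) = f x \<otimes>\<^bsub>N\<^esub> f y" "f \<one>\<^bsub>M\<^esub> = \<one>\<^bsub>N\<^esub>"
    and "\<And>h v. \<lbrakk>h \<in> carrier H; v \<in> carrier M\<rbrakk> \<Longrightarrow> f (act M h v) = act N h (f v)"
    and "\<And>v. v \<in> carrier M \<Longrightarrow>
      coact N (f v) = tensor_lift K (tensor K N H) (coact M v) (\<lambda>v0 v1. pure_tensor K N H (f v0) v1)"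
  using assms unfolding yd_hom_def ring_hom_def by auto

lemma category_YDAlg:
  fixes K :: "('k, 'r) ring_scheme" and H :: "('k, 'h) bialgebra"
  shows "category (YDAlg K H :: (('k, 'h, 'v) yd_algebra, 'v \<Rightarrow> 'v) cat)"
proof (rule category.intro; unfold YDAlg_def cat.simps mem_Collect_eq)
  fix M :: "('k, 'h, 'v) yd_algebra" assume "yd_module_algebra K H M"
  then interpret yd_module_algebra K H M .
  show "(\<lambda>v\<in>carrier M. v) \<in> yd_hom K H M M"
  proof (rule yd_homI)
    show "(\<lambda>v\<in>carrier M. v) \<in> module_hom K M M" by (rule hom_cong[OF M.is_vectorspace _ hom_id]) simp
    fix v assume v: "v \<in> carrier M"
    have "tensor_lift K (tensor K M H) (coact M v) (\<lambda>v0 v1. pure_tensor K M H (restrict (\<lambda>v. v) (carrier M) v0) v1)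
      = tensor_lift K (tensor K M H) (coact M v) (pure_tensor K M H)"
      by (rule right_comodule_algebra.coaction_cong[OF right_comodule_algebra v])
        (simp_all add: tensor_vectorspace pure_tensor_closed M.is_vectorspace H.is_vectorspace)
    then show "coact M (restrict (\<lambda>v. v) (carrier M) v) =
        tensor_lift K (tensor K M H) (coact M v) (\<lambda>v0 v1. pure_tensor K M H (restrict (\<lambda>v. v) (carrier M) v0) v1)"
      using v hom_closed[OF coact_linear v] by (simp add: lift_pure_id M.is_vectorspace H.is_vectorspace)
  qed (simp_all add: hom_closed[OF act_linear_right])
next
  fix L M N :: "('k, 'h, 'v) yd_algebra" and f g
  assume L: "yd_module_algebra K H L" and M: "yd_module_algebra K H M" and N: "yd_module_algebra K H N"
    and f: "f \<in> yd_hom K H L M" and g: "g \<in> yd_hom K H M N"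
  interpret L: yd_module_algebra K H L by fact
  interpret M: yd_module_algebra K H M by fact
  interpret N: yd_module_algebra K H N by fact
  note f = yd_homD[OF f] and g = yd_homD[OF g]
  note [lin] = L.M.is_vectorspace M.M.is_vectorspace N.M.is_vectorspace L.H.is_vectorspace hom_closed[OF f(2)] hom_closed[OF g(2)]
  have T: "vectorspace K (tensor K N H)" by (rule lin)+
  show "compose (carrier L) g f \<in> yd_hom K H L N"
  proof (rule yd_homI)
    show "compose (carrier L) g f \<in> module_hom K L N"
      by (rule hom_cong[OF L.M.is_vectorspace _ hom_compose[OF g(2) f(2)]]) (simp add: compose_eq)
    fix v assume v: "v \<in> carrier L"
    have "coact N (compose (carrier L) g f v) = tensor_lift K (tensor K N H) (coact M (f v)) (\<lambda>w0 w1. pure_tensor K N H (g w0) w1)"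
      using v by (simp add: compose_eq g(6) hom_closed[OF f(2)])
    also have "\<dots> = tensor_lift K (tensor K N H) (coact L v) (\<lambda>v0 v1. pure_tensor K N H (g (f v0)) v1)"
      by (rule lift_comodule_map[OF L.right_comodule_algebra M.M.is_vectorspace f(2) v f(6)[OF v] T],
          (rule lin hom_compose[OF g(2)] | assumption)+)
    also have "\<dots> = tensor_lift K (tensor K N H) (coact L v) (\<lambda>v0 v1. pure_tensor K N H (compose (carrier L) g f v0) v1)"
      by (rule right_comodule_algebra.coaction_cong[OF L.right_comodule_algebra v T]) (simp_all add: compose_eq lin)
    finally show "coact N (compose (carrier L) g f v)
      = tensor_lift K (tensor K N H) (coact L v) (\<lambda>v0 v1. pure_tensor K N H (compose (carrier L) g f v0) v1)" .
  qed (simp_all add: compose_eq f(3-5) g(3-5) hom_closed[OF f(2)] hom_closed[OF L.act_linear_right])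
next
  fix M N :: "('k, 'h, 'v) yd_algebra" and f
  assume "f \<in> yd_hom K H M N"
  note f = yd_homD[OF this]
  show "compose (carrier M) f (\<lambda>v\<in>carrier M. v) = f"
    by (rule extensionalityI[OF compose_extensional f(1)]) (simp add: compose_eq)
  show "compose (carrier M) (\<lambda>v\<in>carrier N. v) f = f"
    by (rule extensionalityI[OF compose_extensional f(1)]) (simp add: compose_eq hom_closed[OF f(2)])
next
  fix A B C D :: "('k, 'h, 'v) yd_algebra" and f g h
  assume "f \<in> yd_hom K H A B"
  note f = yd_homD[OF this]
  show "compose (carrier A) h (compose (carrier A) g f) = compose (carrier A) (compose (carrier B) h g) f"
    by (rule extensionalityI[OF compose_extensional compose_extensional]) (simp add: compose_eq hom_closed[OF f(2)])
qed

lemma category_power_cat: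
  assumes "category X"
  shows "category (power_cat X r)"
proof -
  interpret category X by fact
  show ?thesis
  proof (rule category.intro; unfold power_cat_def cat.simps)
    fix A B f assume "A \<in> {1..r} \<rightarrow>\<^sub>E Ob X" "B \<in> {1..r} \<rightarrow>\<^sub>E Ob X" and f: "f \<in> (\<Pi>\<^sub>E i\<in>{1..r}. Hom X (A i) (B i))"
    then have "A i \<in> Ob X" "B i \<in> Ob X" "f i \<in> Hom X (A i) (B i)" if "i \<in> {1..r}" for i using that by auto
    then show "(\<lambda>i\<in>{1..r}. Comp X (A i) (A i) (B i) (f i) ((\<lambda>i\<in>{1..r}. Ident X (A i)) i)) = f"
      "(\<lambda>i\<in>{1..r}. Comp X (A i) (B i) (B i) ((\<lambda>i\<in>{1..r}. Ident X (B i)) i) (f i)) = f"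
      using f by (auto intro!: extensionalityI[of _ "{1..r}"] simp: Comp_Ident Ident_Comp PiE_def)
  next
    fix A B C D f g h
    assume "A \<in> {1..r} \<rightarrow>\<^sub>E Ob X" "B \<in> {1..r} \<rightarrow>\<^sub>E Ob X" "C \<in> {1..r} \<rightarrow>\<^sub>E Ob X" "D \<in> {1..r} \<rightarrow>\<^sub>E Ob X"
      "f \<in> (\<Pi>\<^sub>E i\<in>{1..r}. Hom X (A i) (B i))" "g \<in> (\<Pi>\<^sub>E i\<in>{1..r}. Hom X (B i) (C i))"
      "h \<in> (\<Pi>\<^sub>E i\<in>{1..r}. Hom X (C i) (D i))"
    then show "(\<lambda>i\<in>{1..r}. Comp X (A i) (C i) (D i) (h i) ((\<lambda>i\<in>{1..r}. Comp X (A i) (B i) (C i) (g i) (f i)) i))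
      = (\<lambda>i\<in>{1..r}. Comp X (A i) (B i) (D i) ((\<lambda>i\<in>{1..r}. Comp X (B i) (C i) (D i) (h i) (g i)) i) (f i))"
      by (intro restrict_ext) (auto intro!: Comp_assoc)
  qed (auto intro!: Ident_in Comp_in)
qed

lemma braided_systemD:
  assumes "braided_system K t S"
  shows "\<lbrakk>1 \<le> i; i \<le> t\<rbrakk> \<Longrightarrow> vectorspace K (space S i)"
    and "\<lbrakk>1 \<le> i; i \<le> j; j \<le> t\<rbrakk> \<Longrightarrow>
      braid S (i, j) \<in> module_hom K (tensor K (space S i) (space S j)) (tensor K (space S j) (space S i))"
  using assms unfolding braided_system_def by (auto dest!: PiE_mem[where x = "(i, j)"])

lemma braided_homI:
  assumes "f \<in> extensional {1..t}"
    and "\<And>i. \<lbrakk>1 \<le> i; i \<le> t\<rbrakk> \<Longrightarrow> f i \<in> module_hom K (space S i) (space S' i)"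
    and "\<And>i. \<lbrakk>1 \<le> i; i \<le> t\<rbrakk> \<Longrightarrow> f i \<in> extensional (carrier (space S i))"
    and "\<And>i j x. \<lbrakk>1 \<le> i; i \<le> j; j \<le> t; x \<in> carrier (tensor K (space S i) (space S j))\<rbrakk> \<Longrightarrow>
      tensor_map K (space S j) (space S i) (space S' j) (space S' i) (f j) (f i) (braid S (i, j) x)
      = braid S' (i, j) (tensor_map K (space S i) (space S j) (space S' i) (space S' j) (f i) (f j) x)"
  shows "f \<in> braided_hom K t S S'"
  using assms unfolding braided_hom_def by (auto simp: PiE_def)

lemma braided_homD:
  assumes "f \<in> braided_hom K t S S'"
  shows "f \<in> extensional {1..t}"
    and "\<And>i. \<lbrakk>1 \<le> i; i \<le> t\<rbrakk> \<Longrightarrow> f i \<in> module_hom K (space S i) (space S' i)"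
    and "\<And>i. \<lbrakk>1 \<le> i; i \<le> t\<rbrakk> \<Longrightarrow> f i \<in> extensional (carrier (space S i))"
    and "\<And>i j x. \<lbrakk>1 \<le> i; i \<le> j; j \<le> t; x \<in> carrier (tensor K (space S i) (space S j))\<rbrakk> \<Longrightarrow>
      tensor_map K (space S j) (space S i) (space S' j) (space S' i) (f j) (f i) (braid S (i, j) x)
      = braid S' (i, j) (tensor_map K (space S i) (space S j) (space S' i) (space S' j) (f i) (f j) x)"
  using assms unfolding braided_hom_def by (auto simp: PiE_def)

lemma category_BrSyst:
  fixes K :: "('k, 'r) ring_scheme"
  shows "category (BrSyst K t :: (('k, 'u) brsystem, nat \<Rightarrow> 'u \<Rightarrow> 'u) cat)"
proof (rule category.intro; unfold BrSyst_def cat.simps mem_Collect_eq)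
  fix S :: "('k, 'u) brsystem" assume S: "braided_system K t S"
  note vs = braided_systemD(1)[OF S] and br = braided_systemD(2)[OF S]
  show "(\<lambda>i\<in>{1..t}. \<lambda>x\<in>carrier (space S i). x) \<in> braided_hom K t S S"
  proof (rule braided_homI)
    fix i assume i: "1 \<le> i" "i \<le> t"
    show "(\<lambda>i\<in>{1..t}. \<lambda>x\<in>carrier (space S i). x) i \<in> module_hom K (space S i) (space S i)"
      by (rule hom_cong[OF vs[OF i] _ hom_id]) (use i in auto)
  next
    fix i j x assume ij: "1 \<le> i" "i \<le> j" "j \<le> t" and x: "x \<in> carrier (tensor K (space S i) (space S j))"
    then show "tensor_map K (space S j) (space S i) (space S j) (space S i)
        ((\<lambda>i\<in>{1..t}. \<lambda>x\<in>carrier (space S i). x) j) ((\<lambda>i\<in>{1..t}. \<lambda>x\<in>carrier (space S i). x) i) (braid S (i, j) x)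
      = braid S (i, j) (tensor_map K (space S i) (space S j) (space S i) (space S j)
        ((\<lambda>i\<in>{1..t}. \<lambda>x\<in>carrier (space S i). x) i) ((\<lambda>i\<in>{1..t}. \<lambda>x\<in>carrier (space S i). x) j) x)"
      using hom_closed[OF br[OF ij] x] vs by (simp add: tensor_map_ident)
  qed auto
next
  fix R S T :: "('k, 'u) brsystem" and f g
  assume R: "braided_system K t R" and S: "braided_system K t S" and T: "braided_system K t T"
    and f: "f \<in> braided_hom K t R S" and g: "g \<in> braided_hom K t S T"
  note vs = braided_systemD(1)[OF R] braided_systemD(1)[OF S] braided_systemD(1)[OF T]
  note f = braided_homD[OF f] and g = braided_homD[OF g]
  let ?c = "\<lambda>i\<in>{1..t}. compose (carrier (space R i)) (g i) (f i)"
  show "?c \<in> braided_hom K t R T"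
  proof (rule braided_homI)
    fix i assume i: "1 \<le> i" "i \<le> t"
    show "?c i \<in> module_hom K (space R i) (space T i)"
      by (rule hom_cong[OF vs(1)[OF i] _ hom_compose[OF g(2)[OF i] f(2)[OF i]]]) (use i in \<open>simp add: compose_eq\<close>)
  next
    fix i j x assume ij: "1 \<le> i" "i \<le> j" "j \<le> t" and x: "x \<in> carrier (tensor K (space R i) (space R j))"
    then have i: "1 \<le> i" "i \<le> t" and j: "1 \<le> j" "j \<le> t" by auto
    have c: "?c k y = g k (f k y)" if "1 \<le> k" "k \<le> t" "y \<in> carrier (space R k)" for k y
      using that by (simp add: compose_eq)
    have comp: "tensor_map K (space R i) (space R j) (space T i) (space T j) (?c i) (?c j) x
      = tensor_map K (space S i) (space S j) (space T i) (space T j) (g i) (g j)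
          (tensor_map K (space R i) (space R j) (space S i) (space S j) (f i) (f j) x)"
      by (rule tensor_map_comp[OF vs(1)[OF i] vs(1)[OF j] vs(2)[OF i] vs(2)[OF j] vs(3)[OF i] vs(3)[OF j]
        f(2)[OF i] f(2)[OF j] g(2)[OF i] g(2)[OF j] c[OF i] c[OF j] x])
    have comp': "tensor_map K (space R j) (space R i) (space T j) (space T i) (?c j) (?c i) (braid R (i, j) x)
      = tensor_map K (space S j) (space S i) (space T j) (space T i) (g j) (g i)
          (tensor_map K (space R j) (space R i) (space S j) (space S i) (f j) (f i) (braid R (i, j) x))"
      by (rule tensor_map_comp[OF vs(1)[OF j] vs(1)[OF i] vs(2)[OF j] vs(2)[OF i] vs(3)[OF j] vs(3)[OF i]
        f(2)[OF j] f(2)[OF i] g(2)[OF j] g(2)[OF i] c[OF j] c[OF i] hom_closed[OF braided_systemD(2)[OF R ij] x]])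
    have fx: "tensor_map K (space R i) (space R j) (space S i) (space S j) (f i) (f j) x
        \<in> carrier (tensor K (space S i) (space S j))"
      by (rule hom_closed[OF tensor_map_hom[OF vs(1)[OF i] vs(1)[OF j] vs(2)[OF i] vs(2)[OF j] f(2)[OF i] f(2)[OF j]] x])
    show "tensor_map K (space R j) (space R i) (space T j) (space T i) (?c j) (?c i) (braid R (i, j) x)
      = braid T (i, j) (tensor_map K (space R i) (space R j) (space T i) (space T j) (?c i) (?c j) x)"
      by (simp only: comp comp' f(4)[OF ij x] g(4)[OF ij fx])
  qed auto
next
  fix S T :: "('k, 'u) brsystem" and f
  assume "f \<in> braided_hom K t S T"
  note f = braided_homD[OF this]
  have eq: "g = f i" if "1 \<le> i" "i \<le> t" "g \<in> extensional (carrier (space S i))"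
    "\<And>x. x \<in> carrier (space S i) \<Longrightarrow> g x = f i x" for i g
    using that f(3) by (auto intro: extensionalityI)
  show "(\<lambda>i\<in>{1..t}. compose (carrier (space S i)) (f i) ((\<lambda>i\<in>{1..t}. \<lambda>x\<in>carrier (space S i). x) i)) = f"
    by (rule extensionalityI[OF restrict_extensional f(1)], simp, rule eq)
      (simp_all add: compose_eq hom_closed[OF f(2)])
  show "(\<lambda>i\<in>{1..t}. compose (carrier (space S i)) ((\<lambda>i\<in>{1..t}. \<lambda>x\<in>carrier (space T i). x) i) (f i)) = f"
    by (rule extensionalityI[OF restrict_extensional f(1)], simp, rule eq)
      (simp_all add: compose_eq hom_closed[OF f(2)])
next
  fix A B C D :: "('k, 'u) brsystem" and f g h
  assume "f \<in> braided_hom K t A B"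
  note f = braided_homD[OF this]
  show "(\<lambda>i\<in>{1..t}. compose (carrier (space A i)) (h i) ((\<lambda>i\<in>{1..t}. compose (carrier (space A i)) (g i) (f i)) i))
    = (\<lambda>i\<in>{1..t}. compose (carrier (space A i)) ((\<lambda>i\<in>{1..t}. compose (carrier (space B i)) (h i) (g i)) i) (f i))"
    by (rule restrict_ext, rule extensionalityI[OF compose_extensional compose_extensional])
      (simp add: compose_eq hom_closed[OF f(2)])
qed

section \<open>The functor\<close>

lemma lift_tensor_map_crossing:
  assumes s: "crossing K A \<rho> e A' B \<alpha> f B' s"
    and coA: "right_comodule_algebra K H A \<rho>" and modB: "left_module_algebra K H B \<alpha>"
    and e: "tagging K A e A'" and f: "tagging K B f B'"
    and vs: "vectorspace K A2'" "vectorspace K B2'" "vectorspace K U"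
    and F: "F \<in> module_hom K A' A2'" and G: "G \<in> module_hom K B' B2'"
    and b: "bilinear K B2' A2' U b"
    and x: "x \<in> carrier A" and y: "y \<in> carrier B"
  shows "tensor_lift K U (tensor_map K B' A' B2' A2' G F (s (pure_tensor K A' B' (e x) (f y)))) b
    = tensor_lift K U (\<rho> x) (\<lambda>x0 x1. b (G (f (\<alpha> x1 y))) (F (e x0)))"
proof -
  interpret A: right_comodule_algebra K H A \<rho> by fact
  interpret B: left_module_algebra K H B \<alpha> by fact
  note [lin] = A.V.is_vectorspace A.H.is_vectorspace B.V.is_vectorspace vs taggingD(1,3)[OF e] taggingD(1,3)[OF f]
    B.action_lin hom_closed[OF F] hom_closed[OF G] hom_closed[OF A.coaction_linear] x y
  have "tensor_lift K U (tensor_map K B' A' B2' A2' G F (s (pure_tensor K A' B' (e x) (f y)))) b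
    = tensor_lift K U (\<rho> x) (\<lambda>x0 x1. tensor_lift K U (pure_tensor K B2' A2' (G (f (\<alpha> x1 y))) (F (e x0))) b)"
    unfolding tensor_map_crossing[OF s coA modB e f vs(1,2) F G x y]
    by (rule lift_lift, (rule lin b | assumption)+)
  also have "\<dots> = tensor_lift K U (\<rho> x) (\<lambda>x0 x1. b (G (f (\<alpha> x1 y))) (F (e x0)))"
    by (rule A.coaction_cong[OF x vs(3)], rule lift_pure, (rule lin b bilinear_closed[OF b] | assumption)+)
  finally show ?thesis .
qed

lemma (in right_comodule_algebra) coaction_expand:
  "v \<in> carrier V \<Longrightarrow> \<rho> v = tensor_lift K (tensor K V H) (\<rho> v) (\<lambda>v0 v1. pure_tensor K V H v0 v1)"
  by (rule lift_pure_id[OF V.is_vectorspace H.is_vectorspace hom_closed[OF coaction_linear], symmetric])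

locale yd_family_pair = X: yd_family K H r M + Y: yd_family K H r N
  for K :: "('k, 'r) ring_scheme" and H :: "('k, 'h) bialgebra" and r :: nat
    and M N :: "nat \<Rightarrow> ('k, 'h, 'v) yd_algebra"
begin

abbreviation F where "F f \<equiv> ibr_mor K H r M N f"

lemma mor_H: "h \<in> carrier H \<Longrightarrow> F f 1 (InH h) = InH h"
  using taggingD(3)[OF X.tag_H] by (simp add: ibr_mor_def)

lemma mor_D: "l \<in> carrier (dual_space K H) \<Longrightarrow> F f (r + 2) (InD l) = InD l"
  using taggingD(3)[OF X.tag_D] by (simp add: ibr_mor_def)

lemma mor_M: "\<lbrakk>2 \<le> i; i \<le> r + 1; m \<in> carrier (M (i - 1))\<rbrakk> \<Longrightarrow> F f i (InM m) = InM (f (i - 1) m)"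
  using taggingD(3)[OF X.tag_M[of i]] by (simp add: ibr_mor_def)

lemma mor_hom:
  assumes f: "\<And>i. i \<in> {1..r} \<Longrightarrow> f i \<in> module_hom K (M i) (N i)" and i: "1 \<le> i" "i \<le> r + 2"
  shows "F f i \<in> module_hom K (X.V i) (Y.V i)"
  using i
proof (rule X.position_cases)
  assume "i = 1"
  show ?thesis unfolding \<open>i = 1\<close>
    by (rule hom_tagged[OF X.is_vectorspace X.tag_H taggingD(2)[OF Y.tag_H]]) (rule mor_H)
next
  assume i: "2 \<le> i" "i \<le> r + 1"
  then have "i - 1 \<in> {1..r}" by auto
  interpret M: yd_module_algebra K H "M (i - 1)" by (rule X.mid[OF i])
  show ?thesis
    by (rule hom_tagged[OF M.M.is_vectorspace X.tag_M[OF i] hom_compose[OF taggingD(2)[OF Y.tag_M[OF i]] f[OF \<open>i - 1 \<in> {1..r}\<close>]]])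
      (rule mor_M[OF i])
next
  assume "i = r + 2"
  show ?thesis unfolding \<open>i = r + 2\<close>
    by (rule hom_tagged[OF X.dual_vectorspace X.tag_D taggingD(2)[OF Y.tag_D]]) (rule mor_D)
qed

lemma mor_extensional: "F f \<in> extensional {1..r + 2}"
  "\<lbrakk>1 \<le> i; i \<le> r + 2\<rbrakk> \<Longrightarrow> F f i \<in> extensional (carrier (X.V i))"
  by (simp_all add: ibr_mor_def)

lemma mor_braided:
  assumes f: "\<And>i. i \<in> {1..r} \<Longrightarrow> f i \<in> yd_hom K H (M i) (N i)"
  shows "F f \<in> braided_hom K (r + 2) (ibr_obj K H r M) (ibr_obj K H r N)"
proof (rule braided_homI, unfold X.space_obj Y.space_obj)
  have hom: "F f i \<in> module_hom K (X.V i) (Y.V i)" if "1 \<le> i" "i \<le> r + 2" for i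
    by (rule mor_hom[OF _ that]) (rule yd_homD(2)[OF f])
  show "F f \<in> extensional {1..r + 2}" by (rule mor_extensional)
  show "F f i \<in> module_hom K (X.V i) (Y.V i)" if "1 \<le> i" "i \<le> r + 2" for i
    using that by (intro hom)
  show "F f i \<in> extensional (carrier (X.V i))" if "1 \<le> i" "i \<le> r + 2" for i
    using that by (rule mor_extensional)
  fix i j t assume ij: "1 \<le> i" "i \<le> j" "j \<le> r + 2" and t: "t \<in> carrier (tensor K (X.V i) (X.V j))"
  then have i: "1 \<le> i" "i \<le> r + 2" and j: "1 \<le> j" "j \<le> r + 2" by auto
  note Fi = hom[OF i] and Fj = hom[OF j]
  have f': "f (k - 1) \<in> yd_hom K H (M (k - 1)) (N (k - 1))" if "2 \<le> k" "k \<le> r + 1" for k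
    using that by (intro f) auto
  note fM = yd_homD[OF f']
  have vM: "vectorspace K (M (k - 1))" "vectorspace K (N (k - 1))" "unital_algebra K (M (k - 1))" "unital_algebra K (N (k - 1))"
    if "2 \<le> k" "k \<le> r + 1" for k
  proof -
    interpret M: yd_module_algebra K H "M (k - 1)" by (rule X.mid[OF that])
    interpret N: yd_module_algebra K H "N (k - 1)" by (rule Y.mid[OF that])
    show "vectorspace K (M (k - 1))" "vectorspace K (N (k - 1))" "unital_algebra K (M (k - 1))" "unital_algebra K (N (k - 1))"
      by unfold_locales
  qed
  note coH = X.right_comodule_algebra_self and modD = X.dual_left_module_algebra
  note expand_H = right_comodule_algebra.coaction_expand[OF coH]
  let ?goal = "\<lambda>i j. tensor_map K (X.V j) (X.V i) (Y.V j) (Y.V i) (F f j) (F f i) (X.s i j t)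
      = Y.s i j (tensor_map K (X.V i) (X.V j) (Y.V i) (Y.V j) (F f i) (F f j) t)"
  show "?goal i j"
  proof (cases "i = j")
    case True
    have algH: "unital_algebra K H" by unfold_locales
    show ?thesis using i
    proof (rule X.position_cases)
      assume "i = 1"
      then have ij: "i = 1" "j = 1" using True by auto
      show ?thesis using t Fi unfolding ij
        by - (rule unit_braiding_natural[OF disjI2[OF conjI[OF X.unit_H Y.unit_H]] algH algH X.tag_H Y.tag_H, where \<phi> = "\<lambda>x. x"],
          (assumption | rule mor_H refl)+)
    next
      assume im: "2 \<le> i" "i \<le> r + 1"
      show ?thesis using t Fi unfolding True[symmetric]
        by - (rule unit_braiding_natural[OF disjI1[OF conjI[OF X.unit_M[OF im] Y.unit_M[OF im]]] vM(3,4)[OF im] X.tag_M[OF im] Y.tag_M[OF im],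
            where \<phi> = "f (i - 1)"], (assumption | rule mor_M[OF im] fM(3,4)[OF im] hom_closed[OF fM(2)[OF im]])+)
    next
      assume "i = r + 2"
      then have ij: "i = r + 2" "j = r + 2" using True by auto
      show ?thesis using t Fi unfolding ij
        by - (rule unit_braiding_natural[OF disjI1[OF conjI[OF X.unit_D Y.unit_D]] X.dual_unital_algebra X.dual_unital_algebra X.tag_D Y.tag_D,
            where \<phi> = "\<lambda>x. x"], (assumption | rule mor_D refl)+)
    qed
  next
    case False
    then have less: "i < j" using ij by simp
    have "i = 1 \<or> 2 \<le> i" "i \<le> r + 1" using less ij by auto
    moreover have "j \<le> r + 1 \<or> j = r + 2" "2 \<le> j" using less ij by auto
    ultimately consider "i = 1" "2 \<le> j" "j \<le> r + 1" | "i = 1" "j = r + 2"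
      | "2 \<le> i" "i \<le> r + 1" "2 \<le> j" "j \<le> r + 1" | "2 \<le> i" "i \<le> r + 1" "j = r + 2" by blast
    then show ?thesis
    proof cases
      case 1
      note jm = 1(2,3)
      show ?thesis using t Fi Fj unfolding 1(1)
        by - (rule crossing_natural[OF X.crossing_HM[OF jm] Y.crossing_HM[OF jm] coH X.modM[OF jm] Y.modM[OF jm]
              X.tag_H X.tag_M[OF jm] Y.tag_H Y.tag_M[OF jm] X.is_vectorspace, where \<phi> = "\<lambda>x. x" and \<psi> = "f (j - 1)"],
            (assumption | rule hom_id fM(2)[OF jm] expand_H fM(5)[OF jm] mor_H mor_M[OF jm])+)
    next
      case 2
      show ?thesis using t Fi Fj unfolding 2
        by - (rule crossing_natural[OF X.crossing_HD Y.crossing_HD coH modD modD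
              X.tag_H X.tag_D Y.tag_H Y.tag_D X.is_vectorspace, where \<phi> = "\<lambda>x. x" and \<psi> = "\<lambda>x. x"],
            (assumption | rule hom_id expand_H refl mor_H mor_D)+)
    next
      case 3
      note im = 3(1,2) and jm = 3(3,4)
      show ?thesis using t Fi Fj
        by - (rule crossing_natural[OF X.crossing_MM[OF im jm less] Y.crossing_MM[OF im jm less] X.coM[OF im] X.modM[OF jm] Y.modM[OF jm]
              X.tag_M[OF im] X.tag_M[OF jm] Y.tag_M[OF im] Y.tag_M[OF jm] vM(2)[OF im], where \<phi> = "f (i - 1)" and \<psi> = "f (j - 1)"],
            (assumption | rule fM(2)[OF im] fM(2)[OF jm] fM(6)[OF im] fM(5)[OF jm] mor_M[OF im] mor_M[OF jm])+)
    next
      case 4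
      note im = 4(1,2)
      show ?thesis using t Fi Fj unfolding 4(3)
        by - (rule crossing_natural[OF X.crossing_MD[OF im] Y.crossing_MD[OF im] X.coM[OF im] modD modD
              X.tag_M[OF im] X.tag_D Y.tag_M[OF im] Y.tag_D vM(2)[OF im], where \<phi> = "f (i - 1)" and \<psi> = "\<lambda>x. x"],
            (assumption | rule fM(2)[OF im] hom_id fM(6)[OF im] refl mor_M[OF im] mor_D)+)
    qed
  qed
qed

text \<open>
  Each of the three kinds of braidings that involve position \<open>i + 1\<close> determines one structure. In
  each case a bilinear map \<open>b\<close> collapses both sides of the naturality square into \<open>N\<^sub>i\<close>.
\<close>

lemma braided_imp_yd_hom:
  assumes braided: "F f \<in> braided_hom K (r + 2) (ibr_obj K H r M) (ibr_obj K H r N)"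
    and f: "f i \<in> carrier (M i) \<rightarrow>\<^sub>E carrier (N i)" and unit: "f i \<one>\<^bsub>M i\<^esub> = \<one>\<^bsub>N i\<^esub>" and i: "i \<in> {1..r}"
  shows "f i \<in> yd_hom K H (M i) (N i)"
proof -
  define p where "p = i + 1"
  have p: "2 \<le> p" "p \<le> r + 1" and p': "1 \<le> p" "p \<le> r + 2" and pi: "p - 1 = i" using i by (auto simp: p_def)
  interpret M: yd_module_algebra K H "M i" using X.yd[OF i] .
  interpret N: yd_module_algebra K H "N i" using Y.yd[OF i] .
  interpret MA: left_module_algebra K H "M i" "act (M i)" by (rule M.left_module_algebra)
  interpret NA: left_module_algebra K H "N i" "act (N i)" by (rule N.left_module_algebra)
  interpret MC: right_comodule_algebra K H "M i" "coact (M i)" by (rule M.right_comodule_algebra)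
  interpret NC: right_comodule_algebra K H "N i" "coact (N i)" by (rule N.right_comodule_algebra)
  note braided = braided_homD[OF braided, unfolded X.space_obj Y.space_obj]
  note tagM = X.tag_M[OF p, unfolded pi] and tagN = Y.tag_M[OF p, unfolded pi]
  note Fp = mor_M[OF p, unfolded pi]
  note hom_p = braided(2)[OF p']
  have fN: "f i m \<in> carrier (N i)" if "m \<in> carrier (M i)" for m using f that by auto
  have f_hom: "f i \<in> module_hom K (M i) (N i)"
  proof (rule homI)
    fix x y assume xy: "x \<in> carrier (M i)" "y \<in> carrier (M i)"
    have "InM (f i (x \<oplus>\<^bsub>M i\<^esub> y)) = F f p (InM x \<oplus>\<^bsub>X.V p\<^esub> InM y)"
      using xy by (simp add: Fp module_hom_add[OF taggingD(2)[OF tagM], symmetric])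
    also have "\<dots> = InM (f i x) \<oplus>\<^bsub>Y.V p\<^esub> InM (f i y)"
      using xy module_hom_add[OF hom_p] taggingD(3)[OF tagM] by (simp add: Fp)
    also have "\<dots> = InM (f i x \<oplus>\<^bsub>N i\<^esub> f i y)"
      using xy fN by (simp add: module_hom_add[OF taggingD(2)[OF tagN]])
    finally show "f i (x \<oplus>\<^bsub>M i\<^esub> y) = f i x \<oplus>\<^bsub>N i\<^esub> f i y" by simp
  next
    fix a x assume a: "a \<in> carrier K" and x: "x \<in> carrier (M i)"
    have "InM (f i (a \<odot>\<^bsub>M i\<^esub> x)) = F f p (a \<odot>\<^bsub>X.V p\<^esub> InM x)"
      using a x by (simp add: Fp module_hom_smult[OF taggingD(2)[OF tagM], symmetric])
    also have "\<dots> = a \<odot>\<^bsub>Y.V p\<^esub> InM (f i x)"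
      using a x module_hom_smult[OF hom_p] taggingD(3)[OF tagM] by (simp add: Fp)
    also have "\<dots> = InM (a \<odot>\<^bsub>N i\<^esub> f i x)"
      using a x fN by (simp add: module_hom_smult[OF taggingD(2)[OF tagN]])
    finally show "f i (a \<odot>\<^bsub>M i\<^esub> x) = a \<odot>\<^bsub>N i\<^esub> f i x" by simp
  qed (rule fN)
  have V1: "vectorspace K (X.V 1)" "vectorspace K (Y.V 1)" and Vp: "vectorspace K (X.V p)" "vectorspace K (Y.V p)"
    and Vr: "vectorspace K (X.V (r + 2))" "vectorspace K (Y.V (r + 2))"
    using X.V_vectorspace Y.V_vectorspace p' by auto
  have hom_1: "F f 1 \<in> module_hom K (X.V 1) (Y.V 1)" by (rule braided(2)) auto

  have hom_r: "F f (r + 2) \<in> module_hom K (X.V (r + 2)) (Y.V (r + 2))" by (rule braided(2)) auto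
  note vN = N.M.is_vectorspace and vH = X.is_vectorspace and vD = X.dual_vectorspace
  show ?thesis
  proof (rule yd_homI)
    show "f i \<in> extensional (carrier (M i))" using f by (auto simp: PiE_def)
    show "f i \<in> module_hom K (M i) (N i)" by (rule f_hom)
    show "f i \<one>\<^bsub>M i\<^esub> = \<one>\<^bsub>N i\<^esub>" by (rule unit)
  next
    fix x y assume x: "x \<in> carrier (M i)" and y: "y \<in> carrier (M i)"
    \<comment> \<open>The braiding at the repeated position gives \<open>1 \<otimes> f\<^sub>i (x y) = 1 \<otimes> f\<^sub>i x f\<^sub>i y\<close>; multiplication removes the unit.\<close>
    let ?b = "\<lambda>(u :: ('h, 'v, 'h \<Rightarrow> 'k) summand) (v :: ('h, 'v, 'h \<Rightarrow> 'k) summand). unM u \<otimes>\<^bsub>N i\<^esub> unM v"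
    have b: "bilinear K (Y.V p) (Y.V p) (N i) ?b"
      by (rule bilinear_tagged[OF vN vN tagN tagN N.M.mult_bilinear]) simp
    have mems: "InM x \<in> carrier (X.V p)" "InM y \<in> carrier (X.V p)" using x y taggingD(3)[OF tagM] by auto
    have sX: "X.s p p (pure_tensor K (X.V p) (X.V p) (InM x) (InM y)) = pure_tensor K (X.V p) (X.V p) (InM \<one>\<^bsub>M i\<^esub>) (InM (x \<otimes>\<^bsub>M i\<^esub> y))"
      using X.unit_M[OF p, unfolded pi] x y by (simp add: left_unit_braiding_def)
    have sY: "Y.s p p (pure_tensor K (Y.V p) (Y.V p) (InM (f i x)) (InM (f i y)))
      = pure_tensor K (Y.V p) (Y.V p) (InM \<one>\<^bsub>N i\<^esub>) (InM (f i x \<otimes>\<^bsub>N i\<^esub> f i y))"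
      using Y.unit_M[OF p, unfolded pi] fN[OF x] fN[OF y] by (simp add: left_unit_braiding_def)
    have "pure_tensor K (Y.V p) (Y.V p) (InM \<one>\<^bsub>N i\<^esub>) (InM (f i (x \<otimes>\<^bsub>M i\<^esub> y)))
      = tensor_map K (X.V p) (X.V p) (Y.V p) (Y.V p) (F f p) (F f p) (X.s p p (pure_tensor K (X.V p) (X.V p) (InM x) (InM y)))"
      unfolding sX using x y taggingD(3)[OF tagM]
      by (subst tensor_map_pure[OF Vp(1) Vp(1) Vp(2) Vp(2) hom_p hom_p]) (simp_all add: Fp unit)
    also have "\<dots> = Y.s p p (tensor_map K (X.V p) (X.V p) (Y.V p) (Y.V p) (F f p) (F f p) (pure_tensor K (X.V p) (X.V p) (InM x) (InM y)))"
      by (rule braided(4)[OF p'(1) order_refl p'(2) pure_tensor_closed[OF Vp(1) Vp(1) mems]])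
    also have "\<dots> = pure_tensor K (Y.V p) (Y.V p) (InM \<one>\<^bsub>N i\<^esub>) (InM (f i x \<otimes>\<^bsub>N i\<^esub> f i y))"
      unfolding tensor_map_pure[OF Vp(1) Vp(1) Vp(2) Vp(2) hom_p hom_p mems] Fp[OF x] Fp[OF y] by (rule sY)
    finally have "tensor_lift K (N i) (pure_tensor K (Y.V p) (Y.V p) (InM \<one>\<^bsub>N i\<^esub>) (InM (f i (x \<otimes>\<^bsub>M i\<^esub> y)))) ?b
      = tensor_lift K (N i) (pure_tensor K (Y.V p) (Y.V p) (InM \<one>\<^bsub>N i\<^esub>) (InM (f i x \<otimes>\<^bsub>N i\<^esub> f i y))) ?b" by simp
    then show "f i (x \<otimes>\<^bsub>M i\<^esub> y) = f i x \<otimes>\<^bsub>N i\<^esub> f i y"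
      using x y fN taggingD(3)[OF tagN] by (simp add: lift_pure[OF Vp(2) Vp(2) vN b])
  next
    fix h m assume h: "h \<in> carrier H" and m: "m \<in> carrier (M i)"
    \<comment> \<open>The crossing with \<open>H\<close> leaves \<open>h\<^sub>(\<^sub>1\<^sub>)\<close> as right factor; the counit removes it.\<close>
    let ?b = "\<lambda>(u :: ('h, 'v, 'h \<Rightarrow> 'k) summand) (v :: ('h, 'v, 'h \<Rightarrow> 'k) summand). counit H (unH v) \<odot>\<^bsub>N i\<^esub> unM u"
    have b: "bilinear K (Y.V p) (Y.V 1) (N i) ?b"
      by (rule bilinear_tagged[OF vN vH tagN Y.tag_H, where b = "\<lambda>n h. counit H h \<odot>\<^bsub>N i\<^esub> n"])
        (auto intro!: bilinearI hom_scalar[OF vN X.counit_linear] hom_smult[OF vN _ hom_id] X.counit_closed)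
    have mems: "InH h \<in> carrier (X.V 1)" "InM m \<in> carrier (X.V p)"
      using taggingD(3)[OF X.tag_H h] taggingD(3)[OF tagM m] by auto
    let ?t = "pure_tensor K (X.V 1) (X.V p) (InH h) (InM m)"
    have act_hom: "(\<lambda>h. f i (act (M i) h m)) \<in> module_hom K H (N i)"
      using hom_compose[OF f_hom M.act_linear_left[OF m]] .
    have "f i (act (M i) h m) = tensor_lift K (N i) (comult H h) (\<lambda>h1 h2. counit H h1 \<odot>\<^bsub>N i\<^esub> f i (act (M i) h2 m))"
      by (rule X.lift_counit_left[OF vN act_hom h, symmetric])
    also have "\<dots> = tensor_lift K (N i) (comult H h) (\<lambda>h1 h2. ?b (F f p (InM (act (M i) h2 m))) (F f 1 (InH h1)))"
      using hom_closed[OF act_hom] MA.action_lin(3) m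
      by (intro X.comult_cong[OF h vN]) (simp_all add: Fp mor_H[unfolded One_nat_def] X.counit_closed fN)
    also have "\<dots> = tensor_lift K (N i) (tensor_map K (X.V p) (X.V 1) (Y.V p) (Y.V 1) (F f p) (F f 1) (X.s 1 p ?t)) ?b"
      by (rule lift_tensor_map_crossing[OF X.crossing_HM[OF p, unfolded pi] X.right_comodule_algebra_self M.left_module_algebra
            X.tag_H tagM V1(2) Vp(2) vN hom_1 hom_p b h m, symmetric])
    also have "\<dots> = tensor_lift K (N i) (Y.s 1 p (pure_tensor K (Y.V 1) (Y.V p) (InH h) (InM (f i m)))) ?b"
      using braided(4)[OF order_refl p' pure_tensor_closed[OF V1(1) Vp(1) mems]]
        tensor_map_pure[OF V1(1) Vp(1) V1(2) Vp(2) hom_1 hom_p mems] mor_H[OF h] Fp[OF m] by simp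
    also have "\<dots> = tensor_lift K (N i) (comult H h) (\<lambda>h1 h2. ?b (InM (act (N i) h2 (f i m))) (InH h1))"
      by (rule crossing_lift[OF Y.crossing_HM[OF p, unfolded pi] X.right_comodule_algebra_self N.left_module_algebra
            Y.tag_H tagN vN b h fN[OF m]])
    also have "\<dots> = act (N i) h (f i m)"
      using X.lift_counit_left[OF vN N.act_linear_left[OF fN[OF m]] h] by simp
    finally show "f i (act (M i) h m) = act (N i) h (f i m)" .
  next
    fix m assume m: "m \<in> carrier (M i)"
    have T: "vectorspace K (tensor K (N i) H)" by (rule tensor_vectorspace[OF vN vH])
    let ?u = "tensor_lift K (tensor K (N i) H) (coact (M i) m) (\<lambda>m0 m1. pure_tensor K (N i) H (f i m0) m1)"
    have u: "?u \<in> carrier (tensor K (N i) H)"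
      using m fN by (intro MC.coaction_lin(3) T pure_tensor_closed vN vH)
    show "coact (N i) (f i m) = ?u"
    proof (rule X.separated_by_functionals[OF X.fin vN hom_closed[OF N.coact_linear fN[OF m]] u])
      fix l assume l: "l \<in> carrier (dual_space K H)"
      \<comment> \<open>The crossing with \<open>H\<^sup>*\<close> has left factor \<open>m\<^sub>(\<^sub>1\<^sub>) l\<close>, whose value at \<open>1\<close> is \<open>l(m\<^sub>(\<^sub>1\<^sub>))\<close>.\<close>
      let ?b = "\<lambda>(u :: ('h, 'v, 'h \<Rightarrow> 'k) summand) (v :: ('h, 'v, 'h \<Rightarrow> 'k) summand). unD u \<one>\<^bsub>H\<^esub> \<odot>\<^bsub>N i\<^esub> unM v"
      have b: "bilinear K (Y.V (r + 2)) (Y.V p) (N i) ?b"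
        by (rule bilinear_tagged[OF vD vN Y.tag_D tagN, where b = "\<lambda>d n. d \<one>\<^bsub>H\<^esub> \<odot>\<^bsub>N i\<^esub> n"])
          (auto intro!: bilinearI hom_scalar[OF vN X.dual_eval_hom] hom_smult[OF vN _ hom_id] X.dual_closed)
      have lb: "bilinear K (N i) H (N i) (\<lambda>n h. l h \<odot>\<^bsub>N i\<^esub> n)"
        using l by (auto intro!: bilinearI hom_scalar[OF vN X.dual_hom] hom_smult[OF vN _ hom_id] X.dual_closed)
      have mems: "InM m \<in> carrier (X.V p)" "InD l \<in> carrier (X.V (r + 2))"
        using taggingD(3)[OF tagM m] taggingD(3)[OF X.tag_D l] by auto
      let ?t = "pure_tensor K (X.V p) (X.V (r + 2)) (InM m) (InD l)"
      have "tensor_lift K (N i) (coact (N i) (f i m)) (\<lambda>n h. l h \<odot>\<^bsub>N i\<^esub> n)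
        = tensor_lift K (N i) (coact (N i) (f i m)) (\<lambda>n h. ?b (InD (dual_action H h l)) (InM n))"
        using l by (intro NC.coaction_cong[OF fN[OF m] vN]) (simp_all add: X.dual_action_eval X.dual_closed)
      also have "\<dots> = tensor_lift K (N i) (Y.s p (r + 2) (pure_tensor K (Y.V p) (Y.V (r + 2)) (InM (f i m)) (InD l))) ?b"
        by (rule crossing_lift[OF Y.crossing_MD[OF p, unfolded pi] N.right_comodule_algebra X.dual_left_module_algebra
            tagN Y.tag_D vN b fN[OF m] l, symmetric])
      also have "\<dots> = tensor_lift K (N i) (tensor_map K (X.V (r + 2)) (X.V p) (Y.V (r + 2)) (Y.V p) (F f (r + 2)) (F f p) (X.s p (r + 2) ?t)) ?b"
        unfolding braided(4)[OF p' order_refl pure_tensor_closed[OF Vp(1) Vr(1) mems]]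
          tensor_map_pure[OF Vp(1) Vr(1) Vp(2) Vr(2) hom_p hom_r mems] mor_D[OF l] Fp[OF m] ..
      also have "\<dots> = tensor_lift K (N i) (coact (M i) m) (\<lambda>m0 m1. ?b (F f (r + 2) (InD (dual_action H m1 l))) (F f p (InM m0)))"
        by (rule lift_tensor_map_crossing[OF X.crossing_MD[OF p, unfolded pi] M.right_comodule_algebra X.dual_left_module_algebra
            tagM X.tag_D Vp(2) Vr(2) vN hom_p hom_r b m l])
      also have "\<dots> = tensor_lift K (N i) (coact (M i) m) (\<lambda>m0 m1. l m1 \<odot>\<^bsub>N i\<^esub> f i m0)"
        using l by (intro MC.coaction_cong[OF m vN])
          (simp_all add: Fp mor_D[unfolded add_2_eq_Suc'] X.dual_action_closed X.dual_action_eval X.dual_closed fN)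
      also have "\<dots> = tensor_lift K (N i) ?u (\<lambda>n h. l h \<odot>\<^bsub>N i\<^esub> n)"
        by (rule lift_comodule_map[OF M.right_comodule_algebra vN f_hom m refl vN lb, symmetric])
      finally show "tensor_lift K (N i) (coact (N i) (f i m)) (\<lambda>n h. l h \<odot>\<^bsub>N i\<^esub> n) = tensor_lift K (N i) ?u (\<lambda>n h. l h \<odot>\<^bsub>N i\<^esub> n)" .
    qed
  qed
qed

end

lemma yd_family_of_power:
  fixes M :: "nat \<Rightarrow> ('k, 'h, 'v) yd_algebra"
  assumes "bialgebra K H" "vectorspace.fin_dim K H"
    and "M \<in> Ob (power_cat (YDAlg K H :: (('k, 'h, 'v) yd_algebra, 'v \<Rightarrow> 'v) cat) r)"
  shows "yd_family K H r M"
  using assms unfolding yd_family_def yd_family_axioms_def by (auto simp: power_cat_def YDAlg_def)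

theorem proposition3p14:
  fixes K :: "('k, 'r) ring_scheme" and H :: "('k, 'h) bialgebra" and r :: nat
  assumes "field K" and "bialgebra K H" and "vectorspace.fin_dim K H"
  shows "faithful_functor
      (power_cat (YDAlg K H :: (('k, 'h, 'v) yd_algebra, 'v \<Rightarrow> 'v) cat) r) (BrSyst K (r + 2))
      (ibr_obj K H r) (ibr_mor K H r) \<and>
    (\<forall>M \<in> Ob (power_cat (YDAlg K H :: (('k, 'h, 'v) yd_algebra, 'v \<Rightarrow> 'v) cat) r).
      \<forall>N \<in> Ob (power_cat (YDAlg K H) r).
      \<forall>f \<in> (\<Pi>\<^sub>E i\<in>{1..r}. carrier (M i) \<rightarrow>\<^sub>E carrier (N i)).
        ibr_mor K H r M N f \<in> Hom (BrSyst K (r + 2)) (ibr_obj K H r M) (ibr_obj K H r N) \<longrightarrow>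
        (\<forall>i\<in>{1..r}. f i \<one>\<^bsub>M i\<^esub> = \<one>\<^bsub>N i\<^esub>) \<longrightarrow>
        (\<forall>i\<in>{1..r}. f i \<in> Hom (YDAlg K H) (M i) (N i)))"
proof
  let ?X = "power_cat (YDAlg K H :: (('k, 'h, 'v) yd_algebra, 'v \<Rightarrow> 'v) cat) r"
  let ?Y = "BrSyst K (r + 2) :: (('k, ('h, 'v, 'h \<Rightarrow> 'k) summand) brsystem, _) cat"
  note family = yd_family_of_power[OF assms(2,3)]
  have pair: "yd_family_pair K H r M N" if "M \<in> Ob ?X" "N \<in> Ob ?X" for M N
    using family[OF that(1)] family[OF that(2)] by (rule yd_family_pair.intro)
  have hom_X: "f i \<in> yd_hom K H (M i) (N i)" if "f \<in> Hom ?X M N" "i \<in> {1..r}" for f M N i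
    using that by (auto simp: power_cat_def YDAlg_def)
  note mor_M = yd_family_pair.mor_M[OF pair]
  show "faithful_functor ?X ?Y (ibr_obj K H r) (ibr_mor K H r)"
  proof (intro faithful_functor.intro cat_functor.intro category_power_cat category_YDAlg category_BrSyst
      cat_functor_axioms.intro faithful_functor_axioms.intro)
    fix M assume M: "M \<in> Ob ?X"
    interpret M: yd_family K H r M by (rule family[OF M])
    show "ibr_obj K H r M \<in> Ob ?Y" using M.braided_system_ibr by (simp add: BrSyst_def)
    show "ibr_mor K H r M M (Ident ?X M) = Ident ?Y (ibr_obj K H r M)"
    proof -
      have "(if i = 1 \<or> i = r + 2 then x else InM (Ident ?X M (i - 1) (unM x))) = x"
        if i: "i \<in> {1..r + 2}" and x: "x \<in> carrier (M.V i)" for i x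
      proof (cases "i = 1 \<or> i = r + 2")
        case False
        then have im: "2 \<le> i" "i \<le> r + 1" "i - 1 \<in> {1..r}" using i by auto
        obtain m where "m \<in> carrier (M (i - 1))" "x = InM m" using taggingD(4)[OF M.tag_M[OF im(1,2)] x] by blast
        then show ?thesis using False im(3) by (simp add: power_cat_def YDAlg_def)
      qed simp
      then show ?thesis unfolding ibr_mor_def BrSyst_def cat.simps M.space_obj by (intro restrict_ext) auto
    qed
  next
    fix M N f assume M: "M \<in> Ob ?X" and N: "N \<in> Ob ?X" and f: "f \<in> Hom ?X M N"
    interpret yd_family_pair K H r M N by (rule pair[OF M N])
    show "ibr_mor K H r M N f \<in> Hom ?Y (ibr_obj K H r M) (ibr_obj K H r N)"
      using mor_braided[OF hom_X[OF f]] by (simp add: BrSyst_def)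
  next
    fix L M N f g assume L: "L \<in> Ob ?X" and M: "M \<in> Ob ?X" and N: "N \<in> Ob ?X"
      and f: "f \<in> Hom ?X L M" and g: "g \<in> Hom ?X M N"
    interpret LM: yd_family_pair K H r L M by (rule pair[OF L M])
    interpret MN: yd_family_pair K H r M N by (rule pair[OF M N])
    interpret LN: yd_family_pair K H r L N by (rule pair[OF L N])
    have "ibr_mor K H r L N (Comp ?X L M N g f) i x = ibr_mor K H r M N g i (ibr_mor K H r L M f i x)"
      if i: "1 \<le> i" "i \<le> r + 2" and x: "x \<in> carrier (LM.X.V i)" for i x
      using i
    proof (rule LM.X.position_cases)
      assume "i = 1"
      then obtain h where h: "h \<in> carrier H" "x = InH h" using taggingD(4)[OF LM.X.tag_H] x by blast
      show ?thesis unfolding \<open>i = 1\<close> h(2) LM.mor_H[OF h(1)] MN.mor_H[OF h(1)] LN.mor_H[OF h(1)] ..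
    next
      assume im: "2 \<le> i" "i \<le> r + 1"
      then have i1: "i - 1 \<in> {1..r}" by auto
      obtain m where m: "m \<in> carrier (L (i - 1))" "x = InM m" using taggingD(4)[OF LM.X.tag_M[OF im] x] by blast
      have fm: "f (i - 1) m \<in> carrier (M (i - 1))" by (rule hom_closed[OF yd_homD(2)[OF hom_X[OF f i1]] m(1)])
      have "Comp ?X L M N g f (i - 1) m = g (i - 1) (f (i - 1) m)"
        using i1 m(1) by (simp add: power_cat_def YDAlg_def compose_eq)
      then show ?thesis unfolding m(2) LN.mor_M[OF im m(1)] LM.mor_M[OF im m(1)] MN.mor_M[OF im fm] by simp
    next
      assume "i = r + 2"
      then obtain l where l: "l \<in> carrier (dual_space K H)" "x = InD l" using taggingD(4)[OF LM.X.tag_D] x by blast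
      show ?thesis unfolding \<open>i = r + 2\<close> l(2) LM.mor_D[OF l(1)] MN.mor_D[OF l(1)] LN.mor_D[OF l(1)] ..
    qed
    then have "ibr_mor K H r L N (Comp ?X L M N g f) i
      = compose (carrier (LM.X.V i)) (ibr_mor K H r M N g i) (ibr_mor K H r L M f i)" if "i \<in> {1..r + 2}" for i
      using that LN.mor_extensional(2)[of i]
      by (intro extensionalityI[OF _ compose_extensional]) (auto simp: compose_eq)
    then show "ibr_mor K H r L N (Comp ?X L M N g f)
      = Comp ?Y (ibr_obj K H r L) (ibr_obj K H r M) (ibr_obj K H r N) (ibr_mor K H r M N g) (ibr_mor K H r L M f)"
      unfolding BrSyst_def cat.simps LM.X.space_obj
      by (intro extensionalityI[OF LN.mor_extensional(1) restrict_extensional]) simp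
  next
    fix M N assume M: "M \<in> Ob ?X" and N: "N \<in> Ob ?X"
    interpret yd_family_pair K H r M N by (rule pair[OF M N])
    show "inj_on (ibr_mor K H r M N) (Hom ?X M N)"
    proof (rule inj_onI)
      fix f g assume f: "f \<in> Hom ?X M N" and g: "g \<in> Hom ?X M N" and eq: "F f = F g"
      have eqs: "f i = g i" if i: "i \<in> {1..r}" for i
      proof (rule extensionalityI[OF yd_homD(1)[OF hom_X[OF f i]] yd_homD(1)[OF hom_X[OF g i]]])
        fix m assume m: "m \<in> carrier (M i)"
        have "InM (f i m) = F f (i + 1) (InM m)" using mor_M[of "i + 1" m f] i m by simp
        also have "\<dots> = InM (g i m)" unfolding eq using mor_M[of "i + 1" m g] i m by simp
        finally show "f i m = g i m" by simp
      qed
      have "f \<in> extensional {1..r}" "g \<in> extensional {1..r}"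
        using f g by (auto simp: power_cat_def PiE_def)
      then show "f = g" using eqs by (rule extensionalityI)
    qed
  qed
  show "\<forall>M \<in> Ob ?X. \<forall>N \<in> Ob ?X. \<forall>f \<in> (\<Pi>\<^sub>E i\<in>{1..r}. carrier (M i) \<rightarrow>\<^sub>E carrier (N i)).
        ibr_mor K H r M N f \<in> Hom ?Y (ibr_obj K H r M) (ibr_obj K H r N) \<longrightarrow>
        (\<forall>i\<in>{1..r}. f i \<one>\<^bsub>M i\<^esub> = \<one>\<^bsub>N i\<^esub>) \<longrightarrow>
        (\<forall>i\<in>{1..r}. f i \<in> Hom (YDAlg K H) (M i) (N i))"
  proof (intro ballI impI)
    fix M N f i
    assume M: "M \<in> Ob ?X" and N: "N \<in> Ob ?X" and f: "f \<in> (\<Pi>\<^sub>E i\<in>{1..r}. carrier (M i) \<rightarrow>\<^sub>E carrier (N i))"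
      and braided: "ibr_mor K H r M N f \<in> Hom ?Y (ibr_obj K H r M) (ibr_obj K H r N)"
      and unit: "\<forall>i\<in>{1..r}. f i \<one>\<^bsub>M i\<^esub> = \<one>\<^bsub>N i\<^esub>" and i: "i \<in> {1..r}"
    interpret yd_family_pair K H r M N by (rule pair[OF M N])
    show "f i \<in> Hom (YDAlg K H) (M i) (N i)"
      unfolding YDAlg_def cat.simps
      by (rule braided_imp_yd_hom[where f = f and i = i, OF _ PiE_mem[OF f i] bspec[OF unit i] i]) (use braided in \<open>simp add: BrSyst_def\<close>)
  qed
qed

end
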